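(* Let $W\in\mathbb{R}^{d\times n}$ be a $\Delta$-modular matrix. For every $\varepsilon\in(0,1)$ there exists a matrix $W'\in\mathbb{R}^{d\times n'}$ with $n'=O(d/\varepsilon^2)$ such that for all $x\in\mathbb{R}^d$, $$(1-\varepsilon)^2\|W^\top x\|_1\le \|W'^\top x\|_1\le \Delta^2(1+\varepsilon)^2\|W^\top x\|_1.$$ Moreover, the columns of $W'$ are a subset of positively scaled columns of $W$, and $W'$ can be found in polynomial time.
   Context: A matrix $W\in\mathbb{R}^{d\times n}$ is $\Delta$-modular if it has full row rank and every non-singular $d\times d$ submatrix $B$ of $W$ satisfies $1\le|\det(B)|\le\Delta$. Note that $\|W^\top x\|_1$ is the support function of the zonotope $\{Wy:\|y\|_\infty\le1\}$ in direction $x$. *)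

theory Defs
  imports
    Complex_Main
    "Jordan_Normal_Form.DL_Rank"
    "Jordan_Normal_Form.DL_Submatrix"
begin

section \<open>Matrices\<close>

definition delta_modular :: "real \<Rightarrow> real mat \<Rightarrow> bool" where
  "delta_modular \<Delta> W \<longleftrightarrow>
     vec_space.rank (dim_row W) W = dim_row W \<and>
     (\<forall>J. J \<subseteq> {..<dim_col W} \<and> card J = dim_row W \<and> det (submatrix W UNIV J) \<noteq> 0 \<longrightarrow>
        1 \<le> \<bar>det (submatrix W UNIV J)\<bar> \<and> \<bar>det (submatrix W UNIV J)\<bar> \<le> \<Delta>)"

definition l1_norm :: "real vec \<Rightarrow> real" where
  "l1_norm v = (\<Sum>i<dim_vec v. \<bar>v $ i\<bar>)"

text \<open>Injectivity of the index map \<open>f\<close> expresses that every column of \<open>W\<close> is used at most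
  once, so that the columns of \<open>W'\<close> are obtained from a subset of the columns of \<open>W\<close>.\<close>

definition scaled_column_subset :: "real mat \<Rightarrow> real mat \<Rightarrow> bool" where
  "scaled_column_subset W' W \<longleftrightarrow>
     (\<exists>f s. inj_on f {..<dim_col W'} \<and> f ` {..<dim_col W'} \<subseteq> {..<dim_col W} \<and>
        (\<forall>j<dim_col W'. s j > 0 \<and> col W' j = s j \<cdot>\<^sub>v col W (f j)))"


section \<open>A real random access machine\<close>

text \<open>
  The input matrices have real entries, so running time is measured in the arithmetic (real RAM)
  model: a single program handles all dimensions and inputs, and each assignment or test of a
  real or index quantity costs one unit. Since the expressions in a fixed program have bounded
  size, this is the number of elementary operations up to a constant factor.

  Index variables hold natural numbers and real arrays have two indices. To keep the unit cost
  measure honest, there is no rounding, no conversion from reals to indices and no multiplication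
  of indices, and real literals are integers (no arbitrary real constants). Division by zero
  yields zero, as usual in HOL.
\<close>

type_synonym vname = string

datatype nexp =
    NConst nat
  | NVar vname
  | NAdd nexp nexp
  | NSub nexp nexp

datatype rexp =
    RConst int
  | RArr vname nexp nexp
  | RAdd rexp rexp
  | RSub rexp rexp
  | RMul rexp rexp
  | RDiv rexp rexp

datatype bexp =
    NLess nexp nexp
  | RLess rexp rexp
  | BNot bexp
  | BAnd bexp bexp

datatype com =
    Skip
  | NAssign vname nexp
  | RAssign vname nexp nexp rexp
  | Seq com com
  | Cond bexp com com
  | While bexp com

type_synonym nstore = "vname \<Rightarrow> nat"
type_synonym rstore = "vname \<Rightarrow> nat \<Rightarrow> nat \<Rightarrow> real"
type_synonym state = "nstore \<times> rstore"

primrec nval :: "nexp \<Rightarrow> state \<Rightarrow> nat" where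
  "nval (NConst k) \<sigma> = k"
| "nval (NVar x) \<sigma> = fst \<sigma> x"
| "nval (NAdd a b) \<sigma> = nval a \<sigma> + nval b \<sigma>"
| "nval (NSub a b) \<sigma> = nval a \<sigma> - nval b \<sigma>"

primrec rval :: "rexp \<Rightarrow> state \<Rightarrow> real" where
  "rval (RConst z) \<sigma> = of_int z"
| "rval (RArr x a b) \<sigma> = snd \<sigma> x (nval a \<sigma>) (nval b \<sigma>)"
| "rval (RAdd p q) \<sigma> = rval p \<sigma> + rval q \<sigma>"
| "rval (RSub p q) \<sigma> = rval p \<sigma> - rval q \<sigma>"
| "rval (RMul p q) \<sigma> = rval p \<sigma> * rval q \<sigma>"
| "rval (RDiv p q) \<sigma> = rval p \<sigma> / rval q \<sigma>"

primrec bval :: "bexp \<Rightarrow> state \<Rightarrow> bool" where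
  "bval (NLess a b) \<sigma> \<longleftrightarrow> nval a \<sigma> < nval b \<sigma>"
| "bval (RLess p q) \<sigma> \<longleftrightarrow> rval p \<sigma> < rval q \<sigma>"
| "bval (BNot b) \<sigma> \<longleftrightarrow> \<not> bval b \<sigma>"
| "bval (BAnd b c) \<sigma> \<longleftrightarrow> bval b \<sigma> \<and> bval c \<sigma>"

definition nupdate :: "vname \<Rightarrow> nat \<Rightarrow> state \<Rightarrow> state" where
  "nupdate x k \<sigma> = ((fst \<sigma>)(x := k), snd \<sigma>)"

definition rupdate :: "vname \<Rightarrow> nat \<Rightarrow> nat \<Rightarrow> real \<Rightarrow> state \<Rightarrow> state" where
  "rupdate x i j r \<sigma> = (fst \<sigma>, (snd \<sigma>)(x := (snd \<sigma> x)(i := (snd \<sigma> x i)(j := r))))"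

text \<open>\<open>exec c \<sigma> t \<tau>\<close>: started in \<open>\<sigma>\<close>, the program \<open>c\<close> halts after \<open>t\<close> steps in \<open>\<tau>\<close>.\<close>

inductive exec :: "com \<Rightarrow> state \<Rightarrow> nat \<Rightarrow> state \<Rightarrow> bool" where
  exec_Skip: "exec Skip \<sigma> 1 \<sigma>"
| exec_NAssign: "exec (NAssign x a) \<sigma> 1 (nupdate x (nval a \<sigma>) \<sigma>)"
| exec_RAssign: "exec (RAssign x a b p) \<sigma> 1 (rupdate x (nval a \<sigma>) (nval b \<sigma>) (rval p \<sigma>) \<sigma>)"
| exec_Seq: "exec c1 \<sigma>1 t1 \<sigma>2 \<Longrightarrow> exec c2 \<sigma>2 t2 \<sigma>3 \<Longrightarrow> exec (Seq c1 c2) \<sigma>1 (t1 + t2) \<sigma>3"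
| exec_CondTrue: "bval b \<sigma> \<Longrightarrow> exec c1 \<sigma> t \<tau> \<Longrightarrow> exec (Cond b c1 c2) \<sigma> (1 + t) \<tau>"
| exec_CondFalse: "\<not> bval b \<sigma> \<Longrightarrow> exec c2 \<sigma> t \<tau> \<Longrightarrow> exec (Cond b c1 c2) \<sigma> (1 + t) \<tau>"
| exec_WhileFalse: "\<not> bval b \<sigma> \<Longrightarrow> exec (While b c) \<sigma> 1 \<sigma>"
| exec_WhileTrue: "bval b \<sigma>1 \<Longrightarrow> exec c \<sigma>1 t1 \<sigma>2 \<Longrightarrow> exec (While b c) \<sigma>2 t2 \<sigma>3 \<Longrightarrow>
    exec (While b c) \<sigma>1 (1 + t1 + t2) \<sigma>3"

inductive_cases exec_SkipE: "exec Skip \<sigma> t \<tau>"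
inductive_cases exec_NAssignE: "exec (NAssign x a) \<sigma> t \<tau>"
inductive_cases exec_RAssignE: "exec (RAssign x a b p) \<sigma> t \<tau>"
inductive_cases exec_SeqE: "exec (Seq c1 c2) \<sigma> t \<tau>"
inductive_cases exec_CondE: "exec (Cond b c1 c2) \<sigma> t \<tau>"
inductive_cases exec_WhileE: "exec (While b c) \<sigma> t \<tau>"

lemma exec_deterministic:
  "exec c \<sigma> t \<tau> \<Longrightarrow> exec c \<sigma> t' \<tau>' \<Longrightarrow> t' = t \<and> \<tau>' = \<tau>"
proof (induction arbitrary: t' \<tau>' rule: exec.induct)
  case (exec_Skip \<sigma>)
  then show ?case by (elim exec_SkipE) simp
next
  case (exec_NAssign x a \<sigma>)
  then show ?case by (elim exec_NAssignE) simp
next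
  case (exec_RAssign x a b p \<sigma>)
  then show ?case by (elim exec_RAssignE) simp
next
  case (exec_Seq c1 \<sigma>1 t1 \<sigma>2 c2 t2 \<sigma>3)
  from exec_Seq.prems obtain s1 \<rho> s2
    where 1: "t' = s1 + s2" "exec c1 \<sigma>1 s1 \<rho>" "exec c2 \<rho> s2 \<tau>'"
    by (rule exec_SeqE)
  from exec_Seq.IH(1)[OF 1(2)] 1(3) have "exec c2 \<sigma>2 s2 \<tau>'" by simp
  from exec_Seq.IH(2)[OF this] exec_Seq.IH(1)[OF 1(2)] 1(1) show ?case by simp
next
  case (exec_CondTrue b \<sigma> c1 t \<tau> c2)
  from exec_CondTrue.prems exec_CondTrue.hyps(1) obtain s
    where "t' = 1 + s" "exec c1 \<sigma> s \<tau>'"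
    by (elim exec_CondE) simp_all
  with exec_CondTrue.IH[of s \<tau>'] show ?case by simp
next
  case (exec_CondFalse b \<sigma> c2 t \<tau> c1)
  from exec_CondFalse.prems exec_CondFalse.hyps(1) obtain s
    where "t' = 1 + s" "exec c2 \<sigma> s \<tau>'"
    by (elim exec_CondE) simp_all
  with exec_CondFalse.IH[of s \<tau>'] show ?case by simp
next
  case (exec_WhileFalse b \<sigma> c)
  from exec_WhileFalse.prems exec_WhileFalse.hyps(1) show ?case
    by (cases rule: exec_WhileE) auto
next
  case (exec_WhileTrue b \<sigma>1 c t1 \<sigma>2 t2 \<sigma>3)
  from exec_WhileTrue.prems exec_WhileTrue.hyps(1) obtain s1 \<rho> s2
    where 2: "t' = 1 + s1 + s2" "exec c \<sigma>1 s1 \<rho>" "exec (While b c) \<rho> s2 \<tau>'"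
    by (cases rule: exec_WhileE) auto
  from exec_WhileTrue.IH(1)[OF 2(2)] 2(3) have "exec (While b c) \<sigma>2 s2 \<tau>'" by simp
  from exec_WhileTrue.IH(2)[OF this] exec_WhileTrue.IH(1)[OF 2(2)] 2(1) show ?case by simp
qed

text \<open>The whole input is stored in the initial state; everything else is zero.\<close>

definition input_state :: "real mat \<Rightarrow> real \<Rightarrow> real \<Rightarrow> state" where
  "input_state W \<Delta> \<epsilon> =
     ((\<lambda>_. 0)(''d'' := dim_row W, ''n'' := dim_col W),
      (\<lambda>_ _ _. 0)(''W'' := (\<lambda>i j. if i < dim_row W \<and> j < dim_col W then W $$ (i, j) else 0),
                  ''Delta'' := (\<lambda>i j. if i = 0 \<and> j = 0 then \<Delta> else 0),
                  ''eps'' := (\<lambda>i j. if i = 0 \<and> j = 0 then \<epsilon> else 0)))"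

definition output_matrix :: "nat \<Rightarrow> state \<Rightarrow> real mat" where
  "output_matrix d \<sigma> = mat d (fst \<sigma> ''m'') (\<lambda>(i, j). snd \<sigma> ''V'' i j)"

definition computes_within :: "com \<Rightarrow> real mat \<Rightarrow> real \<Rightarrow> real \<Rightarrow> real mat \<Rightarrow> nat \<Rightarrow> bool" where
  "computes_within P W \<Delta> \<epsilon> W' T \<longleftrightarrow>
     (\<exists>t \<tau>. exec P (input_state W \<Delta> \<epsilon>) t \<tau> \<and> t \<le> T \<and> output_matrix (dim_row W) \<tau> = W')"

end

theory Submission
  imports Defs
begin

text \<open>
  Both sides of the claimed inequality are linear on each closed chamber
  of the arrangement of hyperplanes orthogonal to the columns \<open>w_i\<close> of \<open>W\<close>, so it suffices to check
  extreme rays. By Cramer's rule, an extreme ray can be scaled so that every nonzero \<open>w_i \<bullet> x\<close> has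
  absolute value in \<open>[1, \<Delta>]\<close>; there the sums of \<open>|w_i \<bullet> x|\<close> and of \<open>(w_i \<bullet> x)^2\<close> agree up to a factor
  \<open>\<Delta>\<close>, and a spectral sparsifier of \<open>W W^T\<close> is good enough.

  The spectral sparsifier is that of Batson, Spielman and Srivastava, with wasteful constants. To avoid
  square roots and eigenvalues, no change of basis to isotropic position is made. For weights \<open>c\<close>,
  everything is expressed through the kernel \<open>K(i, j) = w_i^T (\<Sum>k. c_k w_k w_k^T)^{-1} w_j\<close>, whose trace is
  the barrier potential. The barriers are \<open>c = u - s\<close> and \<open>c = s - l\<close>; they move by \<open>1 + \<epsilon>/2\<close> and \<open>1\<close> in
  each of about \<open>64 d / \<epsilon>^2\<close> rounds. If this number exceeds \<open>n\<close>, \<open>W\<close> itself is returned, which keeps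
  the running time independent of \<open>\<epsilon>\<close>.
\<close>

section \<open>Positive definite arrays and their inverses\<close>

text \<open>In a basis where \<open>W W^T\<close> is the identity, adding \<open>t\<close> to all
  weights adds \<open>t\<close> times the identity to the Gram matrix, the trace of the kernel is
  the trace of the inverse, and \<open>kernel_total\<close> is the trace of the squared inverse. The
  kernel does not depend on the basis, so the potential argument can be run on its entries, which
  field operations alone compute. Convexity and antitonicity of the matrix inverse become instances
  of positivity and of Cauchy-Schwarz for the form \<open>quad c\<close>.

  The machine shapes the rest: it has no roots, no rounding and no conversion of an index to a real.
  Every Gram matrix to be inverted is positive definite, so elimination runs without pivoting, and
  the number of rounds is found by counting.

  The factor \<open>\<Delta>^2\<close> arises because the quadratic comparison is used in both
  directions and loses \<open>\<Delta>\<close> each time. The weights are rescaled so that these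
  losses and the spectral error all fall on the upper bound; the lower bound is obtained with
  constant 1, which is stronger than \<open>(1 - \<epsilon>)^2\<close>.\<close>

definition posdef :: "nat \<Rightarrow> (nat \<Rightarrow> nat \<Rightarrow> real) \<Rightarrow> bool" where
  "posdef d X \<longleftrightarrow> (\<forall>z. (\<exists>a<d. z a \<noteq> 0) \<longrightarrow> 0 < (\<Sum>a<d. \<Sum>b<d. z a * X a b * z b))"

text \<open>The matrix \<open>N\<close> applied to the change of column \<open>k\<close> from a unit
  vector to column \<open>k\<close> of \<open>X\<close>. Its entry \<open>k\<close> plus one is the
  Sherman-Morrison denominator.\<close>

definition inv_coeff :: "nat \<Rightarrow> (nat \<Rightarrow> nat \<Rightarrow> real) \<Rightarrow> nat \<Rightarrow> (nat \<Rightarrow> nat \<Rightarrow> real) \<Rightarrow> nat \<Rightarrow> real" where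
  "inv_coeff d X k N i = (\<Sum>b<d. N i b * (X b k - of_bool (b = k)))"

text \<open>Step \<open>k\<close> is the Sherman--Morrison update for replacing column \<open>k\<close> of the identity matrix
  by column \<open>k\<close> of \<open>X\<close>.\<close>

primrec inv_iter :: "nat \<Rightarrow> (nat \<Rightarrow> nat \<Rightarrow> real) \<Rightarrow> nat \<Rightarrow> nat \<Rightarrow> nat \<Rightarrow> real" where
  "inv_iter d X 0 = (\<lambda>i j. of_bool (i = j))"
| "inv_iter d X (Suc k) = (\<lambda>i j. inv_iter d X k i j -
     inv_coeff d X k (inv_iter d X k) i * inv_iter d X k k j / (1 + inv_coeff d X k (inv_iter d X k) k))"

lemma sum_of_bool_mult:
  fixes f :: "nat \<Rightarrow> real"
  assumes "j < d"
  shows "(\<Sum>e<d. of_bool (j = e) * f e) = f j" "(\<Sum>e<d. f e * of_bool (e = j)) = f j"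
    "(\<Sum>e<d. f e * of_bool (j = e)) = f j" "(\<Sum>e<d. of_bool (e = j) * f e) = f j"
  using assms by (simp_all add: of_bool_def if_distrib if_distribR cong: if_cong)

text \<open>The denominators \<open>p\<close> are quotients of successive leading principal minors
  of \<open>X\<close>, hence nonzero in the positive definite case. The induction runs over the
  intermediate matrices in which the first \<open>k\<close> columns have been replaced.\<close>

lemma inv_iter_right_inverse:
  assumes pd: "posdef d X" and "k \<le> d" and "i < d" "j < d"
  shows "(\<Sum>e<d. (if e < k then X i e else of_bool (i = e)) * inv_iter d X k e j) = of_bool (i = j)"
  using assms(2-)
proof (induction k arbitrary: i j)
  case 0
  then show ?case by (simp add: sum_of_bool_mult)
next
  case (Suc k)
  define N where "N = inv_iter d X k"
  define y where "y = inv_coeff d X k N"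
  define B where "B = (\<lambda>i e. if e < k then X i e else of_bool (i = e))"
  define p where "p = 1 + y k"
  have k: "k < d" using Suc.prems by simp
  have BN: "(\<Sum>e<d. B i e * N e j) = of_bool (i = j)" if "i < d" "j < d" for i j
    using Suc.IH[of i j] that k by (simp add: B_def N_def)
  have By: "(\<Sum>e<d. B i e * y e) = X i k - of_bool (i = k)" if "i < d" for i
  proof -
    have "(\<Sum>e<d. B i e * y e) = (\<Sum>e<d. \<Sum>b<d. B i e * N e b * (X b k - of_bool (b = k)))"
      by (simp add: y_def inv_coeff_def sum_distrib_left mult.assoc)
    also have "\<dots> = (\<Sum>b<d. (\<Sum>e<d. B i e * N e b) * (X b k - of_bool (b = k)))"
      by (subst sum.swap) (simp add: sum_distrib_right)
    also have "\<dots> = (\<Sum>b<d. of_bool (i = b) * (X b k - of_bool (b = k)))"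
      by (intro sum.cong) (use that in \<open>auto simp: BN\<close>)
    also have "\<dots> = X i k - of_bool (i = k)" using that by (rule sum_of_bool_mult)
    finally show ?thesis .
  qed
  have p: "p \<noteq> 0"
  proof
    assume "p = 0"
    then have yk: "y k = - 1" by (simp add: p_def)
    \<comment> \<open>Since \<open>y k = -1\<close>, cutting \<open>y\<close> off after index
      \<open>k\<close> yields a vector that the leading block of \<open>X\<close> sends to zero. Its
      quadratic form vanishes although \<open>z k\<close> does not.\<close>
    define z where "z = (\<lambda>a. if a \<le> k then y a else 0)"
    have Xz: "(\<Sum>b<d. X a b * z b) = 0" if "a \<le> k" for a
    proof -
      have "(\<Sum>b<d. X a b * z b) = (\<Sum>b<d. B a b * y b - of_bool (b = k) * (X a k - of_bool (a = k)) + (X a k * y k + X a k - of_bool (a = k) - of_bool (a = k) * y k) * of_bool (b = k))"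
        by (intro sum.cong) (use that yk in \<open>auto simp: z_def B_def algebra_simps\<close>)
      also have "\<dots> = (X a k - of_bool (a = k)) - (X a k - of_bool (a = k))"
        unfolding sum.distrib sum_subtractf sum_distrib_left[symmetric] sum_distrib_right[symmetric] yk
        using By[of a] that k by (simp add: sum_of_bool_mult)
      finally show ?thesis by simp
    qed
    have "(\<Sum>a<d. \<Sum>b<d. z a * X a b * z b) = (\<Sum>a<d. z a * (\<Sum>b<d. X a b * z b))"
      by (simp add: sum_distrib_left mult.assoc)
    also have "\<dots> = 0"
      by (intro sum.neutral) (use Xz in \<open>auto simp: z_def\<close>)
    finally have "\<not> 0 < (\<Sum>a<d. \<Sum>b<d. z a * X a b * z b)" by simp
    moreover have "z k \<noteq> 0" using yk by (simp add: z_def)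
    ultimately show False using pd k unfolding posdef_def by blast
  qed
  let ?u = "X i k - of_bool (i = k)"
  have "(\<Sum>e<d. (if e < Suc k then X i e else of_bool (i = e)) * inv_iter d X (Suc k) e j)
     = (\<Sum>e<d. (B i e + ?u * of_bool (e = k)) * (N e j - y e * N k j / p))"
    by (intro sum.cong) (auto simp: B_def N_def y_def p_def less_Suc_eq)
  also have "\<dots> = (\<Sum>e<d. B i e * N e j - B i e * y e * (N k j / p)
      + of_bool (e = k) * (?u * (N k j - y k * N k j / p)))"
    by (intro sum.cong) (auto simp: algebra_simps add_divide_distrib diff_divide_distrib)
  also have "\<dots> = of_bool (i = j) - ?u * (N k j / p) + ?u * (N k j - y k * N k j / p)"
    unfolding sum.distrib sum_subtractf sum_distrib_right[symmetric] 
    using Suc.prems k by (simp add: BN By sum_of_bool_mult)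
  also have "\<dots> = of_bool (i = j)"
  proof -
    have yk: "y k = p - 1" by (simp add: p_def)
    show ?thesis using p unfolding yk by (simp add: field_simps)
  qed
  finally show ?case .
qed

section \<open>Kernels of weighted Gram matrices\<close>

definition gram :: "nat \<Rightarrow> (nat \<Rightarrow> nat \<Rightarrow> real) \<Rightarrow> (nat \<Rightarrow> real) \<Rightarrow> nat \<Rightarrow> nat \<Rightarrow> real" where
  "gram n W c a b = (\<Sum>i<n. c i * W a i * W b i)"

definition kernel :: "nat \<Rightarrow> nat \<Rightarrow> (nat \<Rightarrow> nat \<Rightarrow> real) \<Rightarrow> (nat \<Rightarrow> real) \<Rightarrow> nat \<Rightarrow> nat \<Rightarrow> real" where
  "kernel d n W c i j = (\<Sum>a<d. W a i * (\<Sum>b<d. inv_iter d (gram n W c) d a b * W b j))"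

text \<open>A diagonal entry of the squared kernel matrix, the kernel being symmetric. In isotropic
  position it is the quadratic form of the squared inverse at column \<open>i\<close>.\<close>

definition kernel_sq :: "nat \<Rightarrow> nat \<Rightarrow> (nat \<Rightarrow> nat \<Rightarrow> real) \<Rightarrow> (nat \<Rightarrow> real) \<Rightarrow> nat \<Rightarrow> real" where
  "kernel_sq d n W c i = (\<Sum>j<n. (kernel d n W c j i)\<^sup>2)"

definition kernel_total :: "nat \<Rightarrow> nat \<Rightarrow> (nat \<Rightarrow> nat \<Rightarrow> real) \<Rightarrow> (nat \<Rightarrow> real) \<Rightarrow> real" where
  "kernel_total d n W c = (\<Sum>i<n. kernel_sq d n W c i)"

definition column_form :: "nat \<Rightarrow> (nat \<Rightarrow> nat \<Rightarrow> real) \<Rightarrow> nat \<Rightarrow> (nat \<Rightarrow> real) \<Rightarrow> real" where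
  "column_form d W i z = (\<Sum>a<d. W a i * z a)"

lemma column_form_diff: "column_form d W i (\<lambda>a. y a - z a) = column_form d W i y - column_form d W i z"
  and column_form_scale: "column_form d W i (\<lambda>a. t * z a) = t * column_form d W i z"
  by (simp_all add: column_form_def algebra_simps sum.distrib sum_subtractf sum_distrib_left)

text \<open>Full row rank in dual form: no nonzero vector is orthogonal to all columns. Vectors are
  functions of which only the first \<open>d\<close> values count.\<close>

locale full_rank_array =
  fixes d n :: nat and W :: "nat \<Rightarrow> nat \<Rightarrow> real"
  assumes full: "(\<And>i. i < n \<Longrightarrow> column_form d W i z = 0) \<Longrightarrow> a < d \<Longrightarrow> z a = 0"
begin

abbreviation "form \<equiv> column_form d W"
abbreviation "K \<equiv> kernel d n W"
abbreviation "Ksq \<equiv> kernel_sq d n W"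
abbreviation "Ktot \<equiv> kernel_total d n W"

text \<open>The bilinear form of \<open>gram n W c\<close>, kept as a sum over columns: changing one
  weight is then visibly a rank-one update, and shifting all weights adds a multiple of
  \<open>W W^T\<close>.\<close>

definition quad :: "(nat \<Rightarrow> real) \<Rightarrow> (nat \<Rightarrow> real) \<Rightarrow> (nat \<Rightarrow> real) \<Rightarrow> real" where
  "quad c y z = (\<Sum>i<n. c i * form i y * form i z)"

definition pos :: "(nat \<Rightarrow> real) \<Rightarrow> bool" where
  "pos c \<longleftrightarrow> (\<forall>z. (\<exists>i<n. form i z \<noteq> 0) \<longrightarrow> 0 < quad c z z)"

definition potential :: "(nat \<Rightarrow> real) \<Rightarrow> real" where
  "potential c = (\<Sum>i<n. K c i i)"

definition sol :: "(nat \<Rightarrow> real) \<Rightarrow> nat \<Rightarrow> nat \<Rightarrow> real" where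
  "sol c j a = (\<Sum>b<d. inv_iter d (gram n W c) d a b * W b j)"

lemma quad_commute: "quad c y z = quad c z y"
  by (simp add: quad_def mult_ac)

lemma quad_diff: "quad c (\<lambda>a. y a - z a) v = quad c y v - quad c z v"
  by (simp add: quad_def column_form_diff algebra_simps sum_subtractf)

lemma quad_scale: "quad c (\<lambda>a. t * z a) v = t * quad c z v"
  by (simp add: quad_def column_form_scale sum_distrib_left mult_ac)

lemma quad_diff_right: "quad c v (\<lambda>a. y a - z a) = quad c v y - quad c v z"
  by (simp add: quad_commute[of c v] quad_diff)

lemma quad_scale_right: "quad c v (\<lambda>a. t * z a) = t * quad c v z"
  by (simp add: quad_commute[of c v] quad_scale)

lemma quad_shift: "quad (\<lambda>i. c i + t) y z = quad c y z + t * (\<Sum>i<n. form i y * form i z)"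
  by (simp add: quad_def algebra_simps sum.distrib sum_distrib_left)

lemma quad_update: "k < n \<Longrightarrow> quad (c(k := c k + t)) y z = quad c y z + t * form k y * form k z"
proof -
  assume k: "k < n"
  have "quad (c(k := c k + t)) y z = (\<Sum>i<n. c i * form i y * form i z + (if i = k then t * form k y * form k z else 0))"
    unfolding quad_def by (intro sum.cong) (auto simp: algebra_simps)
  then show ?thesis using k by (simp add: quad_def sum.distrib)
qed

lemma quad_gram: "quad c y z = (\<Sum>a<d. \<Sum>b<d. z a * gram n W c a b * y b)"
proof -
  have "quad c y z = (\<Sum>i<n. \<Sum>a<d. \<Sum>b<d. z a * (c i * W a i * W b i) * y b)"
    unfolding quad_commute[of c y z] unfolding quad_def column_form_def mult.assoc sum_product
    by (simp add: sum_distrib_left mult_ac)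
  also have "\<dots> = (\<Sum>a<d. \<Sum>b<d. \<Sum>i<n. z a * (c i * W a i * W b i) * y b)"
    by (subst sum.swap, rule sum.cong[OF refl], subst sum.swap, rule refl)
  also have "\<dots> = (\<Sum>a<d. \<Sum>b<d. z a * gram n W c a b * y b)"
    by (simp add: gram_def sum_distrib_left sum_distrib_right)
  finally show ?thesis .
qed

lemma quad_nonneg: "pos c \<Longrightarrow> 0 \<le> quad c z z"
  unfolding pos_def by (cases "\<exists>i<n. form i z \<noteq> 0") (auto simp: quad_def less_imp_le)

lemma posdef_gram:
  assumes "pos c" shows "posdef d (gram n W c)"
  unfolding posdef_def
proof (intro allI impI)
  fix z :: "nat \<Rightarrow> real" assume z: "\<exists>a<d. z a \<noteq> 0"
  then have "\<exists>i<n. form i z \<noteq> 0" using full by blast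
  then show "0 < (\<Sum>a<d. \<Sum>b<d. z a * gram n W c a b * z b)"
    using assms unfolding pos_def quad_gram by blast
qed

lemma gram_right_inverse:
  assumes "pos c" "i < d" "j < d"
  shows "(\<Sum>e<d. gram n W c i e * inv_iter d (gram n W c) d e j) = of_bool (i = j)"
  using inv_iter_right_inverse[OF posdef_gram[OF assms(1)] order_refl assms(2,3)] by simp

text \<open>The reproducing property: \<open>sol c j\<close> represents the linear form of column
  \<open>j\<close> in the inner product \<open>quad c\<close>. The shift and update estimates use
  the inverse only through it.\<close>

lemma quad_sol: "pos c \<Longrightarrow> quad c (sol c j) v = form j v"
proof -
  assume c: "pos c"
  have *: "(\<Sum>b<d. gram n W c a b * sol c j b) = W a j" if "a < d" for a
  proof -
    have "(\<Sum>b<d. gram n W c a b * sol c j b) = (\<Sum>b<d. \<Sum>e<d. gram n W c a b * inv_iter d (gram n W c) d b e * W e j)"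
      by (simp add: sol_def sum_distrib_left mult.assoc)
    also have "\<dots> = (\<Sum>e<d. (\<Sum>b<d. gram n W c a b * inv_iter d (gram n W c) d b e) * W e j)"
      by (subst sum.swap) (simp add: sum_distrib_right)
    also have "\<dots> = (\<Sum>e<d. of_bool (a = e) * W e j)"
      by (intro sum.cong) (use that c in \<open>auto simp: gram_right_inverse\<close>)
    also have "\<dots> = W a j" using that by (rule sum_of_bool_mult)
    finally show ?thesis .
  qed
  have "quad c (sol c j) v = (\<Sum>a<d. v a * (\<Sum>b<d. gram n W c a b * sol c j b))"
    by (simp add: quad_gram sum_distrib_left mult.assoc)
  also have "\<dots> = form j v" unfolding column_form_def
    by (intro sum.cong) (auto simp: *)
  finally show ?thesis .
qed

lemma kernel_form: "K c i j = form i (sol c j)"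
  by (simp add: kernel_def column_form_def sol_def)

lemma kernel_quad: "pos c \<Longrightarrow> K c i j = quad c (sol c i) (sol c j)"
  by (simp add: kernel_form quad_sol)

lemma kernel_nonneg: "pos c \<Longrightarrow> 0 \<le> K c i i"
  by (simp add: kernel_quad quad_nonneg)

lemma kernel_commute: "pos c \<Longrightarrow> K c i j = K c j i"
  by (metis kernel_quad quad_commute)

lemma kernel_sq_form: "Ksq c i = (\<Sum>j<n. form j (sol c i) * form j (sol c i))"
  by (simp add: kernel_sq_def kernel_form power2_eq_square)

lemma kernel_sq_nonneg: "0 \<le> Ksq c i"
  by (simp add: kernel_sq_def sum_nonneg)

lemma kernel_total_nonneg: "0 \<le> Ktot c"
  by (simp add: kernel_total_def sum_nonneg kernel_sq_nonneg)

text \<open>Convexity of the matrix inverse: expand \<open>quad c\<close> at the difference of the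
  old and the new solution, which is nonnegative. The sign of \<open>t\<close> is free, so one lemma
  serves both the rising upper barrier and the rising lower one.\<close>

lemma kernel_shift:
  assumes c: "pos c" and c': "pos (\<lambda>i. c i + t)"
  shows "K (\<lambda>i. c i + t) i i + t * Ksq (\<lambda>i. c i + t) i \<le> K c i i"
proof -
  let ?c' = "\<lambda>i. c i + t"
  let ?y = "sol c i" and ?y' = "sol ?c' i"
  have "0 \<le> quad c (\<lambda>a. ?y a - ?y' a) (\<lambda>a. ?y a - ?y' a)" using c by (rule quad_nonneg)
  also have "\<dots> = quad c ?y ?y - 2 * quad c ?y ?y' + quad c ?y' ?y'"
    by (simp add: quad_diff quad_diff_right quad_commute)
  also have "quad c ?y' ?y' = quad ?c' ?y' ?y' - t * Ksq ?c' i"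
    by (simp add: quad_shift kernel_sq_form)
  also have "quad ?c' ?y' ?y' = K ?c' i i" using c' by (simp add: kernel_quad)
  also have "quad c ?y ?y' = K ?c' i i" using c by (simp add: quad_sol kernel_form)
  also have "quad c ?y ?y = K c i i" using c by (simp add: kernel_quad)
  finally show ?thesis by simp
qed

lemma potential_shift:
  assumes c: "pos c" and c': "pos (\<lambda>i. c i + t)"
  shows "potential (\<lambda>i. c i + t) + t * Ktot (\<lambda>i. c i + t) \<le> potential c"
proof -
  have "potential (\<lambda>i. c i + t) + t * Ktot (\<lambda>i. c i + t) = (\<Sum>i<n. K (\<lambda>i. c i + t) i i + t * Ksq (\<lambda>i. c i + t) i)"
    by (simp add: potential_def kernel_total_def sum.distrib sum_distrib_left)
  also have "\<dots> \<le> potential c" unfolding potential_def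
    by (intro sum_mono kernel_shift[OF c c'])
  finally show ?thesis .
qed

text \<open>Cauchy-Schwarz for \<open>quad c\<close> between \<open>z\<close> and the representer
  \<open>sol c i\<close>.\<close>

lemma form_square_le:
  assumes c: "pos c" shows "(form i z)\<^sup>2 \<le> K c i i * quad c z z"
proof (cases "\<exists>j<n. form j z \<noteq> 0")
  case True
  then have q: "0 < quad c z z" using c by (auto simp: pos_def)
  let ?t = "form i z / quad c z z"
  have "0 \<le> quad c (\<lambda>a. sol c i a - ?t * z a) (\<lambda>a. sol c i a - ?t * z a)" using c by (rule quad_nonneg)
  also have "\<dots> = quad c (sol c i) (sol c i) - 2 * ?t * quad c (sol c i) z + ?t\<^sup>2 * quad c z z"
    unfolding quad_diff quad_diff_right quad_scale quad_scale_right quad_commute[of c z "sol c i"]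
    by (simp add: power2_eq_square algebra_simps)
  also have "\<dots> = K c i i - 2 * ?t * form i z + ?t\<^sup>2 * quad c z z"
    unfolding quad_sol[OF c] kernel_form ..
  also have "\<dots> = K c i i - (form i z)\<^sup>2 / quad c z z"
    using q by (simp add: field_simps power2_eq_square)
  finally show ?thesis using q by (simp add: field_simps)
next
  case False
  then have "\<And>a. a < d \<Longrightarrow> z a = 0" using full by blast
  then have "form i z = 0" by (simp add: column_form_def)
  with False show ?thesis by (simp add: quad_def)
qed

lemma kernel_pos: 
  assumes "pos c" "k < n" "form k z \<noteq> 0" shows "0 < K c k k"
proof -
  have "0 < (form k z)\<^sup>2" using assms by simp
  then have "K c k k \<noteq> 0" using form_square_le[OF assms(1), of k z] by auto
  then show ?thesis using kernel_nonneg[OF assms(1), of k] by simp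
qed

lemma kernel_total_pos:
  assumes c: "pos c" and "0 < d" shows "0 < Ktot c"
proof -
  have "\<not> (\<forall>i<n. form i (\<lambda>_. 1) = 0)" using full[of "\<lambda>_. 1" 0] \<open>0 < d\<close> by auto
  then obtain k where k: "k < n" "form k (\<lambda>_. 1) \<noteq> 0" by auto
  have "0 < (K c k k)\<^sup>2" using kernel_pos[OF c k] by simp
  also have "\<dots> \<le> Ksq c k" unfolding kernel_sq_def using k by (intro member_le_sum) auto
  also have "\<dots> \<le> Ktot c" unfolding kernel_total_def using k by (intro member_le_sum) (auto simp: kernel_sq_nonneg)
  finally show ?thesis .
qed

text \<open>Cauchy-Schwarz summed over all columns bounds \<open>W W^T\<close> by the potential
  times the Gram matrix. A potential below 1 therefore leaves room for a full unit step of the lower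
  barrier, at the cost of a factor \<open>1 - \<eta>\<close> in the form.\<close>

lemma lower_shift:
  assumes c: "pos c" and pot: "potential c \<le> \<eta>" and "\<eta> < 1"
  shows "pos (\<lambda>i. c i - 1)" "potential (\<lambda>i. c i - 1) \<le> \<eta> / (1 - \<eta>)"
proof -
  let ?c' = "\<lambda>i. c i - 1"
  have q: "(1 - \<eta>) * quad c z z \<le> quad ?c' z z" for z
  proof -
    have "(\<Sum>i<n. (form i z)\<^sup>2) \<le> (\<Sum>i<n. K c i i * quad c z z)"
      by (intro sum_mono form_square_le c)
    also have "\<dots> \<le> \<eta> * quad c z z"
      using pot quad_nonneg[OF c, of z] by (simp add: sum_distrib_right[symmetric] potential_def mult_right_mono)
    finally show ?thesis using quad_shift[of c "-1" z z] by (simp add: power2_eq_square algebra_simps)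
  qed
  show c': "pos ?c'" unfolding pos_def
  proof (intro allI impI)
    fix z assume "\<exists>i<n. form i z \<noteq> 0"
    then have "0 < quad c z z" using c by (auto simp: pos_def)
    then have "0 < (1 - \<eta>) * quad c z z" using \<open>\<eta> < 1\<close> by simp
    then show "0 < quad ?c' z z" using q[of z] by linarith
  qed
  have "K ?c' i i \<le> K c i i / (1 - \<eta>)" for i
  proof (cases "K ?c' i i = 0")
    case False
    then have pos: "0 < K ?c' i i" using kernel_nonneg[OF c', of i] by simp
    \<comment> \<open>Antitonicity of the inverse without square roots: use Cauchy-Schwarz for
      \<open>c\<close> at the solution for \<open>?c'\<close>, where the form takes the value
      \<open>K ?c' i i\<close>, and cancel one such factor.\<close>
    let ?y = "sol ?c' i"
    have "(K ?c' i i)\<^sup>2 \<le> K c i i * quad c ?y ?y"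
      using form_square_le[OF c, of i ?y] by (simp add: kernel_form)
    then have "(1 - \<eta>) * (K ?c' i i)\<^sup>2 \<le> (1 - \<eta>) * (K c i i * quad c ?y ?y)"
      using \<open>\<eta> < 1\<close> by simp
    also have "\<dots> = K c i i * ((1 - \<eta>) * quad c ?y ?y)" by simp
    also have "\<dots> \<le> K c i i * K ?c' i i"
      using q[of ?y] kernel_nonneg[OF c] by (intro mult_left_mono) (simp_all add: kernel_quad[OF c'])
    finally have "((1 - \<eta>) * K ?c' i i) * K ?c' i i \<le> K c i i * K ?c' i i"
      by (simp add: power2_eq_square mult.assoc)
    then have "(1 - \<eta>) * K ?c' i i \<le> K c i i" using pos by (rule mult_right_le_imp_le)
    then show ?thesis using \<open>\<eta> < 1\<close> by (simp add: field_simps)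
  qed (use kernel_nonneg[OF c] \<open>\<eta> < 1\<close> in simp)
  then have "potential ?c' \<le> (\<Sum>i<n. K c i i / (1 - \<eta>))" unfolding potential_def by (intro sum_mono)
  also have "\<dots> \<le> \<eta> / (1 - \<eta>)"
    using pot \<open>\<eta> < 1\<close> by (simp add: sum_divide_distrib[symmetric] potential_def divide_right_mono)
  finally show "potential ?c' \<le> \<eta> / (1 - \<eta>)" .
qed

text \<open>The hypothesis on \<open>t\<close> is positivity of the factor by which the rank-one
  update multiplies the determinant. For negative \<open>t\<close>, Cauchy-Schwarz shows that the
  loss is at most the matching fraction of \<open>quad c z z\<close>.\<close>

lemma pos_update:
  assumes c: "pos c" and k: "k < n" and t: "0 < 1 + t * K c k k"
  shows "pos (c(k := c k + t))"
  unfolding pos_def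
proof (intro allI impI)
  fix z assume "\<exists>i<n. form i z \<noteq> 0"
  then have q: "0 < quad c z z" using c by (auto simp: pos_def)
  have "0 < quad c z z + t * (form k z)\<^sup>2"
  proof (cases "0 \<le> t")
    case True
    then show ?thesis using q by (simp add: add_pos_nonneg)
  next
    case False
    have "0 < (1 + t * K c k k) * quad c z z" using q t by simp
    also have "\<dots> = quad c z z + t * (K c k k * quad c z z)" by (simp add: algebra_simps)
    also have "\<dots> \<le> quad c z z + t * (form k z)\<^sup>2"
      using False form_square_le[OF c, of k z] by (intro add_left_mono mult_left_mono_neg) auto
    finally show ?thesis .
  qed
  then show "0 < quad (c(k := c k + t)) z z" using k by (simp add: quad_update power2_eq_square mult.assoc)
qed

text \<open>Sherman-Morrison, verified on linear forms: \<open>y\<close> is the predicted solution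
  of the updated system.\<close>

lemma kernel_update:
  assumes c: "pos c" and k: "k < n" and t: "0 < 1 + t * K c k k"
  shows "K (c(k := c k + t)) i i = K c i i - t * (K c i k)\<^sup>2 / (1 + t * K c k k)"
proof -
  let ?c' = "c(k := c k + t)"
  define r where "r = t * K c k i / (1 + t * K c k k)"
  define y where "y = (\<lambda>a. sol c i a - r * sol c k a)"
  have "quad ?c' y v = form i v" for v
  proof -
    have "quad ?c' y v = form i v - r * form k v + t * (K c k i - r * K c k k) * form k v"
      unfolding y_def quad_update[OF k] quad_diff quad_scale quad_sol[OF c] column_form_diff column_form_scale kernel_form
      by (simp add: algebra_simps)
    also have "\<dots> = form i v"
    proof -
      have "t * (K c k i - r * K c k k) = r" using t by (simp add: r_def field_simps)
      then show ?thesis by simp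
    qed
    finally show ?thesis .
  qed
  \<comment> \<open>The vectors \<open>y\<close> and \<open>sol ?c' i\<close> are not proved equal.
    Pairing them with each other, once from each side, already gives the kernel entry.\<close>
  then have "quad ?c' y (sol ?c' i) = form i (sol ?c' i)" .
  then have "K ?c' i i = quad ?c' (sol ?c' i) y" by (simp add: kernel_form quad_commute)
  also have "\<dots> = form i y" using pos_update[OF c k t] by (rule quad_sol)
  also have "\<dots> = K c i i - r * K c i k"
    by (simp add: y_def column_form_diff column_form_scale kernel_form del: times_divide_eq_left)
  finally show ?thesis using kernel_commute[OF c, of k i] by (simp add: r_def power2_eq_square mult.assoc)
qed

lemma potential_update:
  assumes c: "pos c" and k: "k < n" and t: "0 < 1 + t * K c k k"
  shows "potential (c(k := c k + t)) = potential c - t * Ksq c k / (1 + t * K c k k)"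
  by (simp add: potential_def kernel_update[OF assms] sum_subtractf kernel_sq_def sum_distrib_left sum_divide_distrib)

text \<open>The potential is the trace of \<open>(t W W^T)^{-1} W W^T\<close>. This is how the
  dimension \<open>d\<close>, rather than the number \<open>n\<close> of columns, enters the number
  of rounds.\<close>

lemma potential_const:
  assumes "0 < t" shows "pos (\<lambda>_. t)" "potential (\<lambda>_. t) = real d / t"
proof -
  show c: "pos (\<lambda>_. t)" unfolding pos_def
  proof (intro allI impI)
    fix z assume "\<exists>i<n. form i z \<noteq> 0"
    then obtain k where k: "k < n" "form k z \<noteq> 0" by auto
    then have "0 < t * (form k z)\<^sup>2" using assms by simp
    also have "\<dots> \<le> (\<Sum>i<n. t * (form i z)\<^sup>2)" using assms k by (intro member_le_sum) auto
    finally show "0 < quad (\<lambda>_. t) z z" by (simp add: quad_def power2_eq_square mult.assoc)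
  qed
  let ?N = "inv_iter d (gram n W (\<lambda>_. t)) d"
  have "t * potential (\<lambda>_. t) = (\<Sum>i<n. \<Sum>a<d. \<Sum>b<d. t * W b i * W a i * ?N a b)"
    by (simp add: potential_def kernel_def sum_distrib_left mult_ac)
  also have "\<dots> = (\<Sum>b<d. \<Sum>a<d. \<Sum>i<n. t * W b i * W a i * ?N a b)"
    by (subst sum.swap, subst sum.swap[of _ "{..<d}" "{..<d}"], rule sum.cong[OF refl], subst sum.swap, rule refl)
  also have "\<dots> = (\<Sum>b<d. \<Sum>a<d. gram n W (\<lambda>_. t) b a * ?N a b)"
    by (simp add: gram_def sum_distrib_right)
  also have "\<dots> = real d" using gram_right_inverse[OF c] by simp
  finally show "potential (\<lambda>_. t) = real d / t" using assms by (simp add: field_simps)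
qed

lemma pos_shift: "pos c \<Longrightarrow> 0 \<le> t \<Longrightarrow> pos (\<lambda>i. c i + t)"
  unfolding pos_def quad_shift by (auto intro!: add_pos_nonneg simp: sum_nonneg)

section \<open>The barrier argument\<close>

text \<open>Moving the barriers to \<open>u + \<delta>\<close> and \<open>l + 1\<close> and adding \<open>1 / g\<close> to the weight \<open>s k\<close> does not increase the
  potentials if \<open>upper_gain \<delta> (u + \<delta> - s) k < g = lower_gain (s - (l + 1)) k\<close>. Batson, Spielman and Srivastava have potential
  differences in place of the multiples of \<open>Ktot\<close>, which bound them (\<open>potential_shift\<close>); this choice makes the
  averaging argument immediate and needs only two matrix inversions per round.\<close>

definition upper_gain :: "real \<Rightarrow> (nat \<Rightarrow> real) \<Rightarrow> nat \<Rightarrow> real" where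
  "upper_gain \<delta> c i = Ksq c i / (\<delta> * Ktot c) + K c i i"

definition lower_gain :: "(nat \<Rightarrow> real) \<Rightarrow> nat \<Rightarrow> real" where
  "lower_gain c i = Ksq c i / Ktot c - K c i i"

text \<open>Positivity places the weighted Gram matrix strictly between \<open>l\<close> and
  \<open>u\<close> times \<open>W W^T\<close>. The potentials make the distance quantitative, as
  \<open>lower_shift\<close> requires.\<close>

definition barrier :: "real \<Rightarrow> real \<Rightarrow> real \<Rightarrow> (nat \<Rightarrow> real) \<Rightarrow> bool" where
  "barrier \<eta> u l s \<longleftrightarrow> pos (\<lambda>i. u - s i) \<and> pos (\<lambda>i. s i - l) \<and>
     potential (\<lambda>i. u - s i) \<le> \<eta> \<and> potential (\<lambda>i. s i - l) \<le> \<eta>"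

text \<open>Averaging: the \<open>Ksq\<close> terms sum to \<open>Ktot\<close>, so the lower gains
  add up to 1 minus a potential and the upper gains to \<open>1 / \<delta>\<close> plus a potential.
  The first total is larger, hence so is some summand.\<close>

lemma barrier_candidate:
  assumes b: "barrier \<eta> u l s" and d: "0 < d" and \<eta>: "0 < \<eta>" "\<eta> \<le> 1/8" and \<delta>: "\<delta> = 1 + 4 * \<eta>"
  shows "\<exists>k<n. upper_gain \<delta> (\<lambda>i. u + \<delta> - s i) k < lower_gain (\<lambda>i. s i - (l + 1)) k"
proof (rule ccontr)
  let ?cu = "\<lambda>i. u + \<delta> - s i" and ?cl = "\<lambda>i. s i - (l + 1)"
  assume "\<not> ?thesis"
  then have "(\<Sum>k<n. lower_gain ?cl k) \<le> (\<Sum>k<n. upper_gain \<delta> ?cu k)"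
    by (intro sum_mono) (metis lessThan_iff not_less)
  moreover have u: "pos ?cu" using b pos_shift[of "\<lambda>i. u - s i" \<delta>] \<eta> \<delta>
    by (simp add: barrier_def algebra_simps)
  moreover have l: "pos ?cl" "potential ?cl \<le> \<eta> / (1 - \<eta>)"
    using b lower_shift[of "\<lambda>i. s i - l" \<eta>] \<eta> by (simp_all add: barrier_def diff_diff_eq)
  moreover have "(\<Sum>k<n. lower_gain ?cl k) = 1 - potential ?cl"
    using kernel_total_pos[OF l(1) d]
    by (simp add: lower_gain_def sum_subtractf sum_divide_distrib[symmetric] kernel_total_def[symmetric] potential_def)
  moreover have "(\<Sum>k<n. upper_gain \<delta> ?cu k) = 1 / \<delta> + potential ?cu"
    using kernel_total_pos[OF u d] 
    by (simp add: upper_gain_def sum.distrib sum_divide_distrib[symmetric] kernel_total_def[symmetric] potential_def)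
  moreover have "potential ?cu \<le> \<eta>"
  proof -
    have "potential ?cu + \<delta> * Ktot ?cu \<le> potential (\<lambda>i. u - s i)"
      using potential_shift[of "\<lambda>i. u - s i" \<delta>] b u by (simp add: barrier_def algebra_simps)
    moreover have "0 \<le> \<delta> * Ktot ?cu" using \<delta> \<eta> by (simp add: kernel_total_nonneg)
    ultimately show ?thesis using b by (simp add: barrier_def)
  qed
  \<comment> \<open>The excess \<open>4 * \<eta>\<close> of \<open>\<delta>\<close> over 1 has to
    pay for the upper potential, at most \<open>\<eta>\<close>, and for the lower potential after
    its shift, at most \<open>8/7 * \<eta>\<close>. The remainder absorbs the quadratic error for
    \<open>\<eta>\<close> up to \<open>1/8\<close>.\<close>
  moreover have "1 / \<delta> + \<eta> < 1 - \<eta> / (1 - \<eta>)"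
  proof -
    have "\<eta> / (1 - \<eta>) \<le> 8/7 * \<eta>" using \<eta> by (simp add: field_simps)
    moreover have "1 / \<delta> < 1 - 15/7 * \<eta>"
    proof -
      have "\<eta> * \<eta> \<le> 1/8 * \<eta>" using \<eta> by (intro mult_right_mono) auto
      then show ?thesis using \<eta> unfolding \<delta> by (simp add: field_simps)
    qed
    ultimately show ?thesis by linarith
  qed
  ultimately show False by linarith
qed

lemma lower_gain_pos:
  assumes "pos c" "0 < \<delta>" "upper_gain \<delta> c k < g" shows "0 < g"
proof -
  have "0 \<le> upper_gain \<delta> c k"
    using assms by (simp add: upper_gain_def kernel_nonneg kernel_sq_nonneg kernel_total_nonneg)
  then show ?thesis using assms by linarith
qed

text \<open>For each barrier, the change of potential due to the shift is bounded by a multiple of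
  \<open>Ktot\<close>, and the change of one weight has to compensate. Taking \<open>1 / g\<close>
  with \<open>g\<close> equal to the lower gain achieves this exactly below; the strict inequality
  between the gains achieves it above.\<close>

lemma barrier_step:
  assumes b: "barrier \<eta> u l s" and d: "0 < d" and \<eta>: "0 < \<eta>" "\<eta> \<le> 1/8" and \<delta>: "\<delta> = 1 + 4 * \<eta>"
    and k: "k < n" and gain: "upper_gain \<delta> (\<lambda>i. u + \<delta> - s i) k < lower_gain (\<lambda>i. s i - (l + 1)) k"
    and s': "s' = s(k := s k + 1 / lower_gain (\<lambda>i. s i - (l + 1)) k)"
  shows "barrier \<eta> (u + \<delta>) (l + 1) s'" "0 < lower_gain (\<lambda>i. s i - (l + 1)) k"
proof -
  let ?cu = "\<lambda>i. u + \<delta> - s i" and ?cl = "\<lambda>i. s i - (l + 1)"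
  define g where "g = lower_gain ?cl k"
  have \<delta>0: "0 < \<delta>" using \<delta> \<eta> by simp
  have u: "pos ?cu" using b pos_shift[of "\<lambda>i. u - s i" \<delta>] \<delta>0
    by (simp add: barrier_def algebra_simps)
  have l: "pos ?cl"
    using b lower_shift[of "\<lambda>i. s i - l" \<eta>] \<eta> by (simp add: barrier_def diff_diff_eq)
  show g0: "0 < lower_gain ?cl k" using lower_gain_pos[OF u \<delta>0 gain] .
  then have g: "0 < g" by (simp add: g_def)
  have tl: "0 < Ktot ?cl" and tu: "0 < Ktot ?cu" using kernel_total_pos l u d by auto
  have u': "(\<lambda>i. u + \<delta> - s' i) = ?cu(k := ?cu k + (- (1/g)))" and l': "(\<lambda>i. s' i - (l + 1)) = ?cl(k := ?cl k + 1/g)"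
    unfolding s' g_def by auto
  have Kl: "0 \<le> K ?cl k k" using l by (rule kernel_nonneg)
  have low: "0 < 1 + 1/g * K ?cl k k" using g Kl by (simp add: add_pos_nonneg)
  have "K ?cu k k \<le> upper_gain \<delta> ?cu k" 
    using \<delta>0 tu kernel_sq_nonneg by (simp add: upper_gain_def)
  then have "K ?cu k k < g" using gain by (simp add: g_def)
  \<comment> \<open>The new weight does not push the matrix through the upper barrier.\<close>
  then have up: "0 < 1 + (- (1/g)) * K ?cu k k" using g by (simp add: field_simps)
  \<comment> \<open>By the definition of \<open>g\<close>, the denominator
    \<open>g + K ?cl k k\<close> equals \<open>Ksq ?cl k / Ktot ?cl\<close>, so the drop is
    precisely \<open>Ktot ?cl\<close>. This offsets the rise that \<open>potential_shift\<close>
    allows for \<open>t = -1\<close>.\<close>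
  have pl: "potential (\<lambda>i. s' i - (l + 1)) = potential ?cl - Ktot ?cl"
  proof -
    have "1/g * Ksq ?cl k / (1 + 1/g * K ?cl k k) = Ksq ?cl k / (g + K ?cl k k)"
      using g Kl by (simp add: field_simps)
    also have "g + K ?cl k k = Ksq ?cl k / Ktot ?cl" by (simp add: g_def lower_gain_def)
    also have "Ksq ?cl k / \<dots> = Ktot ?cl"
    proof -
      have "0 < g + K ?cl k k" using g Kl by simp
      then have "Ksq ?cl k \<noteq> 0" by (auto simp: g_def lower_gain_def)
      then show ?thesis by simp
    qed
    finally show ?thesis unfolding l' potential_update[OF l k low] by simp
  qed
  have "potential ?cl - Ktot ?cl \<le> potential (\<lambda>i. s i - l)"
    using potential_shift[of "\<lambda>i. s i - l" "-1"] b l by (simp add: barrier_def algebra_simps)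
  then have pl': "potential (\<lambda>i. s' i - (l + 1)) \<le> \<eta>" using b pl by (simp add: barrier_def)
  have pu: "potential (\<lambda>i. u + \<delta> - s' i) \<le> potential ?cu + \<delta> * Ktot ?cu"
  proof -
    have "1/g * Ksq ?cu k / (1 + (- (1/g)) * K ?cu k k) = Ksq ?cu k / (g - K ?cu k k)"
      using g \<open>K ?cu k k < g\<close> by (simp add: field_simps)
    also have "\<dots> \<le> \<delta> * Ktot ?cu"
    proof -
      have "Ksq ?cu k / (\<delta> * Ktot ?cu) \<le> g - K ?cu k k"
        using gain by (simp add: upper_gain_def g_def)
      then show ?thesis using \<delta>0 tu \<open>K ?cu k k < g\<close> by (simp add: field_simps)
    qed
    finally show ?thesis unfolding u' potential_update[OF u k up] by simp
  qed
  have "potential ?cu + \<delta> * Ktot ?cu \<le> potential (\<lambda>i. u - s i)"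
    using potential_shift[of "\<lambda>i. u - s i" \<delta>] b u by (simp add: barrier_def algebra_simps)
  then have pu': "potential (\<lambda>i. u + \<delta> - s' i) \<le> \<eta>" using b pu by (simp add: barrier_def)
  show "barrier \<eta> (u + \<delta>) (l + 1) s'"
    unfolding barrier_def using pl' pu' pos_update[OF l k low] pos_update[OF u k up] by (simp add: l' u')
qed

text \<open>With zero weights, both barriers see the constant weight \<open>d / \<eta>\<close>,
  whose potential is exactly \<open>\<eta>\<close>.\<close>

lemma barrier_init:
  assumes "0 < \<eta>" "0 < d"
  shows "barrier \<eta> (real d / \<eta>) (- (real d / \<eta>)) (\<lambda>_. 0)"
  using potential_const[of "real d / \<eta>"] assms by (simp add: barrier_def)

lemma barrier_bounds:
  assumes "barrier \<eta> u l s"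
  shows "l * (\<Sum>i<n. (form i z)\<^sup>2) \<le> (\<Sum>i<n. s i * (form i z)\<^sup>2)"
    "(\<Sum>i<n. s i * (form i z)\<^sup>2) \<le> u * (\<Sum>i<n. (form i z)\<^sup>2)"
  using assms quad_nonneg[of "\<lambda>i. s i - l" z] quad_nonneg[of "\<lambda>i. u - s i" z]
  by (simp_all add: barrier_def quad_def algebra_simps sum_subtractf sum_distrib_left power2_eq_square)

end

section \<open>Maximal minors of Delta-modular matrices\<close>

text \<open>Columns are chosen by an arbitrary function, in any order and possibly repeated, so that
  exchanging one column is a function update. A \<open>submatrix\<close> would sort them
  again.\<close>

definition select :: "nat \<Rightarrow> (nat \<Rightarrow> nat \<Rightarrow> real) \<Rightarrow> (nat \<Rightarrow> nat) \<Rightarrow> real mat" where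
  "select d W f = mat d d (\<lambda>(a, b). W a (f b))"

lemma select_carrier [simp]: "select d W f \<in> carrier_mat d d"
  by (simp add: select_def)

lemma abs_det_select:
  assumes W: "W \<in> carrier_mat d n" and inj: "inj_on f {..<d}" and f: "\<And>b. b < d \<Longrightarrow> f b < n"
  shows "\<bar>det (select d (\<lambda>a i. W $$ (a, i)) f)\<bar> = \<bar>det (submatrix W UNIV (f ` {..<d}))\<bar>"
proof -
  let ?J = "f ` {..<d}"
  have J: "card ?J = d" "{j. j < n \<and> j \<in> ?J} = ?J" using inj f by (auto simp: card_image)
  define A where "A = submatrix W UNIV ?J"
  have A: "A \<in> carrier_mat d d" using W J by (auto simp: A_def submatrix_def)
  \<comment> \<open>The rank of \<open>f b\<close> among the chosen indices, which is its column
    position in the submatrix. The identity beyond \<open>d\<close> makes \<open>\<pi>\<close> a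
    permutation in the sense of \<open>permutes\<close>.\<close>
  define \<pi> where "\<pi> = (\<lambda>b. if b < d then card {a \<in> ?J. a < f b} else b)"
  have pick: "pick ?J (\<pi> b) = f b" if "b < d" for b
    using that by (simp add: \<pi>_def pick_card_in_set)
  have lt: "\<pi> b < d" if "b < d" for b
  proof -
    have "{a \<in> ?J. a < f b} \<subset> ?J" using that by auto
    then have "card {a \<in> ?J. a < f b} < card ?J" by (intro psubset_card_mono) auto
    then show ?thesis using J that by (simp add: \<pi>_def)
  qed
  have inj': "inj_on \<pi> {0..<d}"
    using inj pick by (intro inj_onI) (metis atLeastLessThan_iff inj_onD lessThan_iff)
  have "\<pi> permutes {0..<d}"
  proof (rule bij_imp_permutes)
    show "bij_betw \<pi> {0..<d} {0..<d}"
      using inj' lt by (intro bij_betw_imageI endo_inj_surj) auto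
  qed (simp add: \<pi>_def)
  have "mat d d (\<lambda>(i, j). A\<^sup>T $$ (\<pi> i, j)) = (select d (\<lambda>a i. W $$ (a, i)) f)\<^sup>T"
    using A W lt J by (intro eq_matI) (auto simp: A_def submatrix_index select_def pick pick_UNIV)
  then have "det (select d (\<lambda>a i. W $$ (a, i)) f) = signof \<pi> * det A"
    using det_permute_rows[of "A\<^sup>T" d \<pi>] A \<open>\<pi> permutes {0..<d}\<close> by (simp add: det_transpose[of _ d])
  then show ?thesis by (simp add: A_def abs_mult sign_def)
qed

lemma det_select_not_inj:
  assumes "\<not> inj_on f {..<d}" shows "det (select d W f) = 0"
proof -
  obtain a b where "a < d" "b < d" "a \<noteq> b" "f a = f b" using assms by (auto simp: inj_on_def)
  then show ?thesis
    by (intro det_identical_columns[of _ d a b]) (auto simp: select_def)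
qed

lemma delta_modular_select:
  assumes W: "W \<in> carrier_mat d n" and \<Delta>: "delta_modular \<Delta> W" and f: "\<And>b. b < d \<Longrightarrow> f b < n"
    and nz: "det (select d (\<lambda>a i. W $$ (a, i)) f) \<noteq> 0" (is "?D \<noteq> 0")
  shows "1 \<le> \<bar>?D\<bar>" "\<bar>?D\<bar> \<le> \<Delta>"
proof -
  have inj: "inj_on f {..<d}" using nz det_select_not_inj by blast
  note eq = abs_det_select[OF W inj f]
  have "f ` {..<d} \<subseteq> {..<dim_col W}" "card (f ` {..<d}) = dim_row W"
    using W f inj by (auto simp: card_image)
  moreover have "det (submatrix W UNIV (f ` {..<d})) \<noteq> 0" using nz eq by auto
  ultimately show "1 \<le> \<bar>?D\<bar>" "\<bar>?D\<bar> \<le> \<Delta>" using \<Delta> eq unfolding delta_modular_def by auto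
qed

text \<open>Rank \<open>d\<close> means that the columns span the whole space, so \<open>z\<close>
  is orthogonal to everything, in particular to itself.\<close>

lemma full_row_rank_orthogonal:
  fixes W :: "real mat"
  assumes W: "W \<in> carrier_mat d n" and rank: "vec_space.rank d W = d"
    and z: "z \<in> carrier_vec d" and orth: "\<And>v. v \<in> set (cols W) \<Longrightarrow> z \<bullet> v = 0"
  shows "z = 0\<^sub>v d"
proof -
  interpret vec_space "TYPE(real)" d .
  have cW: "set (cols W) \<subseteq> carrier_vec d" using cols_dim W by blast
  obtain S where S: "maximal S (\<lambda>T. T \<subseteq> set (cols W) \<and> lin_indpt T)"
    using maximal_exists_superset[of "set (cols W)" "(\<lambda>T. T \<subseteq> set (cols W) \<and> lin_indpt T)" "{}"]
    by (auto simp: lin_dep_def)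
  then have S': "S \<subseteq> set (cols W)" "lin_indpt S" by (auto simp: maximal_def)
  have "card S = d" using rank_card_indpt[OF W S] rank by simp
  then have "basis S"
    using S' cW by (intro dim_li_is_basis) (auto simp: dim_is_n intro: finite_subset)
  then have "span S = carrier_vec d" by (simp add: basis_def)
  then have "span (set (cols W)) = carrier_vec d"
    using span_is_monotone[OF S'(1)] span_is_subset2[OF cW] by auto
  moreover have "z \<in> orthogonal_complement (set (cols W))"
    using z orth by (simp add: orthogonal_complement_def)
  ultimately have "z \<in> orthogonal_complement (carrier_vec d)"
    using in_orthogonal_complement_span[OF cW] by simp
  then have "z \<bullet> z = 0" using z by (simp add: orthogonal_complement_def)
  then have "(\<Sum>i<d. (z $ i)\<^sup>2) = 0" using z by (simp add: scalar_prod_def power2_eq_square lessThan_atLeast0)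
  then have "\<forall>i<d. z $ i = 0" by (subst (asm) sum_nonneg_eq_0_iff) auto
  then show ?thesis using z by (intro eq_vecI) auto
qed

lemma delta_modular_full:
  assumes W: "W \<in> carrier_mat d n" and \<Delta>: "delta_modular \<Delta> W"
  shows "full_rank_array d n (\<lambda>a i. W $$ (a, i))"
proof
  fix z :: "nat \<Rightarrow> real" and a
  assume z: "\<And>i. i < n \<Longrightarrow> column_form d (\<lambda>a i. W $$ (a, i)) i z = 0" and a: "a < d"
  have "vec d z = 0\<^sub>v d"
  proof (rule full_row_rank_orthogonal[OF W])
    show "vec_space.rank d W = d" using \<Delta> W by (simp add: delta_modular_def)
    fix v assume "v \<in> set (cols W)"
    then obtain i where "i < n" "v = col W i" using W by (auto simp: cols_def)
    then show "vec d z \<bullet> v = 0"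
      using z[of i] W by (simp add: scalar_prod_def column_form_def lessThan_atLeast0 mult.commute)
  qed simp
  then show "z a = 0" using a by (metis index_vec index_zero_vec(1))
qed

section \<open>Column exchange by Cramer's rule\<close>

context full_rank_array
begin

text \<open>\<open>y\<close> is row \<open>k\<close> of the inverse of \<open>A\<close>, the
  functional dual to column \<open>k\<close>. By Cramer's rule it gives the ratio by which the
  determinant changes when that column is replaced.\<close>

lemma exchange_column:
  fixes A :: "real mat"
  assumes A: "A \<in> carrier_mat d d" "det A \<noteq> 0" and k: "k < d"
  shows "\<exists>y. y \<noteq> (\<lambda>_. 0) \<and> (\<forall>a. \<not> a < d \<longrightarrow> y a = 0) \<and> (\<forall>b<d. (\<Sum>a<d. A $$ (a, b) * y a) = of_bool (b = k)) \<and>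
    (\<forall>v. det (mat d d (\<lambda>(a, b). if b = k then v a else A $$ (a, b))) = (\<Sum>a<d. v a * y a) * det A)"
proof -
  obtain B where B: "B \<in> carrier_mat d d" "B * A = 1\<^sub>m d" "A * B = 1\<^sub>m d"
    using det_non_zero_imp_unit[OF A, of undefined] by (auto simp: Units_def ring_mat_def)
  \<comment> \<open>Zero beyond \<open>d\<close>, so that \<open>y\<close> being a nonzero function
    yields a nonzero entry among the first \<open>d\<close>.\<close>
  define y where "y = (\<lambda>a. if a < d then B $$ (k, a) else 0)"
  show ?thesis
  proof (intro exI[of _ y] conjI allI impI)
    show *: "(\<Sum>a<d. A $$ (a, b) * y a) = of_bool (b = k)" if "b < d" for b
    proof -
      have "(B * A) $$ (k, b) = (\<Sum>a<d. A $$ (a, b) * y a)"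
        using A(1) B(1) that k by (simp add: scalar_prod_def y_def lessThan_atLeast0 mult.commute)
      moreover have "(B * A) $$ (k, b) = of_bool (b = k)" using that k unfolding B(2) by auto
      ultimately show ?thesis by simp
    qed
    show "y \<noteq> (\<lambda>_. 0)" using *[OF k] by auto
    show "y a = 0" if "\<not> a < d" for a using that by (simp add: y_def)
    fix v :: "nat \<Rightarrow> real"
    have "A *\<^sub>v (B *\<^sub>v vec d v) = vec d v"
      using A B by (simp flip: assoc_mult_mat_vec)
    then have "replace_col A (A *\<^sub>v (B *\<^sub>v vec d v)) k = mat d d (\<lambda>(a, b). if b = k then v a else A $$ (a, b))"
      using A by (intro eq_matI) (auto simp: replace_col_def)
    moreover have "(B *\<^sub>v vec d v) $ k = (\<Sum>a<d. v a * y a)"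
      using B k by (simp add: scalar_prod_def y_def lessThan_atLeast0 mult.commute)
    moreover have "B *\<^sub>v vec d v \<in> carrier_vec d" using B by simp
    ultimately show "det (mat d d (\<lambda>(a, b). if b = k then v a else A $$ (a, b))) = (\<Sum>a<d. v a * y a) * det A"
      using cramer_lemma_mat[OF A(1) _ k] by metis
  qed
qed

lemma exchange_form:
  assumes y: "y \<noteq> (\<lambda>_. 0)" "\<And>a. \<not> a < d \<Longrightarrow> y a = 0"
  obtains i where "i < n" "form i y \<noteq> 0"
  using full[of y] y by (metis ext)

text \<open>Start from the identity matrix and replace its columns one at a time. Full rank provides
  a column of \<open>W\<close> on which the dual functional is nonzero, so the determinant stays
  nonzero.\<close>

lemma nonsingular_select: "\<exists>f. (\<forall>b<d. f b < n) \<and> det (select d W f) \<noteq> 0"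
proof -
  let ?A = "\<lambda>k f. mat d d (\<lambda>(a, b). if b < k then W a (f b) else of_bool (a = b))"
  have "\<exists>f. (\<forall>b<k. f b < n) \<and> det (?A k f) \<noteq> 0" if "k \<le> d" for k
    using that
  proof (induction k)
    case 0
    have "?A 0 f = 1\<^sub>m d" for f by (intro eq_matI) auto
    then show ?case by simp
  next
    case (Suc k)
    then obtain f where f: "\<forall>b<k. f b < n" "det (?A k f) \<noteq> 0" by auto
    have k: "k < d" using Suc.prems by simp
    define B where "B = ?A k f"
    have B: "B \<in> carrier_mat d d" "det B \<noteq> 0" using f by (simp_all add: B_def)
    obtain y where y: "y \<noteq> (\<lambda>_. 0)" "\<And>a. \<not> a < d \<Longrightarrow> y a = 0"
      and det: "\<And>v. det (mat d d (\<lambda>(a, b). if b = k then v a else B $$ (a, b))) = (\<Sum>a<d. v a * y a) * det B"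
      using exchange_column[OF B k] by (elim exE conjE) simp
    obtain i where i: "i < n" "form i y \<noteq> 0" using exchange_form[OF y] .
    have "?A (Suc k) (f(k := i)) = mat d d (\<lambda>(a, b). if b = k then W a i else B $$ (a, b))"
      unfolding B_def by (intro eq_matI) (auto simp: less_Suc_eq)
    then have "det (?A (Suc k) (f(k := i))) = form i y * det B"
      using det[of "\<lambda>a. W a i"] by (simp add: column_form_def)
    then show ?case using f B i by (intro exI[of _ "f(k := i)"]) (auto simp: less_Suc_eq)
  qed
  from this[of d] obtain f where f: "\<forall>b<d. f b < n" "det (?A d f) \<noteq> 0" by auto
  have "?A d f = select d W f" unfolding select_def by (intro eq_matI) auto
  then show ?thesis using f by auto
qed

section \<open>Reduction to extreme rays\<close>

text \<open>Stated without chambers: the forms that vanish at \<open>x\<close> cut out the line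
  through \<open>x\<close>. Points are compared by the values of the forms, which ignores entries
  beyond \<open>d\<close>.\<close>

definition extreme_ray :: "(nat \<Rightarrow> real) \<Rightarrow> bool" where
  "extreme_ray x \<longleftrightarrow> (\<exists>i<n. form i x \<noteq> 0) \<and>
     (\<forall>y. (\<forall>i<n. form i x = 0 \<longrightarrow> form i y = 0) \<longrightarrow> (\<exists>\<rho>. \<forall>i<n. form i y = \<rho> * form i x))"

text \<open>Among the nonsingular choices of \<open>d\<close> columns, take one with as many columns
  orthogonal to \<open>x\<close> as possible. A functional dual to a column not orthogonal to
  \<open>x\<close> is then a multiple of \<open>x\<close>, so by Cramer's rule the values of the
  forms at \<open>x\<close> are, up to one common factor, maximal minors.\<close>

lemma extreme_ray_scaling:
  assumes minors: "\<And>f. (\<And>b. b < d \<Longrightarrow> f b < n) \<Longrightarrow> det (select d W f) \<noteq> 0 \<Longrightarrow>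
      1 \<le> \<bar>det (select d W f)\<bar> \<and> \<bar>det (select d W f)\<bar> \<le> \<Delta>"
    and x: "extreme_ray x"
  shows "\<exists>\<mu>>0. \<forall>i<n. form i x = 0 \<or> 1 \<le> \<mu> * \<bar>form i x\<bar> \<and> \<mu> * \<bar>form i x\<bar> \<le> \<Delta>"
proof -
  define cnt where "cnt = (\<lambda>f. card {b. b < d \<and> form (f b) x = 0})"
  let ?P = "\<lambda>f. (\<forall>b<d. f b < n) \<and> det (select d W f) \<noteq> 0"
  have bound: "cnt f < Suc d" for f
    using card_mono[of "{..<d}" "{b. b < d \<and> form (f b) x = 0}"] by (fastforce simp: cnt_def less_Suc_eq_le)
  obtain f where f: "?P f" and max: "\<And>g. ?P g \<Longrightarrow> cnt g \<le> cnt f"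
    using nonsingular_select ex_has_greatest_nat[of ?P _ cnt "Suc d"] bound by blast
  let ?A = "select d W f"
  have "\<exists>k<d. form (f k) x \<noteq> 0"
  proof (rule ccontr)
    assume *: "\<not> ?thesis"
    have "?A\<^sup>T *\<^sub>v vec d x = 0\<^sub>v d"
      using * by (intro eq_vecI) (auto simp: select_def scalar_prod_def column_form_def lessThan_atLeast0)
    moreover have "det ?A\<^sup>T \<noteq> 0" using f by (simp add: det_transpose[of _ d])
    ultimately have "vec d x = 0\<^sub>v d"
      using det_0_iff_vec_prod_zero_field[of "?A\<^sup>T" d] by (metis select_carrier transpose_carrier_mat vec_carrier)
    then have "x a = 0" if "a < d" for a using that by (metis index_vec index_zero_vec(1))
    then show False using x by (auto simp: extreme_ray_def column_form_def)
  qed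
  then obtain k where k: "k < d" "form (f k) x \<noteq> 0" by blast
  obtain y where y: "\<And>b. b < d \<Longrightarrow> (\<Sum>a<d. ?A $$ (a, b) * y a) = of_bool (b = k)"
    and det: "\<And>v. det (mat d d (\<lambda>(a, b). if b = k then v a else ?A $$ (a, b))) = (\<Sum>a<d. v a * y a) * det ?A"
    using exchange_column[OF select_carrier conjunct2[OF f] k(1)] by (elim exE conjE) presburger
  have det': "det (select d W (f(k := i))) = form i y * det ?A" for i
  proof -
    have "select d W (f(k := i)) = mat d d (\<lambda>(a, b). if b = k then W a i else ?A $$ (a, b))"
      unfolding select_def by (intro eq_matI) auto
    then show ?thesis using det[of "\<lambda>a. W a i"] by (simp add: column_form_def)
  qed
  \<comment> \<open>Otherwise column \<open>i\<close> could replace column \<open>f k\<close>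
    without making the matrix singular, and one more chosen column would be orthogonal to
    \<open>x\<close>.\<close>
  have "form i y = 0" if i: "i < n" "form i x = 0" for i
  proof (rule ccontr)
    assume "form i y \<noteq> 0"
    then have "?P (f(k := i))" using det'[of i] f i by auto
    then have "cnt (f(k := i)) \<le> cnt f" by (rule max)
    moreover have "{b. b < d \<and> form ((f(k := i)) b) x = 0} = insert k {b. b < d \<and> form (f b) x = 0}"
      using k i by auto
    ultimately show False using k by (simp add: cnt_def)
  qed
  then obtain \<rho> where \<rho>: "\<And>i. i < n \<Longrightarrow> form i y = \<rho> * form i x" using x unfolding extreme_ray_def by meson
  have "form (f k) y = 1" using y[OF k(1)] k(1) by (simp add: select_def column_form_def)
  then have "\<rho> \<noteq> 0" using \<rho>[of "f k"] f k by auto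
  show ?thesis
  \<comment> \<open>With this factor, the scaled absolute value of form \<open>i\<close> is exactly
    the absolute minor obtained by exchanging column \<open>k\<close> for column
    \<open>i\<close>.\<close>
  proof (intro exI[of _ "\<bar>\<rho> * det ?A\<bar>"] conjI allI impI)
    show "0 < \<bar>\<rho> * det ?A\<bar>" using \<open>\<rho> \<noteq> 0\<close> f by simp
    fix i assume i: "i < n"
    have eq: "\<bar>det (select d W (f(k := i)))\<bar> = \<bar>\<rho> * det ?A\<bar> * \<bar>form i x\<bar>"
      using \<rho>[OF i] det'[of i] by (simp add: abs_mult mult_ac)
    show "form i x = 0 \<or> 1 \<le> \<bar>\<rho> * det ?A\<bar> * \<bar>form i x\<bar> \<and> \<bar>\<rho> * det ?A\<bar> * \<bar>form i x\<bar> \<le> \<Delta>"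
    proof (cases "form i x = 0")
      case False
      then have "det (select d W (f(k := i))) \<noteq> 0" using \<open>\<rho> \<noteq> 0\<close> f \<rho>[OF i] det'[of i] by simp
      then show ?thesis using minors[of "f(k := i)"] f i unfolding eq by auto
    qed simp
  qed
qed

text \<open>A point that is not on an extreme ray is the sum of two points of its closed chamber on which
  more of the linear forms vanish, and \<open>\<Sum>i<n. c i * \<bar>form i x\<bar>\<close> is additive on a closed chamber.\<close>

lemma nonneg_from_extreme_rays:
  assumes ray: "\<And>x. extreme_ray x \<Longrightarrow> 0 \<le> (\<Sum>i<n. c i * \<bar>form i x\<bar>)"
  shows "0 \<le> (\<Sum>i<n. c i * \<bar>form i x\<bar>)"
proof (induction "card {i. i < n \<and> form i x \<noteq> 0}" arbitrary: x rule: less_induct)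
  case less
  let ?N = "{i. i < n \<and> form i x \<noteq> 0}"
  consider "?N = {}" | "extreme_ray x" | "?N \<noteq> {}" "\<not> extreme_ray x" by blast
  then show ?case
  proof cases
    case 1
    then show ?thesis by (intro sum_nonneg) auto
  next
    case 2
    then show ?thesis by (rule ray)
  next
    case 3
    then obtain y where y: "\<And>i. i < n \<Longrightarrow> form i x = 0 \<Longrightarrow> form i y = 0"
      and np: "\<And>\<rho>. \<exists>i<n. form i y \<noteq> \<rho> * form i x" unfolding extreme_ray_def by blast
    \<comment> \<open>Where form \<open>i\<close> vanishes at \<open>x\<close> it vanishes at
      \<open>y\<close> too, so the default value of the division is harmless in
      \<open>yr\<close>.\<close>
    define r where "r i = form i y / form i x" for i
    have yr: "form i y = r i * form i x" if "i < n" for i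
      using y[OF that] by (cases "form i x = 0") (auto simp: r_def)
    define \<alpha> where "\<alpha> = Min (r ` ?N)"
    define \<beta> where "\<beta> = Max (r ` ?N)"
    have fin: "finite (r ` ?N)" "r ` ?N \<noteq> {}" using 3 by auto
    have ab: "\<alpha> \<le> r i" "r i \<le> \<beta>" if "i \<in> ?N" for i
      using that fin by (auto simp: \<alpha>_def \<beta>_def)
    obtain i1 where i1: "i1 \<in> ?N" "r i1 = \<alpha>"
      using Min_in[OF fin] unfolding \<alpha>_def[symmetric] by (elim imageE) simp
    obtain i2 where i2: "i2 \<in> ?N" "r i2 = \<beta>"
      using Max_in[OF fin] unfolding \<beta>_def[symmetric] by (elim imageE) simp
    obtain j where j: "j < n" "form j y \<noteq> \<alpha> * form j x" using np by blast
    then have "j \<in> ?N" using yr by auto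
    then have lt: "\<alpha> < \<beta>" using ab[of j] j yr[of j] by auto
    \<comment> \<open>\<open>p\<close> and \<open>q\<close> add up to \<open>x\<close>. Their ratios
      to \<open>x\<close> on the forms lie between 0 and 1, and each vanishes at an extremal ratio
      \<open>r\<close>: \<open>p\<close> loses the form \<open>i1\<close> and \<open>q\<close> the
      form \<open>i2\<close>.\<close>
    define p where "p = (\<lambda>a. 1 / (\<beta> - \<alpha>) * (y a - \<alpha> * x a))"
    define q where "q = (\<lambda>a. 1 / (\<beta> - \<alpha>) * (\<beta> * x a - y a))"
    have p: "form i p = (r i - \<alpha>) / (\<beta> - \<alpha>) * form i x" if "i < n" for i
      unfolding p_def column_form_scale column_form_diff yr[OF that] by (simp add: algebra_simps add_divide_distrib diff_divide_distrib)
    have q: "form i q = (\<beta> - r i) / (\<beta> - \<alpha>) * form i x" if "i < n" for i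
      unfolding q_def column_form_scale column_form_diff yr[OF that] by (simp add: algebra_simps add_divide_distrib diff_divide_distrib)
    have "i1 \<notin> {i. i < n \<and> form i p \<noteq> 0}" "{i. i < n \<and> form i p \<noteq> 0} \<subseteq> ?N"
      "i2 \<notin> {i. i < n \<and> form i q \<noteq> 0}" "{i. i < n \<and> form i q \<noteq> 0} \<subseteq> ?N"
      using i1 i2 p q by auto
    with i1(1) i2(1) have "{i. i < n \<and> form i p \<noteq> 0} \<subset> ?N" "{i. i < n \<and> form i q \<noteq> 0} \<subset> ?N"
      by blast+
    then have "0 \<le> (\<Sum>i<n. c i * \<bar>form i p\<bar>)" "0 \<le> (\<Sum>i<n. c i * \<bar>form i q\<bar>)"
      by (auto intro!: less psubset_card_mono)
    moreover have "(\<Sum>i<n. c i * \<bar>form i x\<bar>) = (\<Sum>i<n. c i * \<bar>form i p\<bar>) + (\<Sum>i<n. c i * \<bar>form i q\<bar>)"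
      unfolding sum.distrib[symmetric]
    proof (intro sum.cong refl)
      fix i assume "i \<in> {..<n}"
      then have i: "i < n" by simp
      show "c i * \<bar>form i x\<bar> = c i * \<bar>form i p\<bar> + c i * \<bar>form i q\<bar>"
      proof (cases "form i x = 0")
        case False
        then have "\<alpha> \<le> r i" "r i \<le> \<beta>" using ab i by auto
        then have "\<bar>form i p\<bar> = (r i - \<alpha>) / (\<beta> - \<alpha>) * \<bar>form i x\<bar>" "\<bar>form i q\<bar> = (\<beta> - r i) / (\<beta> - \<alpha>) * \<bar>form i x\<bar>"
          using lt by (simp_all add: p[OF i] q[OF i] abs_mult)
        moreover have "(r i - \<alpha>) / (\<beta> - \<alpha>) + (\<beta> - r i) / (\<beta> - \<alpha>) = 1"
          using lt by (simp add: add_divide_distrib[symmetric])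
        ultimately show ?thesis by (metis distrib_left distrib_right mult_1)
      qed (use i p q in auto)
    qed
    ultimately show ?thesis by linarith
  qed
qed

text \<open>For \<open>t = 0\<close> or \<open>1 \<le> \<bar>t\<bar> \<le> \<Delta>\<close> one has
  \<open>\<bar>t\<bar> \<le> t^2 \<le> \<Delta> * \<bar>t\<bar>\<close>. Each spectral bound, framed
  by these two inequalities, becomes a bound for absolute values on a scaled extreme ray.\<close>

lemma l1_sparsification:
  assumes minors: "\<And>f. (\<And>b. b < d \<Longrightarrow> f b < n) \<Longrightarrow> det (select d W f) \<noteq> 0 \<Longrightarrow>
      1 \<le> \<bar>det (select d W f)\<bar> \<and> \<bar>det (select d W f)\<bar> \<le> \<Delta>"
    and \<Delta>: "0 < \<Delta>" and s: "\<And>i. i < n \<Longrightarrow> 0 \<le> s i"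
    and low: "\<And>z. (\<Sum>i<n. (form i z)\<^sup>2) \<le> (\<Sum>i<n. s i * (form i z)\<^sup>2)"
    and up: "\<And>z. (\<Sum>i<n. s i * (form i z)\<^sup>2) \<le> \<gamma> * (\<Sum>i<n. (form i z)\<^sup>2)" and \<gamma>: "0 \<le> \<gamma>"
  shows "(\<Sum>i<n. \<bar>form i x\<bar>) \<le> (\<Sum>i<n. \<Delta> * s i * \<bar>form i x\<bar>)"
    "(\<Sum>i<n. \<Delta> * s i * \<bar>form i x\<bar>) \<le> \<Delta>\<^sup>2 * \<gamma> * (\<Sum>i<n. \<bar>form i x\<bar>)"
proof -
  have ray: "(\<Sum>i<n. \<bar>form i x\<bar>) \<le> (\<Sum>i<n. \<Delta> * s i * \<bar>form i x\<bar>) \<and>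
     (\<Sum>i<n. \<Delta> * s i * \<bar>form i x\<bar>) \<le> \<Delta>\<^sup>2 * \<gamma> * (\<Sum>i<n. \<bar>form i x\<bar>)" if x: "extreme_ray x" for x
  proof -
    obtain \<mu> where \<mu>: "0 < \<mu>" "\<And>i. i < n \<Longrightarrow> form i x = 0 \<or> 1 \<le> \<mu> * \<bar>form i x\<bar> \<and> \<mu> * \<bar>form i x\<bar> \<le> \<Delta>"
      using extreme_ray_scaling[OF minors x] by auto
    define z where "z = (\<lambda>a. \<mu> * x a)"
    have z: "form i z = \<mu> * form i x" for i by (simp add: z_def column_form_scale)
    have z1: "\<bar>form i z\<bar> \<le> (form i z)\<^sup>2" and z2: "(form i z)\<^sup>2 \<le> \<Delta> * \<bar>form i z\<bar>" if "i < n" for i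
    proof -
      have "form i z = 0 \<or> 1 \<le> \<bar>form i z\<bar> \<and> \<bar>form i z\<bar> \<le> \<Delta>" using \<mu> that by (auto simp: z abs_mult)
      moreover have "(form i z)\<^sup>2 = \<bar>form i z\<bar> * \<bar>form i z\<bar>" by (simp add: power2_eq_square)
      ultimately show "\<bar>form i z\<bar> \<le> (form i z)\<^sup>2" "(form i z)\<^sup>2 \<le> \<Delta> * \<bar>form i z\<bar>"
        using mult_right_mono[of 1 "\<bar>form i z\<bar>" "\<bar>form i z\<bar>"] mult_right_mono[of "\<bar>form i z\<bar>" \<Delta> "\<bar>form i z\<bar>"] by auto
    qed
    have "(\<Sum>i<n. \<bar>form i z\<bar>) \<le> (\<Sum>i<n. (form i z)\<^sup>2)" using z1 by (intro sum_mono) auto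
    also have "\<dots> \<le> (\<Sum>i<n. s i * (form i z)\<^sup>2)" by (rule low)
    also have "\<dots> \<le> (\<Sum>i<n. s i * (\<Delta> * \<bar>form i z\<bar>))" using z2 s by (intro sum_mono mult_left_mono) auto
    finally have 1: "(\<Sum>i<n. \<bar>form i z\<bar>) \<le> (\<Sum>i<n. \<Delta> * s i * \<bar>form i z\<bar>)" by (simp add: mult_ac)
    have "(\<Sum>i<n. s i * \<bar>form i z\<bar>) \<le> (\<Sum>i<n. s i * (form i z)\<^sup>2)" using z1 s by (intro sum_mono mult_left_mono) auto
    also have "\<dots> \<le> \<gamma> * (\<Sum>i<n. (form i z)\<^sup>2)" by (rule up)
    also have "\<dots> \<le> \<gamma> * (\<Sum>i<n. \<Delta> * \<bar>form i z\<bar>)" using z2 \<gamma> by (intro mult_left_mono sum_mono) auto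
    finally have "\<Delta> * (\<Sum>i<n. s i * \<bar>form i z\<bar>) \<le> \<Delta> * (\<gamma> * (\<Sum>i<n. \<Delta> * \<bar>form i z\<bar>))"
      using \<Delta> by (intro mult_left_mono) auto
    then have 2: "(\<Sum>i<n. \<Delta> * s i * \<bar>form i z\<bar>) \<le> \<Delta>\<^sup>2 * \<gamma> * (\<Sum>i<n. \<bar>form i z\<bar>)"
      by (simp add: sum_distrib_left power2_eq_square mult_ac)
    have "(\<Sum>i<n. b i * \<bar>form i z\<bar>) = \<mu> * (\<Sum>i<n. b i * \<bar>form i x\<bar>)" for b
      using \<mu>(1) by (simp add: z abs_mult sum_distrib_left mult_ac)
    from 1 2 this[of "\<lambda>_. 1"] this[of "\<lambda>i. \<Delta> * s i"] show ?thesis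
      using \<mu>(1) by (simp add: mult.left_commute[of _ \<mu>])
  qed
  \<comment> \<open>The reduction to rays admits coefficients of either sign, so it applies to the
    difference of the two sides.\<close>
  have "0 \<le> (\<Sum>i<n. (\<Delta> * s i - 1) * \<bar>form i x\<bar>)"
    by (rule nonneg_from_extreme_rays) (use ray in \<open>simp add: algebra_simps sum_subtractf\<close>)
  then show "(\<Sum>i<n. \<bar>form i x\<bar>) \<le> (\<Sum>i<n. \<Delta> * s i * \<bar>form i x\<bar>)"
    by (simp add: algebra_simps sum_subtractf)
  have "0 \<le> (\<Sum>i<n. (\<Delta>\<^sup>2 * \<gamma> - \<Delta> * s i) * \<bar>form i x\<bar>)"
    by (rule nonneg_from_extreme_rays) (use ray in \<open>simp add: left_diff_distrib sum_subtractf sum_distrib_left\<close>)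
  then show "(\<Sum>i<n. \<Delta> * s i * \<bar>form i x\<bar>) \<le> \<Delta>\<^sup>2 * \<gamma> * (\<Sum>i<n. \<bar>form i x\<bar>)"
    by (simp add: left_diff_distrib sum_subtractf sum_distrib_left)
qed

end

section \<open>Reasoning about running times\<close>

text \<open>Constant and degree are separate parameters so that the rules below compute them:
  sequencing adds constants and takes the larger degree, and a loop raises the degree by
  one.\<close>

definition reach :: "nat \<Rightarrow> nat \<Rightarrow> nat \<Rightarrow> com \<Rightarrow> state \<Rightarrow> state \<Rightarrow> bool" where
  "reach s c k p \<sigma> \<tau> \<longleftrightarrow> (\<exists>t. exec p \<sigma> t \<tau> \<and> t \<le> c * Suc s ^ k)"

lemma reach_mono:
  assumes "reach s c k p \<sigma> \<tau>" "c \<le> c'" "k \<le> k'" shows "reach s c' k' p \<sigma> \<tau>"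
proof -
  have "c * Suc s ^ k \<le> c' * Suc s ^ k'" using assms by (intro mult_le_mono power_increasing) auto
  then show ?thesis using assms(1) le_trans unfolding reach_def by blast
qed

lemma reach_Skip: "reach s 1 0 Skip \<sigma> \<sigma>"
  unfolding reach_def using exec_Skip by fastforce

lemma reach_NAssign: "reach s 1 0 (NAssign x a) \<sigma> (nupdate x (nval a \<sigma>) \<sigma>)"
  unfolding reach_def using exec_NAssign by fastforce

lemma reach_RAssign: "reach s 1 0 (RAssign x a b p) \<sigma> (rupdate x (nval a \<sigma>) (nval b \<sigma>) (rval p \<sigma>) \<sigma>)"
  unfolding reach_def using exec_RAssign by fastforce

lemma reach_Seq:
  assumes "reach s c k p \<sigma> \<tau>" "reach s c' k' q \<tau> \<rho>"
  shows "reach s (c + c') (max k k') (Seq p q) \<sigma> \<rho>"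
proof -
  have "reach s c (max k k') p \<sigma> \<tau>" "reach s c' (max k k') q \<tau> \<rho>" using assms reach_mono by auto
  then obtain t t' where "exec p \<sigma> t \<tau>" "exec q \<tau> t' \<rho>" "t \<le> c * Suc s ^ max k k'" "t' \<le> c' * Suc s ^ max k k'"
    by (auto simp: reach_def)
  then show ?thesis unfolding reach_def
    by (intro exI[of _ "t + t'"]) (auto intro: exec_Seq simp: distrib_right)
qed

lemma reach_Cond:
  assumes "reach s c k (if bval b \<sigma> then p else q) \<sigma> \<tau>"
  shows "reach s (Suc c) k (Cond b p q) \<sigma> \<tau>"
proof -
  obtain t where t: "exec (if bval b \<sigma> then p else q) \<sigma> t \<tau>" "t \<le> c * Suc s ^ k"
    using assms by (auto simp: reach_def)
  have "exec (Cond b p q) \<sigma> (1 + t) \<tau>"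
    using t(1) exec_CondTrue[of b \<sigma> p t \<tau> q] exec_CondFalse[of b \<sigma> q t \<tau> p] by (cases "bval b \<sigma>") simp_all
  moreover have "1 + t \<le> Suc c * Suc s ^ k" using t(2) add_mono[of 1 "Suc s ^ k" t "c * Suc s ^ k"] by simp
  ultimately show ?thesis unfolding reach_def by blast
qed

text \<open>The number of iterations is only bounded, not prescribed, as suits the loop that
  determines the number of rounds.\<close>

lemma exec_While_count:
  assumes "bound - k = m" "I k \<tau>" "k \<le> bound"
    and stop: "\<And>k \<tau>. I k \<tau> \<Longrightarrow> bval b \<tau> \<Longrightarrow> k < bound"
    and step: "\<And>k \<tau>. I k \<tau> \<Longrightarrow> bval b \<tau> \<Longrightarrow> \<exists>\<rho> t. exec p \<tau> t \<rho> \<and> t \<le> C \<and> I (Suc k) \<rho>"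
  shows "\<exists>\<rho> t j. exec (While b p) \<tau> t \<rho> \<and> t \<le> m * (C + 1) + 1 \<and> I j \<rho> \<and> \<not> bval b \<rho> \<and> j \<le> bound"
  using assms(1-3)
proof (induction m arbitrary: k \<tau>)
  case 0
  then have "\<not> bval b \<tau>" using stop[of k \<tau>] by auto
  then have "exec (While b p) \<tau> 1 \<tau>" by (rule exec_WhileFalse)
  then show ?case using 0 \<open>\<not> bval b \<tau>\<close> by (intro exI[of _ \<tau>] exI[of _ 1] exI[of _ k]) simp
next
  case (Suc m)
  show ?case
  proof (cases "bval b \<tau>")
    case True
    obtain \<rho> t where t: "exec p \<tau> t \<rho>" "t \<le> C" "I (Suc k) \<rho>" using step[OF Suc.prems(2) True] by blast
    have "bound - Suc k = m" "Suc k \<le> bound" using Suc.prems by auto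
    then obtain \<rho>' t' j where t': "exec (While b p) \<rho> t' \<rho>'" "t' \<le> m * (C + 1) + 1" "I j \<rho>'" "\<not> bval b \<rho>'" "j \<le> bound"
      using Suc.IH[of "Suc k" \<rho>] t by blast
    have "exec (While b p) \<tau> (1 + t + t') \<rho>'" using True t t' by (intro exec_WhileTrue)
    moreover have "1 + t + t' \<le> Suc m * (C + 1) + 1" using t t' by simp
    ultimately show ?thesis using t' by blast
  next
    case False
    moreover have "exec (While b p) \<tau> 1 \<tau>" using False by (rule exec_WhileFalse)
    ultimately show ?thesis using Suc.prems by (intro exI[of _ \<tau>] exI[of _ 1] exI[of _ k]) simp
  qed
qed

lemma reach_While:
  assumes "I 0 \<sigma>" and bound: "bound \<le> Suc s"
    and stop: "\<And>k \<tau>. I k \<tau> \<Longrightarrow> bval b \<tau> \<Longrightarrow> k < bound"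
    and step: "\<And>k \<tau>. I k \<tau> \<Longrightarrow> bval b \<tau> \<Longrightarrow> \<exists>\<rho>. reach s c e p \<tau> \<rho> \<and> I (Suc k) \<rho>"
  shows "\<exists>\<rho> j. reach s (c + 2) (Suc e) (While b p) \<sigma> \<rho> \<and> I j \<rho> \<and> \<not> bval b \<rho> \<and> j \<le> bound"
proof -
  let ?C = "c * Suc s ^ e"
  have "\<exists>\<rho> t j. exec (While b p) \<sigma> t \<rho> \<and> t \<le> bound * (?C + 1) + 1 \<and> I j \<rho> \<and> \<not> bval b \<rho> \<and> j \<le> bound"
    by (rule exec_While_count[of bound 0 bound I]) (use assms in \<open>auto simp: reach_def; blast\<close>)+
  \<comment> \<open>One test per iteration and the final failing test account for the increase of
    the constant by 2.\<close>
  moreover have "bound * (?C + 1) + 1 \<le> (c + 2) * Suc s ^ Suc e"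
  proof -
    have "bound * (?C + 1) \<le> Suc s * ((c + 1) * Suc s ^ e)"
      using bound by (intro mult_le_mono) (auto simp: algebra_simps)
    also have "\<dots> = (c + 1) * Suc s ^ Suc e" by (simp only: power_Suc mult_ac)
    finally have "bound * (?C + 1) + 1 \<le> (c + 1) * Suc s ^ Suc e + 1 * Suc s ^ Suc e"
      by (intro add_mono) (simp_all only: mult_1 one_le_power le_add1 Suc_eq_plus1_left)
    then show ?thesis by (simp only: distrib_right[symmetric] add.assoc one_add_one)
  qed
  ultimately show ?thesis unfolding reach_def by (meson le_trans)
qed

lemma reach_RAssign_eq:
  assumes "nval a \<sigma> = i" "nval b \<sigma> = j" "rval p \<sigma> = r"
  shows "reach s 1 0 (RAssign x a b p) \<sigma> (rupdate x i j r \<sigma>)"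
  using reach_RAssign[of s x a b p \<sigma>] assms by simp

definition For :: "vname \<Rightarrow> nexp \<Rightarrow> com \<Rightarrow> com" where
  "For i e p = Seq (NAssign i (NConst 0))
     (While (NLess (NVar i) e) (Seq p (NAssign i (NAdd (NVar i) (NConst 1)))))"

text \<open>The limit \<open>e\<close> is evaluated anew at each test, hence the hypothesis
  \<open>bound\<close>. The constant grows by 4: initialisation, increment and the two units of
  \<open>reach_While\<close>.\<close>

lemma reach_For:
  assumes init: "I 0 (nupdate i 0 \<sigma>)" and m: "m \<le> Suc s"
    and bound: "\<And>k \<tau>. k \<le> m \<Longrightarrow> fst \<tau> i = k \<Longrightarrow> I k \<tau> \<Longrightarrow> nval e \<tau> = m"
    and step: "\<And>k \<tau>. k < m \<Longrightarrow> fst \<tau> i = k \<Longrightarrow> I k \<tau> \<Longrightarrow>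
      \<exists>\<rho>. reach s c x p \<tau> \<rho> \<and> fst \<rho> i = k \<and> I (Suc k) (nupdate i (Suc k) \<rho>)"
  shows "\<exists>\<rho>. reach s (c + 4) (Suc x) (For i e p) \<sigma> \<rho> \<and> fst \<rho> i = m \<and> I m \<rho>"
proof -
  let ?J = "\<lambda>k \<tau>. k \<le> m \<and> fst \<tau> i = k \<and> I k \<tau>"
  let ?p = "Seq p (NAssign i (NAdd (NVar i) (NConst 1)))"
  let ?b = "NLess (NVar i) e"
  have "\<exists>\<rho> j. reach s ((c + 1) + 2) (Suc x) (While ?b ?p) (nupdate i 0 \<sigma>) \<rho> \<and> ?J j \<rho> \<and> \<not> bval ?b \<rho> \<and> j \<le> m"
  proof (rule reach_While[where I = ?J])
    show "?J 0 (nupdate i 0 \<sigma>)" using init by (simp add: nupdate_def)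
    show "k < m" if "?J k \<tau>" "bval ?b \<tau>" for k \<tau> using that bound[of k \<tau>] by auto
    fix k \<tau> assume J: "?J k \<tau>" and b: "bval ?b \<tau>"
    then have k: "k < m" using bound[of k \<tau>] by auto
    obtain \<rho> where \<rho>: "reach s c x p \<tau> \<rho>" "fst \<rho> i = k" "I (Suc k) (nupdate i (Suc k) \<rho>)"
      using step[of k \<tau>] k J by blast
    have "reach s (c + 1) (max x 0) ?p \<tau> (nupdate i (nval (NAdd (NVar i) (NConst 1)) \<rho>) \<rho>)"
      using \<rho>(1) reach_NAssign by (rule reach_Seq)
    then have "reach s (c + 1) x ?p \<tau> (nupdate i (Suc k) \<rho>)" using \<rho> by simp
    then show "\<exists>\<rho>. reach s (c + 1) x ?p \<tau> \<rho> \<and> ?J (Suc k) \<rho>"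
      using \<rho> k by (intro exI[of _ "nupdate i (Suc k) \<rho>"]) (simp add: nupdate_def)
  qed (use m in simp)
  then obtain \<rho> j where \<rho>: "reach s (c + 3) (Suc x) (While ?b ?p) (nupdate i 0 \<sigma>) \<rho>" "?J j \<rho>" "\<not> bval ?b \<rho>"
    by (auto simp: numeral_eq_Suc)
  have "reach s 1 0 (NAssign i (NConst 0)) \<sigma> (nupdate i 0 \<sigma>)"
    using reach_NAssign[of s i "NConst 0" \<sigma>] by simp
  from reach_Seq[OF this \<rho>(1)] have "reach s (c + 4) (Suc x) (For i e p) \<sigma> \<rho>"
    by (simp add: For_def numeral_eq_Suc)
  moreover have "j = m" using \<rho> bound[of j \<rho>] by auto
  ultimately show ?thesis using \<rho> by (intro exI[of _ \<rho>]) simp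
qed

section \<open>Frame conditions and summation loops\<close>

definition agree :: "vname set \<Rightarrow> vname set \<Rightarrow> state \<Rightarrow> state \<Rightarrow> bool" where
  "agree N R \<sigma> \<tau> \<longleftrightarrow> (\<forall>x. x \<notin> N \<longrightarrow> fst \<tau> x = fst \<sigma> x) \<and> (\<forall>y. y \<notin> R \<longrightarrow> snd \<tau> y = snd \<sigma> y)"

lemma agree_refl: "agree N R \<sigma> \<sigma>"
  by (simp add: agree_def)

lemma agree_nupdate: "agree N R \<sigma> \<tau> \<Longrightarrow> x \<in> N \<Longrightarrow> agree N R \<sigma> (nupdate x v \<tau>)"
  and agree_rupdate: "agree N R \<sigma> \<tau> \<Longrightarrow> y \<in> R \<Longrightarrow> agree N R \<sigma> (rupdate y a b z \<tau>)"
  by (auto simp: agree_def nupdate_def rupdate_def)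

lemma fst_nupdate [simp]: "fst (nupdate x v \<sigma>) y = (if y = x then v else fst \<sigma> y)"
  and snd_nupdate [simp]: "snd (nupdate x v \<sigma>) = snd \<sigma>"
  and fst_rupdate [simp]: "fst (rupdate A a b r \<sigma>) = fst \<sigma>"
  and snd_rupdate [simp]: "snd (rupdate A a b r \<sigma>) B = (if B = A then (snd \<sigma> A)(a := (snd \<sigma> A a)(b := r)) else snd \<sigma> B)"
  by (auto simp: nupdate_def rupdate_def)

abbreviation "loop_vars \<equiv> {''i'', ''j'', ''k''}"

text \<open>With a single summand this is an entrywise assignment, so matrix products, copies and
  traces share one correctness proof.\<close>

definition sum_into :: "vname \<Rightarrow> nexp \<Rightarrow> nexp \<Rightarrow> nexp \<Rightarrow> rexp \<Rightarrow> com" where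
  "sum_into A p q r e = For ''i'' p (For ''j'' q
     (Seq (RAssign A (NVar ''i'') (NVar ''j'') (RConst 0))
        (For ''k'' r (RAssign A (NVar ''i'') (NVar ''j'') (RAdd (RArr A (NVar ''i'') (NVar ''j'')) e)))))"

text \<open>The hypothesis on \<open>e\<close> covers all states that differ from the initial one in
  \<open>A\<close> and the loop variables, so the value of the summand cannot depend on the array
  being written.\<close>

lemma reach_sum_into:
  assumes bounds: "\<And>\<tau>. agree loop_vars {A} \<sigma> \<tau> \<Longrightarrow> nval p \<tau> = P \<and> nval q \<tau> = Q \<and> nval r \<tau> = R"
    and e: "\<And>\<tau>. agree loop_vars {A} \<sigma> \<tau> \<Longrightarrow> fst \<tau> ''i'' < P \<Longrightarrow> fst \<tau> ''j'' < Q \<Longrightarrow> fst \<tau> ''k'' < R \<Longrightarrow>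
       rval e \<tau> = E (fst \<tau> ''i'') (fst \<tau> ''j'') (fst \<tau> ''k'')"
    and size: "P \<le> Suc s" "Q \<le> Suc s" "R \<le> Suc s"
  shows "\<exists>\<tau>. reach s 14 3 (sum_into A p q r e) \<sigma> \<tau> \<and> agree loop_vars {A} \<sigma> \<tau> \<and>
    (\<forall>a<P. \<forall>b<Q. snd \<tau> A a b = (\<Sum>c<R. E a b c))"
proof -
  define S where "S a b = (\<Sum>c<R. E a b c)" for a b
  let ?ok = "\<lambda>\<tau>. agree loop_vars {A} \<sigma> \<tau>"
  \<comment> \<open>Invariants of the three loops, outermost first: the finished rows, the finished
    entries of the current row, the partial sum of the current entry.\<close>
  let ?I = "\<lambda>a \<tau>. ?ok \<tau> \<and> (\<forall>a'<a. \<forall>b'<Q. snd \<tau> A a' b' = S a' b')"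
  let ?J = "\<lambda>a b \<tau>. ?ok \<tau> \<and> fst \<tau> ''i'' = a \<and> (\<forall>a'<a. \<forall>b'<Q. snd \<tau> A a' b' = S a' b') \<and> (\<forall>b'<b. snd \<tau> A a b' = S a b')"
  let ?L = "\<lambda>a b c \<tau>. ?J a b \<tau> \<and> fst \<tau> ''j'' = b \<and> snd \<tau> A a b = (\<Sum>c'<c. E a b c')"
  let ?upd = "RAssign A (NVar ''i'') (NVar ''j'') (RAdd (RArr A (NVar ''i'') (NVar ''j'')) e)"
  let ?zero = "RAssign A (NVar ''i'') (NVar ''j'') (RConst 0)"
  have inner: "\<exists>\<rho>. reach s 5 1 (For ''k'' r ?upd) \<tau> \<rho> \<and> ?L a b R \<rho>" if "?L a b 0 \<tau>" "a < P" "b < Q" for a b \<tau>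
  proof -
    have "\<exists>\<rho>. reach s (1 + 4) (Suc 0) (For ''k'' r ?upd) \<tau> \<rho> \<and> fst \<rho> ''k'' = R \<and> ?L a b R \<rho>"
    proof (rule reach_For[where I = "?L a b" and m = R])
      show "?L a b 0 (nupdate ''k'' 0 \<tau>)" using that by (auto simp: agree_nupdate)
      fix k \<rho> assume "?L a b k \<rho>"
      then show "nval r \<rho> = R" using bounds by blast
    next
      fix k \<rho> assume k: "k < R" "fst \<rho> ''k'' = k" and L: "?L a b k \<rho>"
      have "rval e \<rho> = E a b k" using e[of \<rho>] L k that by auto
      then have "?L a b (Suc k) (nupdate ''k'' (Suc k) (rupdate A a b (snd \<rho> A a b + E a b k) \<rho>))"
        using L by (simp add: agree_nupdate agree_rupdate)
      moreover have "reach s 1 0 ?upd \<rho> (rupdate A a b (snd \<rho> A a b + E a b k) \<rho>)"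
        using reach_RAssign[of s A "NVar ''i''" "NVar ''j''" "RAdd (RArr A (NVar ''i'') (NVar ''j'')) e" \<rho>] L \<open>rval e \<rho> = E a b k\<close> by simp
      ultimately show "\<exists>\<rho>'. reach s 1 0 ?upd \<rho> \<rho>' \<and> fst \<rho>' ''k'' = k \<and> ?L a b (Suc k) (nupdate ''k'' (Suc k) \<rho>')"
        using k by (intro exI[of _ "rupdate A a b (snd \<rho> A a b + E a b k) \<rho>"]) auto
    qed (use size in simp)
    then show ?thesis by auto
  qed
  let ?p1 = "Seq ?zero (For ''k'' r ?upd)"
  have middle: "\<exists>\<rho>. reach s 10 2 (For ''j'' q ?p1) \<tau> \<rho> \<and> ?J a Q \<rho>" if "?J a 0 \<tau>" "a < P" for a \<tau>
  proof -
    have "\<exists>\<rho>. reach s (6 + 4) (Suc 1) (For ''j'' q ?p1) \<tau> \<rho> \<and> fst \<rho> ''j'' = Q \<and> ?J a Q \<rho>"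
    proof (rule reach_For[where I = "?J a" and m = Q])
      show "?J a 0 (nupdate ''j'' 0 \<tau>)" using that by (auto simp: agree_nupdate)
      fix k \<rho> assume "?J a k \<rho>"
      then show "nval q \<rho> = Q" using bounds by blast
    next
      fix b \<rho> assume b: "b < Q" "fst \<rho> ''j'' = b" and J: "?J a b \<rho>"
      have "reach s 1 0 ?zero \<rho> (rupdate A a b 0 \<rho>)"
        using reach_RAssign[of s A "NVar ''i''" "NVar ''j''" "RConst 0" \<rho>] J b by simp
      moreover have "?L a b 0 (rupdate A a b 0 \<rho>)" using J b by (auto simp: agree_rupdate)
      from inner[OF this that(2) b(1)]
      obtain \<rho>' where "reach s 5 1 (For ''k'' r ?upd) (rupdate A a b 0 \<rho>) \<rho>'" "?L a b R \<rho>'"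
        by (elim exE conjE) simp
      ultimately have "reach s 6 1 ?p1 \<rho> \<rho>'" "?L a b R \<rho>'"
        using reach_Seq[of s 1 0 ?zero \<rho> "rupdate A a b 0 \<rho>" 5 1] by auto
      moreover from this have "?J a (Suc b) (nupdate ''j'' (Suc b) \<rho>')"
        by (auto simp: agree_nupdate less_Suc_eq S_def)
      ultimately show "\<exists>\<rho>'. reach s 6 1 ?p1 \<rho> \<rho>' \<and> fst \<rho>' ''j'' = b \<and> ?J a (Suc b) (nupdate ''j'' (Suc b) \<rho>')"
        by blast
    qed (use size in simp)
    then show ?thesis by (auto simp: numeral_eq_Suc)
  qed
  have "\<exists>\<rho>. reach s (10 + 4) (Suc 2) (For ''i'' p (For ''j'' q ?p1)) \<sigma> \<rho> \<and> fst \<rho> ''i'' = P \<and> ?I P \<rho>"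
  proof (rule reach_For[where I = ?I and m = P])
    show "?I 0 (nupdate ''i'' 0 \<sigma>)" by (auto simp: agree_nupdate agree_refl)
    fix k \<rho> assume "?I k \<rho>"
    then show "nval p \<rho> = P" using bounds by blast
  next
    fix a \<rho> assume a: "a < P" "fst \<rho> ''i'' = a" and I: "?I a \<rho>"
    then obtain \<rho>' where "reach s 10 2 (For ''j'' q ?p1) \<rho> \<rho>'" "?J a Q \<rho>'" using middle[where a = a and \<tau> = \<rho>] by auto
    moreover from this have "?I (Suc a) (nupdate ''i'' (Suc a) \<rho>')"
      by (auto simp: agree_nupdate less_Suc_eq)
    ultimately show "\<exists>\<rho>'. reach s 10 2 (For ''j'' q ?p1) \<rho> \<rho>' \<and> fst \<rho>' ''i'' = a \<and> ?I (Suc a) (nupdate ''i'' (Suc a) \<rho>')"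
      by blast
  qed (use size in simp)
  then show ?thesis by (auto simp: sum_into_def S_def numeral_eq_Suc)
qed

section \<open>The sparsification program\<close>

text \<open>Real expressions cannot compare indices, so the identity matrix is stored as an
  array.\<close>

definition inputs :: "nat \<Rightarrow> nat \<Rightarrow> (nat \<Rightarrow> nat \<Rightarrow> real) \<Rightarrow> state \<Rightarrow> bool" where
  "inputs d n W \<sigma> \<longleftrightarrow> fst \<sigma> ''d'' = d \<and> fst \<sigma> ''n'' = n \<and> (\<forall>a<d. \<forall>i<n. snd \<sigma> ''W'' a i = W a i) \<and>
     (\<forall>a<d. \<forall>b<d. snd \<sigma> ''Id'' a b = of_bool (a = b))"

lemma inputs_agree:
  "inputs d n W \<sigma> \<Longrightarrow> agree N R \<sigma> \<tau> \<Longrightarrow> ''d'' \<notin> N \<Longrightarrow> ''n'' \<notin> N \<Longrightarrow> ''W'' \<notin> R \<Longrightarrow> ''Id'' \<notin> R \<Longrightarrow> inputs d n W \<tau>"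
  by (simp add: inputs_def agree_def)

abbreviation "vi \<equiv> NVar ''i''"
abbreviation "vj \<equiv> NVar ''j''"
abbreviation "vk \<equiv> NVar ''k''"
abbreviation "vq \<equiv> NVar ''q''"
abbreviation "vd \<equiv> NVar ''d''"
abbreviation "vn \<equiv> NVar ''n''"
abbreviation "n0 \<equiv> NConst 0"
abbreviation "n1 \<equiv> NConst 1"
abbreviation "cell A \<equiv> RArr A n0 n0"

text \<open>The update of \<open>''N''\<close> reads its row \<open>''q''\<close> throughout; the
  result is therefore built in \<open>''B''\<close> and then copied back.\<close>

definition invert_step :: com where
  "invert_step =
     Seq (sum_into ''Y'' vd n1 vd (RMul (RArr ''N'' vi vk) (RSub (RArr ''X'' vk vq) (RArr ''Id'' vk vq))))
    (Seq (sum_into ''B'' vd vd n1 (RSub (RArr ''N'' vi vj)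
            (RDiv (RMul (RArr ''Y'' vi n0) (RArr ''N'' vq vj)) (RAdd (RConst 1) (RArr ''Y'' vq n0)))))
         (sum_into ''N'' vd vd n1 (RArr ''B'' vi vj)))"

definition invert_com :: com where
  "invert_com = Seq (sum_into ''N'' vd vd n1 (RArr ''Id'' vi vj)) (For ''q'' vd invert_step)"

lemma reach_invert_step:
  assumes inp: "inputs d n W \<sigma>" and s: "d \<le> s" and q: "fst \<sigma> ''q'' = q" "q < d"
    and X: "\<And>a b. a < d \<Longrightarrow> b < d \<Longrightarrow> snd \<sigma> ''X'' a b = X a b"
    and N: "\<And>a b. a < d \<Longrightarrow> b < d \<Longrightarrow> snd \<sigma> ''N'' a b = inv_iter d X q a b"
  shows "\<exists>\<tau>. reach s 42 3 invert_step \<sigma> \<tau> \<and> agree loop_vars {''N'', ''Y'', ''B''} \<sigma> \<tau> \<and>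
    (\<forall>a<d. \<forall>b<d. snd \<tau> ''N'' a b = inv_iter d X (Suc q) a b)"
proof -
  note size = s q
  define y where "y = inv_coeff d X q (inv_iter d X q)"
  let ?p1 = "sum_into ''Y'' vd n1 vd (RMul (RArr ''N'' vi vk) (RSub (RArr ''X'' vk vq) (RArr ''Id'' vk vq)))"
  let ?p2 = "sum_into ''B'' vd vd n1 (RSub (RArr ''N'' vi vj)
            (RDiv (RMul (RArr ''Y'' vi n0) (RArr ''N'' vq vj)) (RAdd (RConst 1) (RArr ''Y'' vq n0))))"
  let ?p3 = "sum_into ''N'' vd vd n1 (RArr ''B'' vi vj)"
  have "\<exists>\<tau>. reach s 14 3 ?p1 \<sigma> \<tau> \<and> agree loop_vars {''Y''} \<sigma> \<tau> \<and>
    (\<forall>a<d. \<forall>b<1. snd \<tau> ''Y'' a b = (\<Sum>c<d. inv_iter d X q a c * (X c q - of_bool (c = q))))"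
    by (rule reach_sum_into) (use inp X N size in \<open>auto simp: agree_def inputs_def\<close>)
  then obtain \<sigma>1 where r1: "reach s 14 3 ?p1 \<sigma> \<sigma>1" and a1: "agree loop_vars {''Y''} \<sigma> \<sigma>1"
    and Y: "\<And>a. a < d \<Longrightarrow> snd \<sigma>1 ''Y'' a 0 = y a" by (auto simp: y_def inv_coeff_def)
  have "\<exists>\<tau>. reach s 14 3 ?p2 \<sigma>1 \<tau> \<and> agree loop_vars {''B''} \<sigma>1 \<tau> \<and>
    (\<forall>a<d. \<forall>b<d. snd \<tau> ''B'' a b = (\<Sum>c<(1::nat). inv_iter d X q a b - y a * inv_iter d X q q b / (1 + y q)))"
    by (rule reach_sum_into) (use inp X N size a1 Y in \<open>auto simp: agree_def inputs_def\<close>)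
  then obtain \<sigma>2 where r2: "reach s 14 3 ?p2 \<sigma>1 \<sigma>2" and a2: "agree loop_vars {''B''} \<sigma>1 \<sigma>2"
    and B: "\<And>a b. a < d \<Longrightarrow> b < d \<Longrightarrow> snd \<sigma>2 ''B'' a b = inv_iter d X (Suc q) a b"
    by (auto simp: y_def)
  have "\<exists>\<tau>. reach s 14 3 ?p3 \<sigma>2 \<tau> \<and> agree loop_vars {''N''} \<sigma>2 \<tau> \<and>
    (\<forall>a<d. \<forall>b<d. snd \<tau> ''N'' a b = (\<Sum>c<(1::nat). inv_iter d X (Suc q) a b))"
    by (rule reach_sum_into) (use inp size a1 a2 B in \<open>auto simp: agree_def inputs_def simp del: inv_iter.simps\<close>)
  then obtain \<sigma>3 where r3: "reach s 14 3 ?p3 \<sigma>2 \<sigma>3" and a3: "agree loop_vars {''N''} \<sigma>2 \<sigma>3"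
    and N': "\<forall>a<d. \<forall>b<d. snd \<sigma>3 ''N'' a b = inv_iter d X (Suc q) a b"
    by (auto simp del: inv_iter.simps)
  have "reach s 42 3 invert_step \<sigma> \<sigma>3"
    using reach_Seq[OF r1 reach_Seq[OF r2 r3]] by (simp add: invert_step_def)
  moreover have "agree loop_vars {''N'', ''Y'', ''B''} \<sigma> \<sigma>3"
    using a1 a2 a3 by (simp add: agree_def)
  ultimately show ?thesis using N' by blast
qed

lemma reach_invert_com:
  assumes inp: "inputs d n W \<sigma>" and s: "d \<le> s"
    and X: "\<And>a b. a < d \<Longrightarrow> b < d \<Longrightarrow> snd \<sigma> ''X'' a b = X a b"
  shows "\<exists>\<tau>. reach s 60 4 invert_com \<sigma> \<tau> \<and> agree (insert ''q'' loop_vars) {''N'', ''Y'', ''B''} \<sigma> \<tau> \<and>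
    (\<forall>a<d. \<forall>b<d. snd \<tau> ''N'' a b = inv_iter d X d a b)"
proof -
  let ?V = "insert ''q'' loop_vars" and ?R = "{''N'', ''Y'', ''B''}"
  let ?p1 = "sum_into ''N'' vd vd n1 (RArr ''Id'' vi vj)"
  have "\<exists>\<tau>. reach s 14 3 ?p1 \<sigma> \<tau> \<and> agree loop_vars {''N''} \<sigma> \<tau> \<and>
    (\<forall>a<d. \<forall>b<d. snd \<tau> ''N'' a b = (\<Sum>c<(1::nat). of_bool (a = b)))"
    by (rule reach_sum_into) (use inp s in \<open>auto simp: agree_def inputs_def\<close>)
  then obtain \<sigma>1 where r1: "reach s 14 3 ?p1 \<sigma> \<sigma>1" and a1: "agree loop_vars {''N''} \<sigma> \<sigma>1"
    and N1: "\<forall>a<d. \<forall>b<d. snd \<sigma>1 ''N'' a b = inv_iter d X 0 a b" by auto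
  let ?I = "\<lambda>q \<tau>. agree ?V ?R \<sigma> \<tau> \<and> (\<forall>a<d. \<forall>b<d. snd \<tau> ''N'' a b = inv_iter d X q a b)"
  have "\<exists>\<rho>. reach s (42 + 4) (Suc 3) (For ''q'' vd invert_step) \<sigma>1 \<rho> \<and> fst \<rho> ''q'' = d \<and> ?I d \<rho>"
  proof (rule reach_For[where I = ?I])
    show "?I 0 (nupdate ''q'' 0 \<sigma>1)" using a1 N1 by (auto simp: agree_def)
    show "d \<le> Suc s" using s by simp
    show "nval vd \<tau> = d" if "?I k \<tau>" for k \<tau> using that inp by (simp add: agree_def inputs_def)
    fix k \<tau> assume k: "k < d" "fst \<tau> ''q'' = k" and I: "?I k \<tau>"
    have inp': "inputs d n W \<tau>" using inp I by (auto intro: inputs_agree)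
    have X': "snd \<tau> ''X'' a b = X a b" if "a < d" "b < d" for a b
      using that X I by (simp add: agree_def)
    have N': "snd \<tau> ''N'' a b = inv_iter d X k a b" if "a < d" "b < d" for a b
      using that I by simp
    obtain \<rho> where \<rho>: "reach s 42 3 invert_step \<tau> \<rho>" "agree loop_vars ?R \<tau> \<rho>"
      "\<forall>a<d. \<forall>b<d. snd \<rho> ''N'' a b = inv_iter d X (Suc k) a b"
      using reach_invert_step[OF inp' s k(2,1) X' N'] by blast
    have "?I (Suc k) (nupdate ''q'' (Suc k) \<rho>)" using I \<rho>(2,3) by (simp add: agree_def del: inv_iter.simps)
    moreover have "fst \<rho> ''q'' = k" using \<rho>(2) k by (simp add: agree_def)
    ultimately show "\<exists>\<rho>. reach s 42 3 invert_step \<tau> \<rho> \<and> fst \<rho> ''q'' = k \<and> ?I (Suc k) (nupdate ''q'' (Suc k) \<rho>)"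
      using \<rho>(1) by blast
  qed
  then obtain \<sigma>2 where r2: "reach s 46 4 (For ''q'' vd invert_step) \<sigma>1 \<sigma>2" and I2: "?I d \<sigma>2"
    by (auto simp: numeral_eq_Suc)
  have "reach s 60 4 invert_com \<sigma> \<sigma>2"
    using reach_Seq[OF r1 r2] by (simp add: invert_com_def)
  then show ?thesis using I2 by blast
qed

text \<open>The weight is passed as an expression in the loop variable \<open>''k''\<close>, so that
  both barriers run the same code.\<close>

definition kernel_com :: "rexp \<Rightarrow> com" where
  "kernel_com e =
     Seq (sum_into ''X'' vd vd vn (RMul (RMul e (RArr ''W'' vi vk)) (RArr ''W'' vj vk)))
    (Seq invert_com
    (Seq (sum_into ''Z'' vd vn vd (RMul (RArr ''N'' vi vk) (RArr ''W'' vk vj)))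
    (Seq (sum_into ''K'' vn vn vd (RMul (RArr ''W'' vk vi) (RArr ''Z'' vk vj)))
    (Seq (sum_into ''SQ'' vn n1 vn (RMul (RArr ''K'' vk vi) (RArr ''K'' vk vi)))
         (sum_into ''TOT'' n1 n1 vn (RArr ''SQ'' vk n0))))))"

abbreviation "kernel_arrays \<equiv> {''N'', ''Y'', ''B'', ''X'', ''Z'', ''K'', ''SQ'', ''TOT''}"

lemma reach_kernel_com:
  assumes inp: "inputs d n W \<sigma>" and s: "d \<le> s" "n \<le> s"
    and e: "\<And>\<tau>. agree loop_vars {''X''} \<sigma> \<tau> \<Longrightarrow> fst \<tau> ''k'' < n \<Longrightarrow> rval e \<tau> = c (fst \<tau> ''k'')"
  shows "\<exists>\<tau>. reach s 130 4 (kernel_com e) \<sigma> \<tau> \<and> agree (insert ''q'' loop_vars) kernel_arrays \<sigma> \<tau> \<and>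
    (\<forall>i<n. \<forall>j<n. snd \<tau> ''K'' i j = kernel d n W c i j) \<and>
    (\<forall>i<n. snd \<tau> ''SQ'' i 0 = kernel_sq d n W c i) \<and> snd \<tau> ''TOT'' 0 0 = kernel_total d n W c"
proof -
  let ?V = "insert ''q'' loop_vars"
  define G where "G = gram n W c"
  let ?p1 = "sum_into ''X'' vd vd vn (RMul (RMul e (RArr ''W'' vi vk)) (RArr ''W'' vj vk))"
  let ?p3 = "sum_into ''Z'' vd vn vd (RMul (RArr ''N'' vi vk) (RArr ''W'' vk vj))"
  let ?p4 = "sum_into ''K'' vn vn vd (RMul (RArr ''W'' vk vi) (RArr ''Z'' vk vj))"
  let ?p5 = "sum_into ''SQ'' vn n1 vn (RMul (RArr ''K'' vk vi) (RArr ''K'' vk vi))"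
  let ?p6 = "sum_into ''TOT'' n1 n1 vn (RArr ''SQ'' vk n0)"
  have "\<exists>\<tau>. reach s 14 3 ?p1 \<sigma> \<tau> \<and> agree loop_vars {''X''} \<sigma> \<tau> \<and>
    (\<forall>a<d. \<forall>b<d. snd \<tau> ''X'' a b = (\<Sum>i<n. c i * W a i * W b i))"
    by (rule reach_sum_into) (use inp s e in \<open>auto simp: agree_def inputs_def\<close>)
  then obtain \<sigma>1 where r1: "reach s 14 3 ?p1 \<sigma> \<sigma>1" and a1: "agree loop_vars {''X''} \<sigma> \<sigma>1"
    and X: "\<And>a b. a < d \<Longrightarrow> b < d \<Longrightarrow> snd \<sigma>1 ''X'' a b = G a b" by (auto simp: G_def gram_def)
  have i1: "inputs d n W \<sigma>1" by (rule inputs_agree[OF inp a1]) simp_all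
  obtain \<sigma>2 where r2: "reach s 60 4 invert_com \<sigma>1 \<sigma>2" and a2: "agree ?V {''N'', ''Y'', ''B''} \<sigma>1 \<sigma>2"
    and N: "\<And>a b. a < d \<Longrightarrow> b < d \<Longrightarrow> snd \<sigma>2 ''N'' a b = inv_iter d G d a b"
    using reach_invert_com[OF i1 s(1) X] by blast
  have i2: "inputs d n W \<sigma>2" by (rule inputs_agree[OF i1 a2]) simp_all
  have "\<exists>\<tau>. reach s 14 3 ?p3 \<sigma>2 \<tau> \<and> agree loop_vars {''Z''} \<sigma>2 \<tau> \<and>
    (\<forall>a<d. \<forall>j<n. snd \<tau> ''Z'' a j = (\<Sum>b<d. inv_iter d G d a b * W b j))"
    by (rule reach_sum_into) (use i2 s N in \<open>auto simp: agree_def inputs_def\<close>)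
  then obtain \<sigma>3 where r3: "reach s 14 3 ?p3 \<sigma>2 \<sigma>3" and a3: "agree loop_vars {''Z''} \<sigma>2 \<sigma>3"
    and Z: "\<And>a j. a < d \<Longrightarrow> j < n \<Longrightarrow> snd \<sigma>3 ''Z'' a j = (\<Sum>b<d. inv_iter d G d a b * W b j)" by auto
  have i3: "inputs d n W \<sigma>3" by (rule inputs_agree[OF i2 a3]) simp_all
  have "\<exists>\<tau>. reach s 14 3 ?p4 \<sigma>3 \<tau> \<and> agree loop_vars {''K''} \<sigma>3 \<tau> \<and>
    (\<forall>i<n. \<forall>j<n. snd \<tau> ''K'' i j = (\<Sum>a<d. W a i * (\<Sum>b<d. inv_iter d G d a b * W b j)))"
    by (rule reach_sum_into) (use i3 s Z in \<open>auto simp: agree_def inputs_def\<close>)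
  then obtain \<sigma>4 where r4: "reach s 14 3 ?p4 \<sigma>3 \<sigma>4" and a4: "agree loop_vars {''K''} \<sigma>3 \<sigma>4"
    and K: "\<And>i j. i < n \<Longrightarrow> j < n \<Longrightarrow> snd \<sigma>4 ''K'' i j = kernel d n W c i j"
    by (auto simp: kernel_def G_def)
  have i4: "inputs d n W \<sigma>4" by (rule inputs_agree[OF i3 a4]) simp_all
  have "\<exists>\<tau>. reach s 14 3 ?p5 \<sigma>4 \<tau> \<and> agree loop_vars {''SQ''} \<sigma>4 \<tau> \<and>
    (\<forall>i<n. \<forall>b<1. snd \<tau> ''SQ'' i b = (\<Sum>j<n. kernel d n W c j i * kernel d n W c j i))"
    by (rule reach_sum_into) (use i4 s K in \<open>auto simp: agree_def inputs_def\<close>)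
  then obtain \<sigma>5 where r5: "reach s 14 3 ?p5 \<sigma>4 \<sigma>5" and a5: "agree loop_vars {''SQ''} \<sigma>4 \<sigma>5"
    and SQ: "\<And>i. i < n \<Longrightarrow> snd \<sigma>5 ''SQ'' i 0 = kernel_sq d n W c i"
    by (auto simp: kernel_sq_def power2_eq_square)
  have i5: "inputs d n W \<sigma>5" by (rule inputs_agree[OF i4 a5]) simp_all
  have "\<exists>\<tau>. reach s 14 3 ?p6 \<sigma>5 \<tau> \<and> agree loop_vars {''TOT''} \<sigma>5 \<tau> \<and>
    (\<forall>a<1. \<forall>b<1. snd \<tau> ''TOT'' a b = (\<Sum>i<n. kernel_sq d n W c i))"
    by (rule reach_sum_into) (use i5 s SQ in \<open>auto simp: agree_def inputs_def\<close>)
  then obtain \<sigma>6 where r6: "reach s 14 3 ?p6 \<sigma>5 \<sigma>6" and a6: "agree loop_vars {''TOT''} \<sigma>5 \<sigma>6"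
    and T: "snd \<sigma>6 ''TOT'' 0 0 = kernel_total d n W c"
    by (auto simp: kernel_total_def)
  have "reach s 130 4 (kernel_com e) \<sigma> \<sigma>6"
    using reach_Seq[OF r1 reach_Seq[OF r2 reach_Seq[OF r3 reach_Seq[OF r4 reach_Seq[OF r5 r6]]]]]
    by (simp add: kernel_com_def)
  moreover have "agree ?V kernel_arrays \<sigma> \<sigma>6"
    using a1 a2 a3 a4 a5 a6 by (simp add: agree_def)
  moreover have "\<forall>i<n. \<forall>j<n. snd \<sigma>6 ''K'' i j = kernel d n W c i j"
    using K a5 a6 by (simp add: agree_def)
  moreover have "\<forall>i<n. snd \<sigma>6 ''SQ'' i 0 = kernel_sq d n W c i"
    using SQ a6 by (simp add: agree_def)
  ultimately show ?thesis using T by blast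
qed

text \<open>The scan keeps the last candidate. The choice does not matter, since
  \<open>barrier_step\<close> holds for every candidate.\<close>

definition pick_com :: com where
  "pick_com = For ''i'' vn (Cond (RLess (RArr ''U'' vi n0) (RArr ''L'' vi n0)) (NAssign ''idx'' vi) Skip)"

lemma reach_pick_com:
  assumes n: "fst \<sigma> ''n'' = n" and s: "n \<le> s" and ex: "\<exists>k<n. snd \<sigma> ''U'' k 0 < snd \<sigma> ''L'' k 0"
  shows "\<exists>\<tau>. reach s 6 1 pick_com \<sigma> \<tau> \<and> agree {''i'', ''idx''} {} \<sigma> \<tau> \<and>
    fst \<tau> ''idx'' < n \<and> snd \<sigma> ''U'' (fst \<tau> ''idx'') 0 < snd \<sigma> ''L'' (fst \<tau> ''idx'') 0"
proof -
  let ?g = "\<lambda>k. snd \<sigma> ''U'' k 0 < snd \<sigma> ''L'' k 0"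
  let ?I = "\<lambda>k \<tau>. agree {''i'', ''idx''} {} \<sigma> \<tau> \<and> ((\<exists>j<k. ?g j) \<longrightarrow> fst \<tau> ''idx'' < n \<and> ?g (fst \<tau> ''idx''))"
  let ?p = "Cond (RLess (RArr ''U'' vi n0) (RArr ''L'' vi n0)) (NAssign ''idx'' vi) Skip"
  have "\<exists>\<rho>. reach s (2 + 4) (Suc 0) (For ''i'' vn ?p) \<sigma> \<rho> \<and> fst \<rho> ''i'' = n \<and> ?I n \<rho>"
  proof (rule reach_For[where I = ?I])
    show "?I 0 (nupdate ''i'' 0 \<sigma>)" by (simp add: agree_def)
    show "n \<le> Suc s" using s by simp
    show "nval vn \<tau> = n" if "?I k \<tau>" for k \<tau> using that n by (simp add: agree_def)
    fix k \<tau> assume k: "k < n" "fst \<tau> ''i'' = k" and I: "?I k \<tau>"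
    let ?b = "RLess (RArr ''U'' vi n0) (RArr ''L'' vi n0)"
    have b: "bval ?b \<tau> \<longleftrightarrow> ?g k" using I k by (simp add: agree_def)
    define \<rho> where "\<rho> = (if ?g k then nupdate ''idx'' k \<tau> else \<tau>)"
    have "reach s 1 0 (if bval ?b \<tau> then NAssign ''idx'' vi else Skip) \<tau> \<rho>"
      using b k reach_NAssign[of s "''idx''" vi \<tau>] reach_Skip by (simp add: \<rho>_def del: bval.simps)
    then have "reach s (Suc 1) 0 ?p \<tau> \<rho>" by (rule reach_Cond)
    moreover have "?I (Suc k) (nupdate ''i'' (Suc k) \<rho>)"
      using I k by (auto simp: \<rho>_def agree_def less_Suc_eq)
    moreover have "fst \<rho> ''i'' = k" using k by (simp add: \<rho>_def)
    ultimately show "\<exists>\<rho>. reach s 2 0 ?p \<tau> \<rho> \<and> fst \<rho> ''i'' = k \<and> ?I (Suc k) (nupdate ''i'' (Suc k) \<rho>)"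
      by (intro exI[of _ \<rho>]) (simp add: numeral_eq_Suc)
  qed
  then show ?thesis using ex by (auto simp: pick_com_def)
qed

text \<open>Both barriers move first because the gains refer to their new positions. The upper gains
  are saved in \<open>''U''\<close> before the second kernel computation overwrites its
  arrays.\<close>

definition step_com :: com where
  "step_com =
     Seq (RAssign ''u'' n0 n0 (RAdd (cell ''u'') (cell ''dl'')))
    (Seq (RAssign ''l'' n0 n0 (RAdd (cell ''l'') (RConst 1)))
    (Seq (kernel_com (RSub (cell ''u'') (RArr ''s'' n0 vk)))
    (Seq (sum_into ''U'' vn n1 n1 (RAdd (RDiv (RArr ''SQ'' vi n0) (RMul (cell ''dl'') (cell ''TOT''))) (RArr ''K'' vi vi)))
    (Seq (kernel_com (RSub (RArr ''s'' n0 vk) (cell ''l'')))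
    (Seq (sum_into ''L'' vn n1 n1 (RSub (RDiv (RArr ''SQ'' vi n0) (cell ''TOT'')) (RArr ''K'' vi vi)))
    (Seq pick_com
      (RAssign ''s'' n0 (NVar ''idx'') (RAdd (RArr ''s'' n0 (NVar ''idx''))
        (RDiv (RConst 1) (RArr ''L'' (NVar ''idx'') n0))))))))))"

abbreviation "step_vars \<equiv> {''i'', ''j'', ''k'', ''q'', ''idx''}"
abbreviation "step_arrays \<equiv> {''N'', ''Y'', ''B'', ''X'', ''Z'', ''K'', ''SQ'', ''TOT'', ''u'', ''l'', ''s'', ''U'', ''L''}"

context full_rank_array
begin

lemma reach_step_com:
  assumes inp: "inputs d n W \<sigma>" and s: "d \<le> s" "n \<le> s"
    and u: "snd \<sigma> ''u'' 0 0 = u" and l: "snd \<sigma> ''l'' 0 0 = l" and dl: "snd \<sigma> ''dl'' 0 0 = \<delta>" and S: "snd \<sigma> ''s'' 0 = S"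
    and ex: "\<exists>k<n. upper_gain \<delta> (\<lambda>i. u + \<delta> - S i) k < lower_gain (\<lambda>i. S i - (l + 1)) k"
  shows "\<exists>\<tau> k. reach s 297 4 step_com \<sigma> \<tau> \<and> agree step_vars step_arrays \<sigma> \<tau> \<and>
    snd \<tau> ''u'' 0 0 = u + \<delta> \<and> snd \<tau> ''l'' 0 0 = l + 1 \<and> k < n \<and>
    upper_gain \<delta> (\<lambda>i. u + \<delta> - S i) k < lower_gain (\<lambda>i. S i - (l + 1)) k \<and>
    snd \<tau> ''s'' 0 = S(k := S k + 1 / lower_gain (\<lambda>i. S i - (l + 1)) k)"
proof -
  let ?cu = "\<lambda>i. u + \<delta> - S i" and ?cl = "\<lambda>i. S i - (l + 1)"
  let ?V = "insert ''q'' loop_vars"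
  let ?p1 = "RAssign ''u'' n0 n0 (RAdd (cell ''u'') (cell ''dl''))"
  let ?p2 = "RAssign ''l'' n0 n0 (RAdd (cell ''l'') (RConst 1))"
  let ?p3 = "kernel_com (RSub (cell ''u'') (RArr ''s'' n0 vk))"
  let ?p4 = "sum_into ''U'' vn n1 n1 (RAdd (RDiv (RArr ''SQ'' vi n0) (RMul (cell ''dl'') (cell ''TOT''))) (RArr ''K'' vi vi))"
  let ?p5 = "kernel_com (RSub (RArr ''s'' n0 vk) (cell ''l''))"
  let ?p6 = "sum_into ''L'' vn n1 n1 (RSub (RDiv (RArr ''SQ'' vi n0) (cell ''TOT'')) (RArr ''K'' vi vi))"
  let ?p8 = "RAssign ''s'' n0 (NVar ''idx'') (RAdd (RArr ''s'' n0 (NVar ''idx'')) (RDiv (RConst 1) (RArr ''L'' (NVar ''idx'') n0)))"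
  define \<sigma>1 where "\<sigma>1 = rupdate ''u'' 0 0 (u + \<delta>) \<sigma>"
  define \<sigma>2 where "\<sigma>2 = rupdate ''l'' 0 0 (l + 1) \<sigma>1"
  have r1: "reach s 1 0 ?p1 \<sigma> \<sigma>1" unfolding \<sigma>1_def by (rule reach_RAssign_eq) (use u dl in simp_all)
  have r2: "reach s 1 0 ?p2 \<sigma>1 \<sigma>2" unfolding \<sigma>2_def by (rule reach_RAssign_eq) (use l in \<open>simp_all add: \<sigma>1_def\<close>)
  have a2: "agree {} {''u'', ''l''} \<sigma> \<sigma>2" by (simp add: agree_def \<sigma>1_def \<sigma>2_def)
  have u2: "snd \<sigma>2 ''u'' 0 0 = u + \<delta>" "snd \<sigma>2 ''l'' 0 0 = l + 1" by (simp_all add: \<sigma>1_def \<sigma>2_def)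
  have i2: "inputs d n W \<sigma>2" by (rule inputs_agree[OF inp a2]) simp_all
  have e3: "rval (RSub (cell ''u'') (RArr ''s'' n0 vk)) \<tau> = ?cu (fst \<tau> ''k'')" if "agree loop_vars {''X''} \<sigma>2 \<tau>" for \<tau>
    using that a2 u2 S by (simp add: agree_def)
  obtain \<sigma>3 where r3: "reach s 130 4 ?p3 \<sigma>2 \<sigma>3" and a3: "agree ?V kernel_arrays \<sigma>2 \<sigma>3"
    and K3: "\<And>i j. i < n \<Longrightarrow> j < n \<Longrightarrow> snd \<sigma>3 ''K'' i j = K ?cu i j"
    and SQ3: "\<And>i. i < n \<Longrightarrow> snd \<sigma>3 ''SQ'' i 0 = Ksq ?cu i" and T3: "snd \<sigma>3 ''TOT'' 0 0 = Ktot ?cu"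
    using reach_kernel_com[OF i2 s e3] by blast
  have i3: "inputs d n W \<sigma>3" by (rule inputs_agree[OF i2 a3]) simp_all
  have "\<exists>\<tau>. reach s 14 3 ?p4 \<sigma>3 \<tau> \<and> agree loop_vars {''U''} \<sigma>3 \<tau> \<and>
    (\<forall>i<n. \<forall>b<1. snd \<tau> ''U'' i b = (\<Sum>c<(1::nat). upper_gain \<delta> ?cu i))"
    by (rule reach_sum_into) (use i3 s K3 SQ3 T3 dl a2 a3 in \<open>auto simp: agree_def inputs_def upper_gain_def\<close>)
  then obtain \<sigma>4 where r4: "reach s 14 3 ?p4 \<sigma>3 \<sigma>4" and a4: "agree loop_vars {''U''} \<sigma>3 \<sigma>4"
    and U: "\<And>i. i < n \<Longrightarrow> snd \<sigma>4 ''U'' i 0 = upper_gain \<delta> ?cu i" by auto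
  have i4: "inputs d n W \<sigma>4" by (rule inputs_agree[OF i3 a4]) simp_all
  have e5: "rval (RSub (RArr ''s'' n0 vk) (cell ''l'')) \<tau> = ?cl (fst \<tau> ''k'')" if "agree loop_vars {''X''} \<sigma>4 \<tau>" for \<tau>
    using that a2 a3 a4 u2 S by (simp add: agree_def)
  obtain \<sigma>5 where r5: "reach s 130 4 ?p5 \<sigma>4 \<sigma>5" and a5: "agree ?V kernel_arrays \<sigma>4 \<sigma>5"
    and K5: "\<And>i j. i < n \<Longrightarrow> j < n \<Longrightarrow> snd \<sigma>5 ''K'' i j = K ?cl i j"
    and SQ5: "\<And>i. i < n \<Longrightarrow> snd \<sigma>5 ''SQ'' i 0 = Ksq ?cl i" and T5: "snd \<sigma>5 ''TOT'' 0 0 = Ktot ?cl"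
    using reach_kernel_com[OF i4 s e5] by blast
  have i5: "inputs d n W \<sigma>5" by (rule inputs_agree[OF i4 a5]) simp_all
  have "\<exists>\<tau>. reach s 14 3 ?p6 \<sigma>5 \<tau> \<and> agree loop_vars {''L''} \<sigma>5 \<tau> \<and>
    (\<forall>i<n. \<forall>b<1. snd \<tau> ''L'' i b = (\<Sum>c<(1::nat). lower_gain ?cl i))"
    by (rule reach_sum_into) (use i5 s K5 SQ5 T5 in \<open>auto simp: agree_def inputs_def lower_gain_def\<close>)
  then obtain \<sigma>6 where r6: "reach s 14 3 ?p6 \<sigma>5 \<sigma>6" and a6: "agree loop_vars {''L''} \<sigma>5 \<sigma>6"
    and L: "\<And>i. i < n \<Longrightarrow> snd \<sigma>6 ''L'' i 0 = lower_gain ?cl i" by auto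
  have i6: "inputs d n W \<sigma>6" by (rule inputs_agree[OF i5 a6]) simp_all
  have U6: "snd \<sigma>6 ''U'' i 0 = upper_gain \<delta> ?cu i" if "i < n" for i
    using U[OF that] a5 a6 by (simp add: agree_def)
  have ex6: "\<exists>k<n. snd \<sigma>6 ''U'' k 0 < snd \<sigma>6 ''L'' k 0" using ex U6 L by auto
  obtain \<sigma>7 where r7: "reach s 6 1 pick_com \<sigma>6 \<sigma>7" and a7: "agree {''i'', ''idx''} {} \<sigma>6 \<sigma>7"
    and idx: "fst \<sigma>7 ''idx'' < n" "snd \<sigma>6 ''U'' (fst \<sigma>7 ''idx'') 0 < snd \<sigma>6 ''L'' (fst \<sigma>7 ''idx'') 0"
    using reach_pick_com[OF _ s(2) ex6] i6 unfolding inputs_def by blast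
  define k where "k = fst \<sigma>7 ''idx''"
  have k: "k < n" "upper_gain \<delta> ?cu k < lower_gain ?cl k" using idx U6 L by (simp_all add: k_def)
  define \<sigma>8 where "\<sigma>8 = rupdate ''s'' 0 k (S k + 1 / lower_gain ?cl k) \<sigma>7"
  have S7: "snd \<sigma>7 ''s'' 0 = S" using S a2 a3 a4 a5 a6 a7 by (simp add: agree_def)
  have "snd \<sigma>7 ''L'' k 0 = lower_gain ?cl k" using L[OF k(1)] a7 by (simp add: agree_def)
  then have r8: "reach s 1 0 ?p8 \<sigma>7 \<sigma>8"
    unfolding \<sigma>8_def by (intro reach_RAssign_eq) (use S7 in \<open>simp_all add: k_def\<close>)
  have "reach s 297 4 step_com \<sigma> \<sigma>8"
    using reach_Seq[OF r1 reach_Seq[OF r2 reach_Seq[OF r3 reach_Seq[OF r4 reach_Seq[OF r5 reach_Seq[OF r6 reach_Seq[OF r7 r8]]]]]]]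
    by (simp add: step_com_def)
  moreover have "agree step_vars step_arrays \<sigma> \<sigma>8"
    using a2 a3 a4 a5 a6 a7 by (simp add: agree_def \<sigma>8_def)
  moreover have "snd \<sigma>8 ''u'' 0 0 = u + \<delta>" "snd \<sigma>8 ''l'' 0 0 = l + 1"
    using u2 a3 a4 a5 a6 a7 by (simp_all add: agree_def \<sigma>8_def)
  moreover have "snd \<sigma>8 ''s'' 0 = S(k := S k + 1 / lower_gain ?cl k)"
    using S7 by (simp add: \<sigma>8_def)
  ultimately show ?thesis using k by blast
qed

end

text \<open>An index cannot be converted to a real, so \<open>''dr''\<close> receives
  \<open>d\<close> as a sum of \<open>d\<close> ones.\<close>

definition init_com :: com where
  "init_com = Seq (For ''i'' vd (RAssign ''Id'' vi vi (RConst 1))) (sum_into ''dr'' n1 n1 vd (RConst 1))"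

lemma reach_init_com:
  assumes d: "fst \<sigma> ''d'' = d" "fst \<sigma> ''n'' = n" "\<forall>a<d. \<forall>i<n. snd \<sigma> ''W'' a i = W a i"
    and Id: "snd \<sigma> ''Id'' = (\<lambda>_ _. 0)" and s: "d \<le> s"
  shows "\<exists>\<tau>. reach s 19 3 init_com \<sigma> \<tau> \<and> agree loop_vars {''Id'', ''dr''} \<sigma> \<tau> \<and>
    inputs d n W \<tau> \<and> snd \<tau> ''dr'' 0 0 = real d"
proof -
  let ?p = "RAssign ''Id'' vi vi (RConst 1)"
  let ?I = "\<lambda>k \<tau>. agree {''i''} {''Id''} \<sigma> \<tau> \<and> (\<forall>a b. snd \<tau> ''Id'' a b = of_bool (a = b \<and> a < k))"
  have "\<exists>\<rho>. reach s (1 + 4) (Suc 0) (For ''i'' vd ?p) \<sigma> \<rho> \<and> fst \<rho> ''i'' = d \<and> ?I d \<rho>"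
  proof (rule reach_For[where I = ?I])
    show "?I 0 (nupdate ''i'' 0 \<sigma>)" using Id by (simp add: agree_def)
    show "d \<le> Suc s" using s by simp
    show "nval vd \<tau> = d" if "?I k \<tau>" for k \<tau> using that d by (simp add: agree_def)
    fix k \<tau> assume k: "k < d" "fst \<tau> ''i'' = k" and I: "?I k \<tau>"
    have "reach s 1 0 ?p \<tau> (rupdate ''Id'' k k 1 \<tau>)" by (rule reach_RAssign_eq) (use k in simp_all)
    then show "\<exists>\<rho>. reach s 1 0 ?p \<tau> \<rho> \<and> fst \<rho> ''i'' = k \<and> ?I (Suc k) (nupdate ''i'' (Suc k) \<rho>)"
      using k I by (intro exI[of _ "rupdate ''Id'' k k 1 \<tau>"]) (auto simp: agree_def)
  qed
  then obtain \<sigma>1 where r1: "reach s 5 1 (For ''i'' vd ?p) \<sigma> \<sigma>1" and I1: "?I d \<sigma>1" by auto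
  have i1: "inputs d n W \<sigma>1" using I1 d by (simp add: inputs_def agree_def)
  have "\<exists>\<tau>. reach s 14 3 (sum_into ''dr'' n1 n1 vd (RConst 1)) \<sigma>1 \<tau> \<and> agree loop_vars {''dr''} \<sigma>1 \<tau> \<and>
    (\<forall>a<1. \<forall>b<1. snd \<tau> ''dr'' a b = (\<Sum>c<d. 1))"
    by (rule reach_sum_into) (use i1 s in \<open>auto simp: agree_def inputs_def\<close>)
  then obtain \<sigma>2 where r2: "reach s 14 3 (sum_into ''dr'' n1 n1 vd (RConst 1)) \<sigma>1 \<sigma>2"
    and a2: "agree loop_vars {''dr''} \<sigma>1 \<sigma>2" and dr: "snd \<sigma>2 ''dr'' 0 0 = real d" by auto
  have "reach s 19 3 init_com \<sigma> \<sigma>2" using reach_Seq[OF r1 r2] by (simp add: init_com_def)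
  moreover have "agree loop_vars {''Id'', ''dr''} \<sigma> \<sigma>2" using I1 a2 by (simp add: agree_def)
  moreover have "inputs d n W \<sigma>2" by (rule inputs_agree[OF i1 a2]) simp_all
  ultimately show ?thesis using dr by blast
qed

abbreviation "few_steps \<equiv> RLess (RMul (cell ''r'') (RMul (cell ''eps'') (cell ''eps''))) (RMul (RConst 64) (cell ''dr''))"

text \<open>Counting stands in for rounding \<open>64 d / \<epsilon>^2\<close> up, capped at
  \<open>n\<close>. The real cell \<open>''r''\<close> mirrors the index \<open>''T''\<close>, since
  the test is a comparison of reals.\<close>

definition count_com :: com where
  "count_com = While (BAnd (NLess (NVar ''T'') vn) few_steps)
     (Seq (NAssign ''T'' (NAdd (NVar ''T'') n1)) (RAssign ''r'' n0 n0 (RAdd (cell ''r'') (RConst 1))))"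

lemma reach_count_com:
  assumes n: "fst \<sigma> ''n'' = n" and T: "fst \<sigma> ''T'' = 0" and r: "snd \<sigma> ''r'' 0 0 = 0" and s: "n \<le> s"
    and eps: "snd \<sigma> ''eps'' 0 0 = \<epsilon>" and dr: "snd \<sigma> ''dr'' 0 0 = real d"
  shows "\<exists>\<tau> T. reach s 4 1 count_com \<sigma> \<tau> \<and> agree {''T''} {''r''} \<sigma> \<tau> \<and> fst \<tau> ''T'' = T \<and> snd \<tau> ''r'' 0 0 = real T \<and>
    T \<le> n \<and> (T < n \<longrightarrow> 64 * real d \<le> real T * \<epsilon>\<^sup>2) \<and> (\<forall>k<T. real k * \<epsilon>\<^sup>2 < 64 * real d)"
proof -
  let ?b = "BAnd (NLess (NVar ''T'') vn) few_steps"
  let ?p = "Seq (NAssign ''T'' (NAdd (NVar ''T'') n1)) (RAssign ''r'' n0 n0 (RAdd (cell ''r'') (RConst 1)))"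
  let ?I = "\<lambda>k \<tau>. agree {''T''} {''r''} \<sigma> \<tau> \<and> fst \<tau> ''T'' = k \<and> snd \<tau> ''r'' 0 0 = real k \<and> k \<le> n \<and>
    (\<forall>k'<k. real k' * \<epsilon>\<^sup>2 < 64 * real d)"
  have b: "bval ?b \<tau> \<longleftrightarrow> k < n \<and> real k * \<epsilon>\<^sup>2 < 64 * real d" if "?I k \<tau>" for k \<tau>
    using that n eps dr by (simp add: agree_def power2_eq_square)
  have "\<exists>\<rho> j. reach s (2 + 2) (Suc 0) (While ?b ?p) \<sigma> \<rho> \<and> ?I j \<rho> \<and> \<not> bval ?b \<rho> \<and> j \<le> n"
  proof (rule reach_While[where I = ?I])
    show "?I 0 \<sigma>" using T r by (simp add: agree_def)
    show "n \<le> Suc s" using s by simp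
    show "k < n" if "?I k \<tau>" "bval ?b \<tau>" for k \<tau> using that b by blast
    fix k \<tau> assume I: "?I k \<tau>" and "bval ?b \<tau>"
    then have k: "k < n" "real k * \<epsilon>\<^sup>2 < 64 * real d" using b by blast+
    let ?\<tau>1 = "nupdate ''T'' (Suc k) \<tau>"
    let ?\<tau>2 = "rupdate ''r'' 0 0 (real (Suc k)) ?\<tau>1"
    have "reach s 1 0 (NAssign ''T'' (NAdd (NVar ''T'') n1)) \<tau> ?\<tau>1"
      using reach_NAssign[of s "''T''" "NAdd (NVar ''T'') n1" \<tau>] I by simp
    moreover have "reach s 1 0 (RAssign ''r'' n0 n0 (RAdd (cell ''r'') (RConst 1))) ?\<tau>1 ?\<tau>2"
      by (rule reach_RAssign_eq) (use I in simp_all)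
    ultimately have "reach s 2 0 ?p \<tau> ?\<tau>2" using reach_Seq[of s 1 0 _ \<tau> ?\<tau>1 1 0] by (simp add: numeral_eq_Suc)
    moreover have "?I (Suc k) ?\<tau>2" using I k by (auto simp: agree_def less_Suc_eq)
    ultimately show "\<exists>\<rho>. reach s 2 0 ?p \<tau> \<rho> \<and> ?I (Suc k) \<rho>" by blast
  qed
  then obtain \<rho> j where \<rho>: "reach s (2 + 2) (Suc 0) (While ?b ?p) \<sigma> \<rho>" "?I j \<rho>" "\<not> bval ?b \<rho>" by blast
  have "j < n \<longrightarrow> 64 * real d \<le> real j * \<epsilon>\<^sup>2" using \<rho>(3) b[OF \<rho>(2)] by (auto simp: not_less)
  then show ?thesis using \<rho>(1,2) unfolding count_com_def
    by (intro exI[of _ \<rho>] exI[of _ j]) (simp del: bval.simps)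
qed

text \<open>The constants are those of \<open>\<eta> = \<epsilon> / 8\<close>: barriers start at
  distance \<open>d / \<eta>\<close> from zero and the upper one moves by
  \<open>1 + 4 * \<eta>\<close>. The final coefficient divides the weights by the lower barrier and
  supplies the factor \<open>\<Delta>\<close>.\<close>

definition barrier_com :: com where
  "barrier_com =
     Seq (RAssign ''u'' n0 n0 (RDiv (RMul (RConst 8) (cell ''dr'')) (cell ''eps'')))
    (Seq (RAssign ''l'' n0 n0 (RSub (RConst 0) (RDiv (RMul (RConst 8) (cell ''dr'')) (cell ''eps''))))
    (Seq (RAssign ''dl'' n0 n0 (RAdd (RConst 1) (RDiv (cell ''eps'') (RConst 2))))
    (Seq (For ''p'' (NVar ''T'') step_com)
         (RAssign ''coef'' n0 n0 (RDiv (cell ''Delta'') (cell ''l''))))))"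

abbreviation "main_arrays \<equiv> insert ''dl'' (insert ''coef'' step_arrays)"
abbreviation "main_vars \<equiv> insert ''p'' step_vars"

context full_rank_array
begin

text \<open>Each round changes one weight, and only by a positive amount, which bounds the support
  by \<open>T\<close>. The barrier claim is restricted to positive \<open>d\<close>, as
  \<open>barrier_step\<close> is; for \<open>d = 0\<close> no round takes place.\<close>

lemma reach_barrier_com:
  assumes inp: "inputs d n W \<sigma>" and s: "d \<le> s" "n \<le> s" and T: "fst \<sigma> ''T'' = T" "T \<le> n"
    and d: "T \<noteq> 0 \<Longrightarrow> 0 < d" and eps: "snd \<sigma> ''eps'' 0 0 = \<epsilon>" "0 < \<epsilon>" "\<epsilon> < 1" and dr: "snd \<sigma> ''dr'' 0 0 = real d"
    and S0: "snd \<sigma> ''s'' 0 = (\<lambda>_. 0)" and Delta: "snd \<sigma> ''Delta'' 0 0 = \<Delta>"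
  shows "\<exists>\<tau> S. reach s 305 5 barrier_com \<sigma> \<tau> \<and> agree main_vars main_arrays \<sigma> \<tau> \<and> snd \<tau> ''s'' 0 = S \<and>
    snd \<tau> ''coef'' 0 0 = \<Delta> / (real T - 8 * real d / \<epsilon>) \<and> (\<forall>i<n. 0 \<le> S i) \<and> card {i. i < n \<and> S i \<noteq> 0} \<le> T \<and>
    (0 < d \<longrightarrow> barrier (\<epsilon> / 8) (8 * real d / \<epsilon> + real T * (1 + \<epsilon> / 2)) (real T - 8 * real d / \<epsilon>) S)"
proof -
  let ?u = "8 * real d / \<epsilon>" and ?\<delta> = "1 + \<epsilon> / 2"
  let ?p1 = "RAssign ''u'' n0 n0 (RDiv (RMul (RConst 8) (cell ''dr'')) (cell ''eps''))"
  let ?p2 = "RAssign ''l'' n0 n0 (RSub (RConst 0) (RDiv (RMul (RConst 8) (cell ''dr'')) (cell ''eps'')))"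
  let ?p3 = "RAssign ''dl'' n0 n0 (RAdd (RConst 1) (RDiv (cell ''eps'') (RConst 2)))"
  let ?p4 = "For ''p'' (NVar ''T'') step_com"
  let ?p5 = "RAssign ''coef'' n0 n0 (RDiv (cell ''Delta'') (cell ''l''))"
  define \<sigma>1 where "\<sigma>1 = rupdate ''u'' 0 0 ?u \<sigma>"
  define \<sigma>2 where "\<sigma>2 = rupdate ''l'' 0 0 (- ?u) \<sigma>1"
  define \<sigma>3 where "\<sigma>3 = rupdate ''dl'' 0 0 ?\<delta> \<sigma>2"
  have r1: "reach s 1 0 ?p1 \<sigma> \<sigma>1" unfolding \<sigma>1_def by (rule reach_RAssign_eq) (use eps dr in simp_all)
  have r2: "reach s 1 0 ?p2 \<sigma>1 \<sigma>2" unfolding \<sigma>2_def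
    by (rule reach_RAssign_eq) (use eps dr in \<open>simp_all add: \<sigma>1_def\<close>)
  have r3: "reach s 1 0 ?p3 \<sigma>2 \<sigma>3" unfolding \<sigma>3_def
    by (rule reach_RAssign_eq) (use eps in \<open>simp_all add: \<sigma>1_def \<sigma>2_def\<close>)
  have a3: "agree {} {''u'', ''l'', ''dl''} \<sigma> \<sigma>3" by (simp add: agree_def \<sigma>1_def \<sigma>2_def \<sigma>3_def)
  have i3: "inputs d n W \<sigma>3" by (rule inputs_agree[OF inp a3]) simp_all
  have v3: "snd \<sigma>3 ''u'' 0 0 = ?u" "snd \<sigma>3 ''l'' 0 0 = - ?u" "snd \<sigma>3 ''dl'' 0 0 = ?\<delta>" "snd \<sigma>3 ''s'' 0 = (\<lambda>_. 0)"
    "fst \<sigma>3 ''T'' = T" "snd \<sigma>3 ''Delta'' 0 0 = \<Delta>"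
    using S0 T Delta by (simp_all add: \<sigma>1_def \<sigma>2_def \<sigma>3_def)
  let ?good = "\<lambda>k S. (\<forall>i<n. 0 \<le> S i) \<and> card {i. i < n \<and> S i \<noteq> 0} \<le> k \<and>
    (0 < d \<longrightarrow> barrier (\<epsilon> / 8) (?u + real k * ?\<delta>) (real k - ?u) S)"
  let ?I = "\<lambda>k \<tau>. agree (insert ''p'' step_vars) step_arrays \<sigma>3 \<tau> \<and> snd \<tau> ''u'' 0 0 = ?u + real k * ?\<delta> \<and>
    snd \<tau> ''l'' 0 0 = real k - ?u \<and> ?good k (snd \<tau> ''s'' 0)"
  have "\<exists>\<rho>. reach s (297 + 4) (Suc 4) ?p4 \<sigma>3 \<rho> \<and> fst \<rho> ''p'' = T \<and> ?I T \<rho>"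
  proof (rule reach_For[where I = ?I])
    show "?I 0 (nupdate ''p'' 0 \<sigma>3)"
      using v3 barrier_init[of "\<epsilon> / 8"] eps by (simp add: agree_def mult.commute)
    show "T \<le> Suc s" using T s by simp
    show "nval (NVar ''T'') \<tau> = T" if "?I k \<tau>" for k \<tau> using that v3 by (simp add: agree_def)
    fix k \<tau> assume k: "k < T" "fst \<tau> ''p'' = k" and I: "?I k \<tau>"
    have d0: "0 < d" using d k by simp
    let ?S = "snd \<tau> ''s'' 0" and ?uk = "?u + real k * ?\<delta>" and ?lk = "real k - ?u"
    have a: "agree (insert ''p'' step_vars) step_arrays \<sigma>3 \<tau>" using I by blast
    have inp': "inputs d n W \<tau>" by (rule inputs_agree[OF i3 a]) simp_all
    have bar: "barrier (\<epsilon> / 8) ?uk ?lk ?S" and u: "snd \<tau> ''u'' 0 0 = ?uk" and l: "snd \<tau> ''l'' 0 0 = ?lk"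
      using I d0 by auto
    have dl: "snd \<tau> ''dl'' 0 0 = ?\<delta>" using a v3 by (simp add: agree_def)
    have e: "0 < \<epsilon> / 8" "\<epsilon> / 8 \<le> 1 / 8" "?\<delta> = 1 + 4 * (\<epsilon> / 8)" using eps by auto
    obtain \<rho> j where \<rho>: "reach s 297 4 step_com \<tau> \<rho>" "agree step_vars step_arrays \<tau> \<rho>"
      "snd \<rho> ''u'' 0 0 = ?uk + ?\<delta>" "snd \<rho> ''l'' 0 0 = ?lk + 1" and j: "j < n"
      and gain: "upper_gain ?\<delta> (\<lambda>i. ?uk + ?\<delta> - ?S i) j < lower_gain (\<lambda>i. ?S i - (?lk + 1)) j"
      and S': "snd \<rho> ''s'' 0 = ?S(j := ?S j + 1 / lower_gain (\<lambda>i. ?S i - (?lk + 1)) j)"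
      using reach_step_com[OF inp' s u l dl refl barrier_candidate[OF bar d0 e]] by blast
    note step = barrier_step[OF bar d0 e j gain S']
    have "?good (Suc k) (snd \<rho> ''s'' 0)"
    proof (intro conjI impI)
      show "\<forall>i<n. 0 \<le> snd \<rho> ''s'' 0 i" using I step(2) unfolding S' by (auto simp: add_nonneg_nonneg)
      have "{i. i < n \<and> snd \<rho> ''s'' 0 i \<noteq> 0} \<subseteq> insert j {i. i < n \<and> ?S i \<noteq> 0}" unfolding S' by auto
      then have "card {i. i < n \<and> snd \<rho> ''s'' 0 i \<noteq> 0} \<le> card (insert j {i. i < n \<and> ?S i \<noteq> 0})"
        by (intro card_mono) auto
      also have "\<dots> \<le> Suc k" using I by (intro card_insert_le_m1) auto
      finally show "card {i. i < n \<and> snd \<rho> ''s'' 0 i \<noteq> 0} \<le> Suc k" .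
      show "barrier (\<epsilon> / 8) (?u + real (Suc k) * ?\<delta>) (real (Suc k) - ?u) (snd \<rho> ''s'' 0)"
      proof -
        have eq: "?uk + ?\<delta> = ?u + real (Suc k) * ?\<delta>" "?lk + 1 = real (Suc k) - ?u"
          by (simp_all add: distrib_right)
        show ?thesis using step(1) unfolding eq .
      qed
    qed
    moreover have "fst \<rho> ''p'' = k" using \<rho>(2) k by (simp add: agree_def)
    moreover have "agree (insert ''p'' step_vars) step_arrays \<sigma>3 (nupdate ''p'' (Suc k) \<rho>)"
      using a \<rho>(2) by (simp add: agree_def)
    ultimately show "\<exists>\<rho>. reach s 297 4 step_com \<tau> \<rho> \<and> fst \<rho> ''p'' = k \<and> ?I (Suc k) (nupdate ''p'' (Suc k) \<rho>)"
      using \<rho>(1,3,4) by (intro exI[of _ \<rho>]) (simp add: distrib_right)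
  qed
  then obtain \<sigma>4 where r4: "reach s 301 5 ?p4 \<sigma>3 \<sigma>4" and I4: "?I T \<sigma>4" by (auto simp: numeral_eq_Suc)
  define \<sigma>5 where "\<sigma>5 = rupdate ''coef'' 0 0 (\<Delta> / (real T - ?u)) \<sigma>4"
  have r5: "reach s 1 0 ?p5 \<sigma>4 \<sigma>5" unfolding \<sigma>5_def
    by (rule reach_RAssign_eq) (use I4 v3 in \<open>simp_all add: agree_def\<close>)
  have "reach s 305 5 barrier_com \<sigma> \<sigma>5"
    using reach_Seq[OF r1 reach_Seq[OF r2 reach_Seq[OF r3 reach_Seq[OF r4 r5]]]] by (simp add: barrier_com_def)
  moreover have "agree main_vars main_arrays \<sigma> \<sigma>5"
    using a3 I4 by (simp add: agree_def \<sigma>5_def)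
  moreover have "snd \<sigma>5 ''coef'' 0 0 = \<Delta> / (real T - ?u)" "?good T (snd \<sigma>5 ''s'' 0)"
    using I4 by (simp_all add: \<sigma>5_def)
  ultimately show ?thesis by blast
qed

text \<open>After enough rounds the starting offsets are small against \<open>T\<close>, and the
  ratio of the barriers is at most \<open>(1 + \<epsilon>)^2\<close>. Dividing by the lower barrier
  puts this whole error on the upper side.\<close>

lemma barrier_l1:
  assumes minors: "\<And>f. (\<And>b. b < d \<Longrightarrow> f b < n) \<Longrightarrow> det (select d W f) \<noteq> 0 \<Longrightarrow>
      1 \<le> \<bar>det (select d W f)\<bar> \<and> \<bar>det (select d W f)\<bar> \<le> \<Delta>"
    and \<Delta>: "1 \<le> \<Delta>" and S: "\<And>i. i < n \<Longrightarrow> 0 \<le> S i" and d: "0 < d"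
    and eps: "0 < \<epsilon>" "\<epsilon> < 1" and T: "64 * real d \<le> real T * \<epsilon>\<^sup>2"
    and bar: "barrier \<eta> (8 * real d / \<epsilon> + real T * (1 + \<epsilon> / 2)) (real T - 8 * real d / \<epsilon>) S" (is "barrier _ ?u ?l S")
  shows "0 < ?l" "(\<Sum>i<n. \<bar>form i x\<bar>) \<le> (\<Sum>i<n. \<Delta> / ?l * S i * \<bar>form i x\<bar>)"
    "(\<Sum>i<n. \<Delta> / ?l * S i * \<bar>form i x\<bar>) \<le> \<Delta>\<^sup>2 * (1 + \<epsilon>)\<^sup>2 * (\<Sum>i<n. \<bar>form i x\<bar>)"
proof -
  \<comment> \<open>Origin of 64: the starting offset \<open>8 d / \<epsilon>\<close> becomes at
    most \<open>T * \<epsilon> / 8\<close>.\<close>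
  have "8 * real d / \<epsilon> \<le> real T * (\<epsilon> / 8)" using T eps by (simp add: field_simps power2_eq_square)
  then have l: "real T * (1 - \<epsilon> / 8) \<le> ?l" and u: "?u \<le> real T * (1 + 5 * \<epsilon> / 8)" by (simp_all add: algebra_simps)
  have "T \<noteq> 0" using T d by (intro notI) simp
  then have "0 < real T * (1 - \<epsilon> / 8)" using eps by simp
  then show l0: "0 < ?l" using l by linarith
  \<comment> \<open>The 5/8 combines the offset \<open>\<epsilon> / 8\<close> with the drift
    \<open>\<epsilon> / 2\<close> of the upper barrier.\<close>
  have "1 + 5 * \<epsilon> / 8 \<le> (1 - \<epsilon> / 8) * (1 + \<epsilon>)\<^sup>2"
  proof -
    have "\<epsilon> * \<epsilon> * \<epsilon> \<le> \<epsilon> * \<epsilon>" "0 \<le> \<epsilon> * \<epsilon>" using eps by (simp_all add: mult_left_le)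
    moreover have "(1 - \<epsilon> / 8) * (1 + \<epsilon>)\<^sup>2 = 1 + 15 / 8 * \<epsilon> + 3 / 4 * (\<epsilon> * \<epsilon>) - 1 / 8 * (\<epsilon> * \<epsilon> * \<epsilon>)"
      by (simp add: power2_eq_square algebra_simps)
    ultimately show ?thesis using eps by linarith
  qed
  then have "real T * (1 + 5 * \<epsilon> / 8) \<le> real T * ((1 - \<epsilon> / 8) * (1 + \<epsilon>)\<^sup>2)" by (intro mult_left_mono) auto
  also have "\<dots> \<le> ?l * (1 + \<epsilon>)\<^sup>2" using mult_right_mono[OF l, of "(1 + \<epsilon>)\<^sup>2"] by simp
  finally have ul: "?u \<le> (1 + \<epsilon>)\<^sup>2 * ?l" using u by (simp add: mult.commute)
  have low: "(\<Sum>i<n. (form i z)\<^sup>2) \<le> (\<Sum>i<n. S i / ?l * (form i z)\<^sup>2)" for z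
    using barrier_bounds(1)[OF bar, of z] l0 by (simp add: sum_divide_distrib[symmetric] field_simps)
  have up: "(\<Sum>i<n. S i / ?l * (form i z)\<^sup>2) \<le> (1 + \<epsilon>)\<^sup>2 * (\<Sum>i<n. (form i z)\<^sup>2)" for z
  proof -
    have "(\<Sum>i<n. S i * (form i z)\<^sup>2) \<le> ?u * (\<Sum>i<n. (form i z)\<^sup>2)" using bar by (rule barrier_bounds(2))
    also have "\<dots> \<le> (1 + \<epsilon>)\<^sup>2 * ?l * (\<Sum>i<n. (form i z)\<^sup>2)" using ul by (intro mult_right_mono sum_nonneg) auto
    finally have "(\<Sum>i<n. S i * (form i z)\<^sup>2) / ?l \<le> (1 + \<epsilon>)\<^sup>2 * (\<Sum>i<n. (form i z)\<^sup>2)"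
      using l0 by (simp only: pos_divide_le_eq mult_ac)
    then show ?thesis by (simp add: sum_divide_distrib)
  qed
  have Sl: "0 \<le> S i / ?l" if "i < n" for i using S[OF that] l0 by simp
  have "0 < \<Delta>" using \<Delta> by simp
  \<comment> \<open>Here the weights are \<open>S i / ?l\<close> and \<open>\<gamma>\<close> is
    \<open>(1 + \<epsilon>)^2\<close>.\<close>
  from l1_sparsification[OF minors this Sl low up]
  show "(\<Sum>i<n. \<bar>form i x\<bar>) \<le> (\<Sum>i<n. \<Delta> / ?l * S i * \<bar>form i x\<bar>)"
    "(\<Sum>i<n. \<Delta> / ?l * S i * \<bar>form i x\<bar>) \<le> \<Delta>\<^sup>2 * (1 + \<epsilon>)\<^sup>2 * (\<Sum>i<n. \<bar>form i x\<bar>)"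
    by simp_all
qed

end

definition trivial_com :: com where
  "trivial_com = Seq (sum_into ''s'' n1 vn n1 (RConst 1)) (RAssign ''coef'' n0 n0 (RConst 1))"

lemma reach_trivial_com:
  assumes n: "fst \<sigma> ''n'' = n" "n \<le> s"
  shows "\<exists>\<tau>. reach s 15 3 trivial_com \<sigma> \<tau> \<and> agree main_vars main_arrays \<sigma> \<tau> \<and>
    (\<forall>i<n. snd \<tau> ''s'' 0 i = 1) \<and> snd \<tau> ''coef'' 0 0 = 1"
proof -
  have "\<exists>\<tau>. reach s 14 3 (sum_into ''s'' n1 vn n1 (RConst 1)) \<sigma> \<tau> \<and> agree loop_vars {''s''} \<sigma> \<tau> \<and>
    (\<forall>a<1. \<forall>i<n. snd \<tau> ''s'' a i = (\<Sum>c<(1::nat). 1))"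
    by (rule reach_sum_into) (use n in \<open>auto simp: agree_def\<close>)
  then obtain \<sigma>1 where r1: "reach s 14 3 (sum_into ''s'' n1 vn n1 (RConst 1)) \<sigma> \<sigma>1"
    and a1: "agree loop_vars {''s''} \<sigma> \<sigma>1" and S: "\<forall>i<n. snd \<sigma>1 ''s'' 0 i = 1" by auto
  have r2: "reach s 1 0 (RAssign ''coef'' n0 n0 (RConst 1)) \<sigma>1 (rupdate ''coef'' 0 0 1 \<sigma>1)"
    by (rule reach_RAssign_eq) simp_all
  show ?thesis using reach_Seq[OF r1 r2] a1 S
    by (intro exI[of _ "rupdate ''coef'' 0 0 1 \<sigma>1"]) (simp add: trivial_com_def agree_def)
qed

definition output_com :: com where
  "output_com = For ''i'' vn (Cond (RLess (RConst 0) (RArr ''s'' n0 vi))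
     (Seq (For ''j'' vd (RAssign ''V'' vj (NVar ''m'') (RMul (RMul (cell ''coef'') (RArr ''s'' n0 vi)) (RArr ''W'' vj vi))))
        (NAssign ''m'' (NAdd (NVar ''m'') n1))) Skip)"

lemma reach_output_com:
  assumes inp: "inputs d n W \<sigma>" and s: "d \<le> s" "n \<le> s" and m: "fst \<sigma> ''m'' = 0"
    and S: "snd \<sigma> ''s'' 0 = S" and coef: "snd \<sigma> ''coef'' 0 0 = \<kappa>" and xs: "xs = filter (\<lambda>i. 0 < S i) [0..<n]"
  shows "\<exists>\<tau>. reach s 11 2 output_com \<sigma> \<tau> \<and> fst \<tau> ''m'' = length xs \<and>
    (\<forall>a<d. \<forall>j<length xs. snd \<tau> ''V'' a j = \<kappa> * S (xs ! j) * W a (xs ! j))"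
proof -
  define L where "L k = filter (\<lambda>i. 0 < S i) [0..<k]" for k
  let ?ok = "\<lambda>\<tau>. agree {''i'', ''j'', ''m''} {''V''} \<sigma> \<tau>"
  let ?I = "\<lambda>k \<tau>. ?ok \<tau> \<and> fst \<tau> ''m'' = length (L k) \<and>
    (\<forall>a<d. \<forall>j<length (L k). snd \<tau> ''V'' a j = \<kappa> * S (L k ! j) * W a (L k ! j))"
  let ?b = "RLess (RConst 0) (RArr ''s'' n0 vi)"
  let ?w = "RAssign ''V'' vj (NVar ''m'') (RMul (RMul (cell ''coef'') (RArr ''s'' n0 vi)) (RArr ''W'' vj vi))"
  let ?q = "Seq (For ''j'' vd ?w) (NAssign ''m'' (NAdd (NVar ''m'') n1))"
  have "\<exists>\<rho>. reach s (7 + 4) (Suc 1) (For ''i'' vn (Cond ?b ?q Skip)) \<sigma> \<rho> \<and> fst \<rho> ''i'' = n \<and> ?I n \<rho>"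
  proof (rule reach_For[where I = ?I])
    show "?I 0 (nupdate ''i'' 0 \<sigma>)" using m by (simp add: agree_def L_def)
    show "n \<le> Suc s" using s by simp
    show "nval vn \<tau> = n" if "?I k \<tau>" for k \<tau> using that inp by (simp add: agree_def inputs_def)
    fix k \<tau> assume k: "k < n" "fst \<tau> ''i'' = k" and I: "?I k \<tau>"
    have b: "bval ?b \<tau> \<longleftrightarrow> 0 < S k" using I k S by (simp add: agree_def)
    show "\<exists>\<rho>. reach s 7 1 (Cond ?b ?q Skip) \<tau> \<rho> \<and> fst \<rho> ''i'' = k \<and> ?I (Suc k) (nupdate ''i'' (Suc k) \<rho>)"
    proof (cases "0 < S k")
      case False
      have "reach s 1 0 (if bval ?b \<tau> then ?q else Skip) \<tau> \<tau>" using b False reach_Skip by simp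
      then have "reach s 7 1 (Cond ?b ?q Skip) \<tau> \<tau>" by (rule reach_mono[OF reach_Cond]) simp_all
      moreover have "L (Suc k) = L k" using False by (simp add: L_def)
      ultimately show ?thesis using I k by (intro exI[of _ \<tau>]) (simp add: agree_def)
    next
      case True
      have L: "L (Suc k) = L k @ [k]" using True by (simp add: L_def)
      let ?m = "length (L k)"
      \<comment> \<open>Earlier output columns are compared with their values in
        \<open>\<tau>\<close>, so the inner loop changes only column \<open>?m\<close>.\<close>
      let ?J = "\<lambda>a \<rho>. ?ok \<rho> \<and> fst \<rho> ''i'' = k \<and> fst \<rho> ''m'' = ?m \<and>
        (\<forall>a<d. \<forall>j<?m. snd \<rho> ''V'' a j = snd \<tau> ''V'' a j) \<and> (\<forall>a'<a. snd \<rho> ''V'' a' ?m = \<kappa> * S k * W a' k)"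
      have "\<exists>\<rho>. reach s (1 + 4) (Suc 0) (For ''j'' vd ?w) \<tau> \<rho> \<and> fst \<rho> ''j'' = d \<and> ?J d \<rho>"
      proof (rule reach_For[where I = ?J])
        show "?J 0 (nupdate ''j'' 0 \<tau>)" using I k by (simp add: agree_def)
        show "d \<le> Suc s" using s by simp
        show "nval vd \<rho> = d" if "?J a \<rho>" for a \<rho> using that inp by (simp add: agree_def inputs_def)
        fix a \<rho> assume a: "a < d" "fst \<rho> ''j'' = a" and J: "?J a \<rho>"
        have "reach s 1 0 ?w \<rho> (rupdate ''V'' a ?m (\<kappa> * S k * W a k) \<rho>)"
          by (rule reach_RAssign_eq) (use a J k inp S coef in \<open>simp_all add: agree_def inputs_def\<close>)
        moreover have "?J (Suc a) (nupdate ''j'' (Suc a) (rupdate ''V'' a ?m (\<kappa> * S k * W a k) \<rho>))"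
          using J by (auto simp: agree_def less_Suc_eq)
        ultimately show "\<exists>\<rho>'. reach s 1 0 ?w \<rho> \<rho>' \<and> fst \<rho>' ''j'' = a \<and> ?J (Suc a) (nupdate ''j'' (Suc a) \<rho>')"
          using a by (intro exI[of _ "rupdate ''V'' a ?m (\<kappa> * S k * W a k) \<rho>"]) simp
      qed
      then obtain \<rho> where r: "reach s 5 1 (For ''j'' vd ?w) \<tau> \<rho>" and J: "?J d \<rho>" by auto
      let ?\<rho> = "nupdate ''m'' (Suc ?m) \<rho>"
      have "reach s 1 0 (NAssign ''m'' (NAdd (NVar ''m'') n1)) \<rho> ?\<rho>"
        using reach_NAssign[of s "''m''" "NAdd (NVar ''m'') n1" \<rho>] J by simp
      from reach_Seq[OF r this] have "reach s 6 1 (if bval ?b \<tau> then ?q else Skip) \<tau> ?\<rho>" using b True by simp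
      then have "reach s 7 1 (Cond ?b ?q Skip) \<tau> ?\<rho>" by (rule reach_mono[OF reach_Cond]) simp_all
      moreover have "?I (Suc k) (nupdate ''i'' (Suc k) ?\<rho>)"
      proof -
        have "?ok (nupdate ''i'' (Suc k) ?\<rho>)" using J by (simp add: agree_nupdate)
        moreover have "snd \<rho> ''V'' a j = \<kappa> * S (L (Suc k) ! j) * W a (L (Suc k) ! j)"
          if "a < d" "j < length (L (Suc k))" for a j
          using that I J unfolding L by (cases "j < ?m") (auto simp: nth_append less_Suc_eq)
        ultimately show ?thesis by (simp add: L)
      qed
      moreover have "fst ?\<rho> ''i'' = k" using J by simp
      ultimately show ?thesis by blast
    qed
  qed
  then show ?thesis unfolding output_com_def xs L_def by (auto simp: numeral_eq_Suc)
qed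

definition sparsify_com :: com where
  "sparsify_com = Seq init_com (Seq count_com (Seq (Cond few_steps trivial_com barrier_com) output_com))"

lemma reach_sparsify_com:
  assumes W: "W \<in> carrier_mat d n" and mod: "delta_modular \<Delta> W" and eps: "0 < \<epsilon>" "\<epsilon> < 1"
  defines "A \<equiv> \<lambda>a i. W $$ (a, i)"
  shows "\<exists>\<tau> S \<kappa> xs. reach (d + n) 340 5 sparsify_com (input_state W \<Delta> \<epsilon>) \<tau> \<and>
    xs = filter (\<lambda>i. 0 < S i) [0..<n] \<and> fst \<tau> ''m'' = length xs \<and>
    (\<forall>a<d. \<forall>j<length xs. snd \<tau> ''V'' a j = \<kappa> * S (xs ! j) * A a (xs ! j)) \<and>
    (\<forall>i<n. 0 \<le> S i) \<and> (xs \<noteq> [] \<longrightarrow> 0 < \<kappa>) \<and> real (length xs) \<le> 65 * (real d / \<epsilon>\<^sup>2) \<and>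
    (\<forall>x. (1 - \<epsilon>)\<^sup>2 * (\<Sum>i<n. \<bar>column_form d A i x\<bar>) \<le> (\<Sum>i<n. \<kappa> * S i * \<bar>column_form d A i x\<bar>) \<and>
       (\<Sum>i<n. \<kappa> * S i * \<bar>column_form d A i x\<bar>) \<le> \<Delta>\<^sup>2 * (1 + \<epsilon>)\<^sup>2 * (\<Sum>i<n. \<bar>column_form d A i x\<bar>))"
proof -
  interpret full_rank_array d n A unfolding A_def using W mod by (rule delta_modular_full)
  have minors: "1 \<le> \<bar>det (select d A f)\<bar> \<and> \<bar>det (select d A f)\<bar> \<le> \<Delta>"
    if "\<And>b. b < d \<Longrightarrow> f b < n" "det (select d A f) \<noteq> 0" for f
    using delta_modular_select[OF W mod, of f] that unfolding A_def by blast
  \<comment> \<open>A nonsingular choice of columns exists, so \<open>1\<close> and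
    \<open>\<Delta>\<close> enclose some absolute minor.\<close>
  have \<Delta>: "1 \<le> \<Delta>" using nonsingular_select minors by (meson order_trans)
  let ?s = "d + n" and ?\<sigma> = "input_state W \<Delta> \<epsilon>"
  have s: "d \<le> ?s" "n \<le> ?s" by simp_all
  have dims: "dim_row W = d" "dim_col W = n" using W by auto
  have \<sigma>: "fst ?\<sigma> ''d'' = d" "fst ?\<sigma> ''n'' = n" "\<forall>a<d. \<forall>i<n. snd ?\<sigma> ''W'' a i = A a i" "snd ?\<sigma> ''Id'' = (\<lambda>_ _. 0)"
    "fst ?\<sigma> ''T'' = 0" "fst ?\<sigma> ''m'' = 0" "snd ?\<sigma> ''r'' = (\<lambda>_ _. 0)" "snd ?\<sigma> ''s'' = (\<lambda>_ _. 0)"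
    "snd ?\<sigma> ''eps'' 0 0 = \<epsilon>" "snd ?\<sigma> ''Delta'' 0 0 = \<Delta>"
    by (simp_all add: input_state_def dims A_def)
  obtain \<sigma>1 where r1: "reach ?s 19 3 init_com ?\<sigma> \<sigma>1" and a1: "agree loop_vars {''Id'', ''dr''} ?\<sigma> \<sigma>1"
    and i1: "inputs d n A \<sigma>1" and dr1: "snd \<sigma>1 ''dr'' 0 0 = real d"
    using reach_init_com[OF \<sigma>(1-4) s(1)] by blast
  have "fst \<sigma>1 ''n'' = n" "fst \<sigma>1 ''T'' = 0" "snd \<sigma>1 ''r'' 0 0 = 0" "snd \<sigma>1 ''eps'' 0 0 = \<epsilon>"
    using a1 \<sigma> by (simp_all add: agree_def)
  then obtain \<sigma>2 T where r2: "reach ?s 4 1 count_com \<sigma>1 \<sigma>2" and a2: "agree {''T''} {''r''} \<sigma>1 \<sigma>2"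
    and T2: "fst \<sigma>2 ''T'' = T" "snd \<sigma>2 ''r'' 0 0 = real T" and T: "T \<le> n" "T < n \<longrightarrow> 64 * real d \<le> real T * \<epsilon>\<^sup>2"
    and T': "\<forall>k<T. real k * \<epsilon>\<^sup>2 < 64 * real d"
    using reach_count_com[OF _ _ _ s(2) _ dr1] by blast
  have i2: "inputs d n A \<sigma>2" by (rule inputs_agree[OF i1 a2]) simp_all
  have v2: "fst \<sigma>2 ''m'' = 0" "snd \<sigma>2 ''s'' 0 = (\<lambda>_. 0)" "snd \<sigma>2 ''eps'' 0 0 = \<epsilon>" "snd \<sigma>2 ''Delta'' 0 0 = \<Delta>"
    "snd \<sigma>2 ''dr'' 0 0 = real d"
    using a1 a2 \<sigma> dr1 by (simp_all add: agree_def)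
  have few: "bval few_steps \<sigma>2 \<longleftrightarrow> real T * \<epsilon>\<^sup>2 < 64 * real d"
    using T2 v2 by (simp add: power2_eq_square)
  have d0: "0 < d" if "T \<noteq> 0" using T' that by auto
  let ?p = "if bval few_steps \<sigma>2 then trivial_com else barrier_com"
  have "\<exists>\<tau> S \<kappa>. reach ?s 305 5 ?p \<sigma>2 \<tau> \<and> agree main_vars main_arrays \<sigma>2 \<tau> \<and> snd \<tau> ''s'' 0 = S \<and>
    snd \<tau> ''coef'' 0 0 = \<kappa> \<and> (\<forall>i<n. 0 \<le> S i) \<and> ((\<exists>i<n. 0 < S i) \<longrightarrow> 0 < \<kappa>) \<and>
    real (card {i. i < n \<and> 0 < S i}) \<le> 65 * (real d / \<epsilon>\<^sup>2) \<and>
    (\<forall>x. (1 - \<epsilon>)\<^sup>2 * (\<Sum>i<n. \<bar>form i x\<bar>) \<le> (\<Sum>i<n. \<kappa> * S i * \<bar>form i x\<bar>) \<and>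
       (\<Sum>i<n. \<kappa> * S i * \<bar>form i x\<bar>) \<le> \<Delta>\<^sup>2 * (1 + \<epsilon>)\<^sup>2 * (\<Sum>i<n. \<bar>form i x\<bar>))"
  proof (cases "real T * \<epsilon>\<^sup>2 < 64 * real d")
    case True
    \<comment> \<open>Counting reached the cap \<open>n\<close> although more rounds were called
      for. Then \<open>n\<close> itself is below \<open>64 d / \<epsilon>^2\<close>, and keeping all
      columns respects the size bound.\<close>
    then have "T = n" using T by auto
    obtain \<tau> where \<tau>: "reach ?s 15 3 trivial_com \<sigma>2 \<tau>" "agree main_vars main_arrays \<sigma>2 \<tau>"
      "\<forall>i<n. snd \<tau> ''s'' 0 i = 1" "snd \<tau> ''coef'' 0 0 = 1"
      using reach_trivial_com[of \<sigma>2 n ?s] i2 by (auto simp: inputs_def)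
    have "reach ?s 305 5 ?p \<sigma>2 \<tau>" using True few reach_mono[OF \<tau>(1), of 305 5] by simp
    moreover have "real (card {i. i < n \<and> 0 < snd \<tau> ''s'' 0 i}) \<le> 65 * (real d / \<epsilon>\<^sup>2)"
    proof -
      have "{i. i < n \<and> 0 < snd \<tau> ''s'' 0 i} = {..<n}" using \<tau>(3) by auto
      then show ?thesis using True eps \<open>T = n\<close> by (simp add: field_simps)
    qed
    moreover have "(1 - \<epsilon>)\<^sup>2 * (\<Sum>i<n. \<bar>form i x\<bar>) \<le> (\<Sum>i<n. 1 * snd \<tau> ''s'' 0 i * \<bar>form i x\<bar>)"
      "(\<Sum>i<n. 1 * snd \<tau> ''s'' 0 i * \<bar>form i x\<bar>) \<le> \<Delta>\<^sup>2 * (1 + \<epsilon>)\<^sup>2 * (\<Sum>i<n. \<bar>form i x\<bar>)" for x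
    proof -
      have eq: "(\<Sum>i<n. 1 * snd \<tau> ''s'' 0 i * \<bar>form i x\<bar>) = (\<Sum>i<n. \<bar>form i x\<bar>)" using \<tau>(3) by simp
      have "0 \<le> (\<Sum>i<n. \<bar>form i x\<bar>)" by (simp add: sum_nonneg)
      moreover have "(1 - \<epsilon>)\<^sup>2 \<le> 1" using eps by (simp add: power_le_one)
      moreover have "1 \<le> \<Delta>\<^sup>2 * (1 + \<epsilon>)\<^sup>2" using eps \<Delta> mult_mono[of 1 "\<Delta>\<^sup>2" 1 "(1 + \<epsilon>)\<^sup>2"] by simp
      ultimately show "(1 - \<epsilon>)\<^sup>2 * (\<Sum>i<n. \<bar>form i x\<bar>) \<le> (\<Sum>i<n. 1 * snd \<tau> ''s'' 0 i * \<bar>form i x\<bar>)"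
        "(\<Sum>i<n. 1 * snd \<tau> ''s'' 0 i * \<bar>form i x\<bar>) \<le> \<Delta>\<^sup>2 * (1 + \<epsilon>)\<^sup>2 * (\<Sum>i<n. \<bar>form i x\<bar>)"
        unfolding eq using mult_right_mono[of _ 1 "\<Sum>i<n. \<bar>form i x\<bar>"] mult_right_mono[of 1 _ "\<Sum>i<n. \<bar>form i x\<bar>"] by simp_all
    qed
    ultimately show ?thesis using \<tau> by (intro exI[of _ \<tau>] exI[of _ "snd \<tau> ''s'' 0"] exI[of _ 1]) simp
  next
    case False
    let ?l = "real T - 8 * real d / \<epsilon>"
    obtain \<tau> S where \<tau>: "reach ?s 305 5 barrier_com \<sigma>2 \<tau>" "agree main_vars main_arrays \<sigma>2 \<tau>" "snd \<tau> ''s'' 0 = S"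
      "snd \<tau> ''coef'' 0 0 = \<Delta> / ?l" and S: "\<forall>i<n. 0 \<le> S i" "card {i. i < n \<and> S i \<noteq> 0} \<le> T"
      and bar: "0 < d \<longrightarrow> barrier (\<epsilon> / 8) (8 * real d / \<epsilon> + real T * (1 + \<epsilon> / 2)) ?l S"
      using reach_barrier_com[OF i2 s T2(1) T(1) d0 v2(3) eps v2(5,2,4)] by blast
    have "reach ?s 305 5 ?p \<sigma>2 \<tau>" using False few \<tau>(1) by simp
    moreover have "real (card {i. i < n \<and> 0 < S i}) \<le> 65 * (real d / \<epsilon>\<^sup>2)"
    proof -
      have "{i. i < n \<and> 0 < S i} \<subseteq> {i. i < n \<and> S i \<noteq> 0}" by auto
      then have "card {i. i < n \<and> 0 < S i} \<le> card {i. i < n \<and> S i \<noteq> 0}" by (intro card_mono) auto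
      then have "real (card {i. i < n \<and> 0 < S i}) \<le> real T" using S by simp
      also have "real T \<le> 65 * (real d / \<epsilon>\<^sup>2)"
      proof (cases T)
        \<comment> \<open>Origin of 65: the previous count still satisfied
          \<open>k * \<epsilon>^2 < 64 d\<close>, and one more round adds
          \<open>\<epsilon>^2 \<le> 1 \<le> d\<close>.\<close>
        case (Suc k)
        have "0 < d" using d0 Suc by simp
        then have "1 \<le> real d" by simp
        moreover have "\<epsilon>\<^sup>2 \<le> 1" using eps by (simp add: power_le_one)
        moreover have "real k * \<epsilon>\<^sup>2 < 64 * real d" using T' Suc by simp
        ultimately have "real T * \<epsilon>\<^sup>2 \<le> 65 * real d" by (simp add: Suc distrib_right)
        then show ?thesis using eps by (simp add: field_simps)
      qed simp
      finally show ?thesis .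
    qed
    \<comment> \<open>For \<open>d = 0\<close> the coefficient is a division by zero and equals
      zero, but then no weight is positive.\<close>
    moreover have "(\<exists>i<n. 0 < S i) \<longrightarrow> 0 < \<Delta> / ?l"
    proof
      assume "\<exists>i<n. 0 < S i"
      then have "card {i. i < n \<and> S i \<noteq> 0} \<noteq> 0" by auto
      then have d: "0 < d" using S d0 by linarith
      have "0 < ?l" using barrier_l1(1)[OF minors \<Delta> _ d eps _ mp[OF bar d]] S False by simp
      then show "0 < \<Delta> / ?l" using \<Delta> by simp
    qed
    moreover have "(1 - \<epsilon>)\<^sup>2 * (\<Sum>i<n. \<bar>form i x\<bar>) \<le> (\<Sum>i<n. \<Delta> / ?l * S i * \<bar>form i x\<bar>) \<and>
       (\<Sum>i<n. \<Delta> / ?l * S i * \<bar>form i x\<bar>) \<le> \<Delta>\<^sup>2 * (1 + \<epsilon>)\<^sup>2 * (\<Sum>i<n. \<bar>form i x\<bar>)" for x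
    proof (cases "d = 0")
      case True
      then have "form i x = 0" for i by (simp add: column_form_def)
      then show ?thesis by simp
    next
      case d: False
      have "(1 - \<epsilon>)\<^sup>2 * (\<Sum>i<n. \<bar>form i x\<bar>) \<le> 1 * (\<Sum>i<n. \<bar>form i x\<bar>)"
        using eps by (intro mult_right_mono sum_nonneg) (simp_all add: power_le_one)
      moreover have "0 < d" "64 * real d \<le> real T * \<epsilon>\<^sup>2" using d False by simp_all
      ultimately show ?thesis
        using barrier_l1(2,3)[OF minors \<Delta> _ \<open>0 < d\<close> eps _ mp[OF bar \<open>0 < d\<close>], of x] S by auto
    qed
    ultimately show ?thesis using \<tau> S(1) by blast
  qed
  then obtain \<sigma>3 S \<kappa> where r3': "reach ?s 305 5 ?p \<sigma>2 \<sigma>3" and a3: "agree main_vars main_arrays \<sigma>2 \<sigma>3"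
    and v3: "snd \<sigma>3 ''s'' 0 = S" "snd \<sigma>3 ''coef'' 0 0 = \<kappa>" and S: "\<forall>i<n. 0 \<le> S i" "(\<exists>i<n. 0 < S i) \<longrightarrow> 0 < \<kappa>"
    and card: "real (card {i. i < n \<and> 0 < S i}) \<le> 65 * (real d / \<epsilon>\<^sup>2)"
    and bounds: "\<forall>x. (1 - \<epsilon>)\<^sup>2 * (\<Sum>i<n. \<bar>form i x\<bar>) \<le> (\<Sum>i<n. \<kappa> * S i * \<bar>form i x\<bar>) \<and>
       (\<Sum>i<n. \<kappa> * S i * \<bar>form i x\<bar>) \<le> \<Delta>\<^sup>2 * (1 + \<epsilon>)\<^sup>2 * (\<Sum>i<n. \<bar>form i x\<bar>)"
    by blast
  have r3: "reach ?s 306 5 (Cond few_steps trivial_com barrier_com) \<sigma>2 \<sigma>3"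
    using reach_Cond[OF r3'] by simp
  have i3: "inputs d n A \<sigma>3" by (rule inputs_agree[OF i2 a3]) simp_all
  have m3: "fst \<sigma>3 ''m'' = 0" using a3 v2 by (simp add: agree_def)
  define xs where "xs = filter (\<lambda>i. 0 < S i) [0..<n]"
  obtain \<tau> where r4: "reach ?s 11 2 output_com \<sigma>3 \<tau>" and m: "fst \<tau> ''m'' = length xs"
    and V: "\<forall>a<d. \<forall>j<length xs. snd \<tau> ''V'' a j = \<kappa> * S (xs ! j) * A a (xs ! j)"
    using reach_output_com[OF i3 s m3 v3 xs_def] by blast
  have "reach ?s 340 5 sparsify_com ?\<sigma> \<tau>"
    using reach_Seq[OF r1 reach_Seq[OF r2 reach_Seq[OF r3 r4]]] by (simp add: sparsify_com_def)
  moreover have "length xs = card {i. i < n \<and> 0 < S i}"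
  proof -
    have "length xs = card (set xs)" unfolding xs_def by (intro distinct_card[symmetric] distinct_filter) simp
    then show ?thesis by (simp add: xs_def conj_commute)
  qed
  moreover have "xs \<noteq> [] \<longrightarrow> 0 < \<kappa>" using S(2) by (auto simp: xs_def filter_empty_conv)
  ultimately show ?thesis using xs_def m V S(1) card bounds
    by (intro exI[of _ \<tau>] exI[of _ S] exI[of _ \<kappa>] exI[of _ xs]) simp
qed

section \<open>Transfer to matrices and the l1 norm\<close>

lemma l1_norm_transpose:
  assumes "M \<in> carrier_mat d n" "x \<in> carrier_vec d"
  shows "l1_norm (M\<^sup>T *\<^sub>v x) = (\<Sum>i<n. \<bar>column_form d (\<lambda>a i. M $$ (a, i)) i (\<lambda>a. x $ a)\<bar>)"
  using assms by (simp add: l1_norm_def column_form_def scalar_prod_def lessThan_atLeast0)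

theorem theorem3p1:
  shows "\<exists>(C::real) (P::com) (c::nat) (k::nat).
    \<forall>(d::nat) (n::nat) (\<Delta>::real) (W::real mat) (\<epsilon>::real).
      W \<in> carrier_mat d n \<and> delta_modular \<Delta> W \<and> 0 < \<epsilon> \<and> \<epsilon> < 1 \<longrightarrow>
      (\<exists>(n'::nat) (W'::real mat).
        W' \<in> carrier_mat d n' \<and>
        real n' \<le> C * (real d / \<epsilon>\<^sup>2) \<and>
        (\<forall>x \<in> carrier_vec d.
           (1 - \<epsilon>)\<^sup>2 * l1_norm (W\<^sup>T *\<^sub>v x) \<le> l1_norm (W'\<^sup>T *\<^sub>v x) \<and>
           l1_norm (W'\<^sup>T *\<^sub>v x) \<le> \<Delta>\<^sup>2 * (1 + \<epsilon>)\<^sup>2 * l1_norm (W\<^sup>T *\<^sub>v x)) \<and>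
        scaled_column_subset W' W \<and>
        computes_within P W \<Delta> \<epsilon> W' (c * (d + n + 1) ^ k))"
proof (rule exI[of _ 65], rule exI[of _ sparsify_com], rule exI[of _ 340], rule exI[of _ 5], intro allI impI)
  fix d n :: nat and \<Delta> :: real and W :: "real mat" and \<epsilon> :: real
  assume "W \<in> carrier_mat d n \<and> delta_modular \<Delta> W \<and> 0 < \<epsilon> \<and> \<epsilon> < 1"
  then have W: "W \<in> carrier_mat d n" and mod: "delta_modular \<Delta> W" and eps: "0 < \<epsilon>" "\<epsilon> < 1" by auto
  let ?A = "\<lambda>a i. W $$ (a, i)"
  obtain \<tau> S \<kappa> xs where r: "reach (d + n) 340 5 sparsify_com (input_state W \<Delta> \<epsilon>) \<tau>"
    and xs: "xs = filter (\<lambda>i. 0 < S i) [0..<n]" and m: "fst \<tau> ''m'' = length xs"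
    and V: "\<forall>a<d. \<forall>j<length xs. snd \<tau> ''V'' a j = \<kappa> * S (xs ! j) * ?A a (xs ! j)"
    and S: "\<forall>i<n. 0 \<le> S i" and \<kappa>: "xs \<noteq> [] \<longrightarrow> 0 < \<kappa>" and len: "real (length xs) \<le> 65 * (real d / \<epsilon>\<^sup>2)"
    and bounds: "\<forall>x. (1 - \<epsilon>)\<^sup>2 * (\<Sum>i<n. \<bar>column_form d ?A i x\<bar>) \<le> (\<Sum>i<n. \<kappa> * S i * \<bar>column_form d ?A i x\<bar>) \<and>
       (\<Sum>i<n. \<kappa> * S i * \<bar>column_form d ?A i x\<bar>) \<le> \<Delta>\<^sup>2 * (1 + \<epsilon>)\<^sup>2 * (\<Sum>i<n. \<bar>column_form d ?A i x\<bar>)"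
    using reach_sparsify_com[OF W mod eps] by (elim exE conjE) (rule that; assumption)
  define W' where "W' = output_matrix d \<tau>"
  have W': "W' \<in> carrier_mat d (length xs)" by (simp add: W'_def output_matrix_def m)
  have entry: "W' $$ (a, j) = \<kappa> * S (xs ! j) * ?A a (xs ! j)" if "a < d" "j < length xs" for a j
    using that V by (simp add: W'_def output_matrix_def m)
  have set_xs: "set xs = {i. i < n \<and> 0 < S i}" and dist: "distinct xs" by (auto simp: xs)
  have nth_xs: "xs ! j < n" "0 < S (xs ! j)" if "j < length xs" for j
    using nth_mem[OF that] unfolding set_xs by auto
  have \<kappa>0: "0 < \<kappa>" if "j < length xs" for j using \<kappa> that by auto
  have norm: "l1_norm (W'\<^sup>T *\<^sub>v x) = (\<Sum>i<n. \<kappa> * S i * \<bar>column_form d ?A i (\<lambda>a. x $ a)\<bar>)"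
    if x: "x \<in> carrier_vec d" for x
  proof -
    have "l1_norm (W'\<^sup>T *\<^sub>v x) = (\<Sum>j<length xs. \<bar>column_form d (\<lambda>a i. W' $$ (a, i)) j (\<lambda>a. x $ a)\<bar>)"
      using W' x by (rule l1_norm_transpose)
    also have "\<dots> = (\<Sum>j<length xs. \<kappa> * S (xs ! j) * \<bar>column_form d ?A (xs ! j) (\<lambda>a. x $ a)\<bar>)"
    proof (intro sum.cong refl)
      fix j assume "j \<in> {..<length xs}"
      then have j: "j < length xs" by simp
      have "column_form d (\<lambda>a i. W' $$ (a, i)) j (\<lambda>a. x $ a) = \<kappa> * S (xs ! j) * column_form d ?A (xs ! j) (\<lambda>a. x $ a)"
        using j by (simp add: column_form_def entry sum_distrib_left mult.assoc)
      then show "\<bar>column_form d (\<lambda>a i. W' $$ (a, i)) j (\<lambda>a. x $ a)\<bar> = \<kappa> * S (xs ! j) * \<bar>column_form d ?A (xs ! j) (\<lambda>a. x $ a)\<bar>"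
        using \<kappa>0[OF j] nth_xs[OF j] by (simp add: abs_mult)
    qed
    also have "\<dots> = (\<Sum>i\<in>set xs. \<kappa> * S i * \<bar>column_form d ?A i (\<lambda>a. x $ a)\<bar>)"
      using sum.reindex_bij_betw[OF bij_betw_nth[OF dist refl refl]] .
    \<comment> \<open>Weights are nonnegative, so an index missing from \<open>xs\<close> has weight
      zero and contributes nothing.\<close>
    also have "\<dots> = (\<Sum>i<n. \<kappa> * S i * \<bar>column_form d ?A i (\<lambda>a. x $ a)\<bar>)"
      using S by (intro sum.mono_neutral_left) (force simp: set_xs)+
    finally show ?thesis .
  qed
  have "scaled_column_subset W' W" unfolding scaled_column_subset_def
  proof (intro exI[of _ "\<lambda>j. xs ! j"] exI[of _ "\<lambda>j. \<kappa> * S (xs ! j)"] conjI allI impI)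
    show "inj_on ((!) xs) {..<dim_col W'}" using W' dist by (auto intro!: inj_on_nth)
    show "(!) xs ` {..<dim_col W'} \<subseteq> {..<dim_col W}" using W W' nth_xs by auto
    fix j assume "j < dim_col W'"
    then have j: "j < length xs" using W' by simp
    show "0 < \<kappa> * S (xs ! j)" using \<kappa>0[OF j] nth_xs[OF j] by simp
    show "col W' j = \<kappa> * S (xs ! j) \<cdot>\<^sub>v col W (xs ! j)"
      using W W' j nth_xs[OF j] entry by (intro eq_vecI) auto
  qed
  moreover have "computes_within sparsify_com W \<Delta> \<epsilon> W' (340 * (d + n + 1) ^ 5)"
  proof -
    obtain t where "exec sparsify_com (input_state W \<Delta> \<epsilon>) t \<tau>" "t \<le> 340 * (d + n + 1) ^ 5"
      using r by (auto simp: reach_def)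
    then show ?thesis using W unfolding computes_within_def W'_def
      by (intro exI[of _ t] exI[of _ \<tau>]) simp
  qed
  moreover have "(1 - \<epsilon>)\<^sup>2 * l1_norm (W\<^sup>T *\<^sub>v x) \<le> l1_norm (W'\<^sup>T *\<^sub>v x) \<and>
      l1_norm (W'\<^sup>T *\<^sub>v x) \<le> \<Delta>\<^sup>2 * (1 + \<epsilon>)\<^sup>2 * l1_norm (W\<^sup>T *\<^sub>v x)" if "x \<in> carrier_vec d" for x
    unfolding norm[OF that] l1_norm_transpose[OF W that] using bounds by blast
  ultimately show "\<exists>n' W'. W' \<in> carrier_mat d n' \<and> real n' \<le> 65 * (real d / \<epsilon>\<^sup>2) \<and>
        (\<forall>x \<in> carrier_vec d.
           (1 - \<epsilon>)\<^sup>2 * l1_norm (W\<^sup>T *\<^sub>v x) \<le> l1_norm (W'\<^sup>T *\<^sub>v x) \<and>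
           l1_norm (W'\<^sup>T *\<^sub>v x) \<le> \<Delta>\<^sup>2 * (1 + \<epsilon>)\<^sup>2 * l1_norm (W\<^sup>T *\<^sub>v x)) \<and>
        scaled_column_subset W' W \<and>
        computes_within sparsify_com W \<Delta> \<epsilon> W' (340 * (d + n + 1) ^ 5)"
    using W' len by blast
qed

end
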